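(* Let $d\ge 2$, $q\in\{1,\ldots,d-1\}$, $\gamma\in\{0,\ldots,q-1\}$ and $u>0$ be fixed. For each $K\le 0$ let $\mathbf{L}$ be a random element of $G_K(d,q)$ with distribution $\nu_{q,K}$ and let $\mathbf{E}$ be a random element of $A_K(d,d-q+\gamma)$, independent of $\mathbf{L}$, whose distribution is the restriction of $C_K(d,d-q+\gamma,u)^{-1}\mu_{d-q+\gamma,K}$ to $[uB_K^d]_{d-q+\gamma,K}$, and let $\mathcal{L}(K)$ denote the law of the $[0,+\infty]$-valued random variable $d_K(o,\mathbf{E}\cap\mathbf{L})$. Then $$\mathcal{L}(K)\longrightarrow\mathcal{L}(0)\quad\text{weakly, as } K\uparrow 0.$$ In particular, $$\lim_{K\uparrow 0}\mathbb{P}(\mathbf{E}\cap\mathbf{L}\neq\varnothing)=1.$$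
   Context: For $K<0$, $\mathbb{M}_K^d$ is the $d$-dimensional simply connected complete space of constant sectional curvature $K$ (hyperbolic space); $\mathbb{M}_0^d=\mathbb{R}^d$. $d_K$ denotes the Riemannian (for $K=0$, Euclidean) distance and $o$ a fixed point (the origin; for $K=0$, $o=(0,\ldots,0)$). For $F\subset\mathbb{M}_K^d$, $d_K(o,F):=\inf\{d_K(o,x):x\in F\}$, with $\inf\varnothing=+\infty$. $uB_K^d:=\{x\in\mathbb{M}_K^d: d_K(x,o)\le u\}$. For a dimension $k$, a $k$-flat is a (complete) $k$-dimensional totally geodesic submanifold of $\mathbb{M}_K^d$; for $K=0$ these are the $k$-dimensional affine subspaces, and for $K<0$ they are, in the Beltrami-Klein model, the non-empty intersections of $k$-dimensional affine subspaces of $\mathbb{R}^d$ with the open Euclidean ball of radius $1/\sqrt{-K}$. $A_K(d,k)$ is the space of all $k$-flats, $G_K(d,k)$ the space of all $k$-flats passing through $o$. $\nu_{k,K}$ is the unique Borel probability measure on $G_K(d,k)$ invariant under all isometries of $\mathbb{M}_K^d$ fixing $o$. $\mu_{k,K}$ is the isometry-invariant measure on $A_K(d,k)$ normalized as follows: for $K=0$, $$\mu_{k,0}(\cdot)=\int_{G_0(d,k)}\int_{L^\perp}\mathbf{1}\{L+x\in\cdot\}\,\lambda_{L^\perp}(\mathrm{d}x)\,\nu_{k,0}(\mathrm{d}L),$$ with $\lambda_{L^\perp}$ the Lebesgue measure on the orthogonal complement $L^\perp$; for $K<0$, $$\mu_{k,K}(\cdot)=\int_{G_K(d,d-k)}\int_L\mathbf{1}\{E(L,x)\in\cdot\}\cosh^k(\sqrt{-K}\,d_K(x,o))\,\mathcal{H}_K^{d-k}(\mathrm{d}x)\,\nu_{d-k,K}(\mathrm{d}L),$$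 where $E(L,x)$ is the unique $k$-flat passing through $x$ orthogonally to $L$ and $\mathcal{H}_K^{d-k}$ is the $(d-k)$-dimensional Hausdorff measure with respect to $d_K$. $[uB_K^d]_{k,K}:=\{E\in A_K(d,k):E\cap uB_K^d\neq\varnothing\}$ and $C_K(d,k,u):=\mu_{k,K}([uB_K^d]_{k,K})$. With $\omega_n:=2\pi^{n/2}/\Gamma(n/2)$ one has $C_0(d,k,u)=\frac{1}{d-k}\omega_{d-k}u^{d-k}$ and, for $K<0$, $C_K(d,k,u)=\omega_{d-k}(\sqrt{-K})^{-d+k+1}\int_0^u\cosh^k(\sqrt{-K}r)\sinh^{d-k-1}(\sqrt{-K}r)\,\mathrm{d}r$. Weak convergence is weak convergence of probability measures on $[0,+\infty]$. *)

theory Defs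
  imports "HOL-Probability.Probability"
begin

text \<open>
  The \<open>d\<close>-dimensional space of constant curvature \<open>K \<le> 0\<close> is modelled on a type
  \<open>'a::euclidean_space\<close> with \<open>d = DIM('a)\<close>: for \<open>K = 0\<close> it is the Euclidean space itself, for
  \<open>K < 0\<close> the Beltrami-Klein ball of radius \<open>1 / sqrt (- K)\<close>. The base point \<open>o\<close> is \<open>0\<close> in both
  cases. In either model the topology of the space is the one inherited from \<open>'a\<close>.
\<close>

definition space_form :: "real \<Rightarrow> 'a::euclidean_space set" where
  "space_form K = (if K = 0 then UNIV else ball 0 (1 / sqrt (- K)))"

text \<open>Riemannian distance; for \<open>K < 0\<close> the hyperbolic distance in Beltrami-Klein coordinates,
  \<open>cosh (sqrt (- K) * d) = (1 + K * (x \<bullet> y)) / sqrt ((1 + K * |x|^2) * (1 + K * |y|^2))\<close>.\<close>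

definition sf_dist :: "real \<Rightarrow> 'a::euclidean_space \<Rightarrow> 'a \<Rightarrow> real" where
  "sf_dist K x y =
     (if K = 0 then dist x y
      else arcosh ((1 + K * (x \<bullet> y)) /
                   (sqrt (1 + K * (norm x)\<^sup>2) * sqrt (1 + K * (norm y)\<^sup>2))) / sqrt (- K))"

text \<open>The Riemannian metric tensor at \<open>x\<close> in the same coordinates.\<close>

definition sf_inner :: "real \<Rightarrow> 'a::euclidean_space \<Rightarrow> 'a \<Rightarrow> 'a \<Rightarrow> real" where
  "sf_inner K x v w =
     (v \<bullet> w) / (1 + K * (norm x)\<^sup>2) - K * (x \<bullet> v) * (x \<bullet> w) / (1 + K * (norm x)\<^sup>2)\<^sup>2"

definition sf_ball :: "real \<Rightarrow> real \<Rightarrow> 'a::euclidean_space set" where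
  "sf_ball K u = {x \<in> space_form K. sf_dist K x 0 \<le> u}"

text \<open>Distance of a set from the base point, with value \<open>\<infinity>\<close> for the empty set.\<close>

definition sf_setdist :: "real \<Rightarrow> 'a::euclidean_space set \<Rightarrow> ennreal" where
  "sf_setdist K F = (INF x\<in>F. ennreal (sf_dist K 0 x))"

text \<open>Self-maps of the space; values of \<open>\<phi>\<close> outside \<open>space_form K\<close> are irrelevant.\<close>

definition sf_isometry :: "real \<Rightarrow> ('a::euclidean_space \<Rightarrow> 'a) \<Rightarrow> bool" where
  "sf_isometry K \<phi> \<longleftrightarrow> bij_betw \<phi> (space_form K) (space_form K) \<and>
     (\<forall>x\<in>space_form K. \<forall>y\<in>space_form K. sf_dist K (\<phi> x) (\<phi> y) = sf_dist K x y)"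


text \<open>\<open>flats K k\<close> is \<open>A_K(d,k)\<close> and \<open>flats0 K k\<close> is \<open>G_K(d,k)\<close>.\<close>

definition flats :: "real \<Rightarrow> nat \<Rightarrow> 'a::euclidean_space set set" where
  "flats K k = {A \<inter> space_form K | A. affine A \<and> aff_dim A = int k \<and> A \<inter> space_form K \<noteq> {}}"

definition flats0 :: "real \<Rightarrow> nat \<Rightarrow> 'a::euclidean_space set set" where
  "flats0 K k = {L \<in> flats K k. 0 \<in> L}"

text \<open>The Fell (hit-or-miss) topology on the closed subsets of a space \<open>X\<close>. Its trace on the flats
  of a fixed dimension is the usual topology on \<open>A_K(d,k)\<close> and on \<open>G_K(d,k)\<close>.\<close>

definition fell_topology :: "'a::topological_space set \<Rightarrow> 'a set topology" where
  "fell_topology X = topology_generated_by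
     ({{F. closedin (top_of_set X) F \<and> F \<inter> C = {}} | C. compact C \<and> C \<subseteq> X} \<union>
      {{F. closedin (top_of_set X) F \<and> F \<inter> U \<noteq> {}} | U. openin (top_of_set X) U})"

definition borel_of :: "'b topology \<Rightarrow> 'b measure" where
  "borel_of T = sigma (topspace T) {U. openin T U}"

definition flats_borel :: "real \<Rightarrow> nat \<Rightarrow> 'a::euclidean_space set measure" where
  "flats_borel K k = borel_of (subtopology (fell_topology (space_form K)) (flats K k))"

definition flats0_borel :: "real \<Rightarrow> nat \<Rightarrow> 'a::euclidean_space set measure" where
  "flats0_borel K k = borel_of (subtopology (fell_topology (space_form K)) (flats0 K k))"

text \<open>The probability measure \<open>\<nu>_{k,K}\<close> on \<open>G_K(d,k)\<close>.\<close>

definition flats0_measure :: "real \<Rightarrow> nat \<Rightarrow> 'a::euclidean_space set measure" where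
  "flats0_measure K k = (THE \<nu>. prob_space \<nu> \<and>
     space \<nu> = space (flats0_borel K k) \<and> sets \<nu> = sets (flats0_borel K k) \<and>
     (\<forall>\<phi>. sf_isometry K \<phi> \<and> \<phi> 0 = 0 \<longrightarrow>
        (\<forall>A\<in>sets \<nu>. emeasure \<nu> ((\<lambda>L. \<phi> ` L) ` A) = emeasure \<nu> A)))"


text \<open>Hausdorff measure of a metric \<open>d\<close> on \<open>X\<close>, normalised so that \<open>m\<close>-dimensional Hausdorff measure
  agrees with Lebesgue measure on Euclidean \<open>m\<close>-space. Empty covering sets contribute nothing
  (this matters only for \<open>m = 0\<close>).\<close>

definition ediam :: "('a \<Rightarrow> 'a \<Rightarrow> real) \<Rightarrow> 'a set \<Rightarrow> ennreal" where
  "ediam d C = (SUP x\<in>C. SUP y\<in>C. ennreal (d x y))"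

definition hausdorff_pre ::
    "'a set \<Rightarrow> ('a \<Rightarrow> 'a \<Rightarrow> real) \<Rightarrow> nat \<Rightarrow> real \<Rightarrow> 'a set \<Rightarrow> ennreal" where
  "hausdorff_pre X d m \<delta> A =
     (INF C\<in>{C :: nat \<Rightarrow> 'a set. A \<subseteq> (\<Union>i. C i) \<and> (\<forall>i. C i \<subseteq> X \<and> ediam d (C i) \<le> ennreal \<delta>)}.
        \<Sum>i. if C i = {} then 0 else ennreal (unit_ball_vol (real m)) * (ediam d (C i) / 2) ^ m)"

definition hausdorff_measure ::
    "'a::topological_space set \<Rightarrow> ('a \<Rightarrow> 'a \<Rightarrow> real) \<Rightarrow> nat \<Rightarrow> 'a measure" where
  "hausdorff_measure X d m =
     measure_of X (sets (restrict_space borel X)) (\<lambda>A. SUP \<delta>\<in>{0<..}. hausdorff_pre X d m \<delta> A)"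

text \<open>Lebesgue measure on a linear subspace \<open>V\<close>, as a measure on the ambient space concentrated on
  \<open>V\<close>: the image of product Lebesgue measure under orthonormal coordinates. By rotation invariance
  the choice of the orthonormal basis is immaterial.\<close>

definition subspace_lborel :: "'a::euclidean_space set \<Rightarrow> 'a measure" where
  "subspace_lborel V =
     (let B = (SOME B. pairwise orthogonal B \<and> (\<forall>b\<in>B. norm b = 1) \<and> span B = V)
      in distr (\<Pi>\<^sub>M b\<in>B. lborel) borel (\<lambda>f. \<Sum>b\<in>B. f b *\<^sub>R b))"

text \<open>\<open>E(L,x)\<close>: the \<open>k\<close>-flat through \<open>x\<close> orthogonal to \<open>L\<close> there. Since flats are relatively open
  parts of affine subspaces in these coordinates, the differences \<open>y - x\<close> (\<open>y\<close> in the flat) span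
  the tangent space at \<open>x\<close>.\<close>

definition perp_flat :: "real \<Rightarrow> nat \<Rightarrow> 'a::euclidean_space set \<Rightarrow> 'a \<Rightarrow> 'a set" where
  "perp_flat K k L x =
     (THE E. E \<in> flats K k \<and> x \<in> E \<and> (\<forall>y\<in>E. \<forall>z\<in>L. sf_inner K x (y - x) (z - x) = 0))"

text \<open>The invariant measure \<open>\<mu>_{k,K}\<close> on \<open>A_K(d,k)\<close>.\<close>

definition flats_measure :: "real \<Rightarrow> nat \<Rightarrow> 'a::euclidean_space set measure" where
  "flats_measure K k = measure_of (space (flats_borel K k)) (sets (flats_borel K k))
     (\<lambda>\<A>. if K = 0
        then \<integral>\<^sup>+ L. (\<integral>\<^sup>+ x. indicator \<A> ((\<lambda>y. y + x) ` L) \<partial>subspace_lborel (orthogonal_comp L))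
               \<partial>flats0_measure 0 k
        else \<integral>\<^sup>+ L. (\<integral>\<^sup>+ x\<in>L. (indicator \<A> (perp_flat K k L x) *
                            ennreal (cosh (sqrt (- K) * sf_dist K x 0) ^ k))
                      \<partial>hausdorff_measure (space_form K) (sf_dist K) (DIM('a) - k))
               \<partial>flats0_measure K (DIM('a) - k))"

definition hitting_flats :: "real \<Rightarrow> nat \<Rightarrow> real \<Rightarrow> 'a::euclidean_space set set" where
  "hitting_flats K k u = {E \<in> flats K k. E \<inter> sf_ball K u \<noteq> {}}"

text \<open>The constant \<open>C_K(d,k,u)\<close>.\<close>

definition hitting_const :: "'a::euclidean_space itself \<Rightarrow> real \<Rightarrow> nat \<Rightarrow> real \<Rightarrow> ennreal" where
  "hitting_const _ K k u =
     emeasure (flats_measure K k :: 'a set measure) (hitting_flats K k u)"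

text \<open>The restriction of \<open>C_K(d,k,u)\<^sup>-\<^sup>1 \<mu>_{k,K}\<close> to the flats hitting the ball of radius \<open>u\<close>,
  regarded as a measure on all of \<open>A_K(d,k)\<close>.\<close>

definition hitting_law :: "real \<Rightarrow> nat \<Rightarrow> real \<Rightarrow> 'a::euclidean_space set measure" where
  "hitting_law K k u = density (flats_measure K k)
     (\<lambda>E. indicator (hitting_flats K k u) E / hitting_const TYPE('a) K k u)"


text \<open>Weak convergence of Borel probability measures on a topological space, along a filter.
  The library notion only covers sequences of measures on the real line.\<close>

definition weak_conv_prob ::
    "('i \<Rightarrow> 'b::topological_space measure) \<Rightarrow> 'b measure \<Rightarrow> 'i filter \<Rightarrow> bool" where
  "weak_conv_prob M N F \<longleftrightarrow>
     (\<forall>\<^sub>F i in F. prob_space (M i) \<and> sets (M i) = sets borel) \<and>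
     prob_space N \<and> sets N = sets borel \<and>
     (\<forall>f :: 'b \<Rightarrow> real. continuous_on UNIV f \<and> bounded (range f) \<longrightarrow>
        ((\<lambda>i. \<integral>x. f x \<partial>M i) \<longlongrightarrow> (\<integral>x. f x \<partial>N)) F)"

end

theory Submission
  imports Defs
begin

text \<open>
  In the Beltrami-Klein model flats are traces of affine subspaces, so that the spaces of all
  curvatures \<open>K \<le> 0\<close> live on one vector space and can be compared there directly. The idea of the
  proof is to realise, up to a multiplicative error tending to \<open>1\<close>, the random flats of all
  curvatures on one probability space on which the distance converges pointwise.

  \<^item> Flats through the base point are traces of linear subspaces, and isometries fixing the base point
    are restrictions of orthogonal maps (\<open>sf_isometry_orthogonal\<close>). Hence the law of \<open>L\<close> is for every
    \<open>K\<close> the trace of one and the same measure \<open>haar\<close> on the Grassmannian (\<open>flats0_measure_eq\<close>), the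
    unique rotation-invariant probability measure (\<open>rot_inv_unique\<close>, \<open>rot_inv_exists\<close>).

  \<^item> At a point \<open>x\<close> of a linear subspace \<open>V\<close>, hyperbolic and Euclidean orthogonality to \<open>V\<close> agree, so
    \<open>E(V, x)\<close> is the trace of \<open>x + V\<^sup>\<bottom>\<close> (\<open>perp_flat_eq\<close>). The random flat \<open>E\<close> is thus given by a
    direction \<open>V\<close> with law \<open>haar\<close> and a point \<open>x\<close> of \<open>V\<close> in a ball; conditionally on \<open>V\<close>, the law
    of the point is, up to normalisation and a density close to \<open>1\<close>, the measure on \<open>V\<close> entering the definition of \<open>\<mu>\<close>.

  \<^item> For \<open>K < 0\<close> that measure is a Hausdorff measure. It is invariant under rotations, and it is
    quasi-invariant under translations because the hyperbolic metric is bi-Lipschitz to the Euclidean one with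
    constants tending to \<open>1\<close> (\<open>sf_dist_bilipschitz\<close>, \<open>hausdorff_outer_lipschitz\<close>). A Fubini argument
    (\<open>Fubini_comparison\<close>, \<open>kernel_bound\<close>) compares every quasi-invariant measure with the projection of
    Lebesgue measure on a cylinder around \<open>V\<close>, up to a total mass that cancels on normalisation.

  \<^item> This yields \<open>law of E \<le> theta * law of samp_flat\<close> with \<open>theta\<close> tending to \<open>1\<close> (\<open>law_bound\<close>,
    \<open>law_bound_hyperbolic\<close>, \<open>law_bound_euclidean\<close>). Both sides being probability measures up to the
    factor, expectations of bounded functions differ by a multiple of \<open>theta - 1\<close>
    (\<open>expectation_samp\<close>). For fixed \<open>V\<close>, \<open>L\<close> and sample point, the affine set \<open>E \<inter> L\<close> scales with the
    radius of the ball, and its distance from the base point converges (\<open>samp_dist_tendsto\<close>);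
    dominated convergence gives weak convergence.

  \<^item> Almost all \<open>L\<close> are transversal to the direction of a given \<open>E\<close>, and then the Euclidean flats meet
    (\<open>AE_samp_dist_finite\<close>). For a fixed sample the flats meet for all small \<open>\<bar>K\<bar>\<close> iff they
    meet for \<open>K = 0\<close> (\<open>samp_dist_tendsto\<close>), which gives the limit of the probability of a non-empty intersection.
\<close>

section \<open>Orthogonal projections and orthogonal maps\<close>

definition orth_proj :: "'a::euclidean_space set \<Rightarrow> 'a \<Rightarrow> 'a" where
  "orth_proj V x = (SOME p. p \<in> V \<and> (\<forall>w\<in>V. (x - p) \<bullet> w = 0))"

lemma mem_orthogonal_comp: "x \<in> V\<^sup>\<bottom> \<longleftrightarrow> (\<forall>w\<in>V. x \<bullet> w = 0)"
  by (auto simp: orthogonal_comp_def orthogonal_def inner_commute)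

lemma orth_proj:
  fixes V :: "'a::euclidean_space set"
  assumes "subspace V"
  shows "orth_proj V x \<in> V" and "\<And>w. w \<in> V \<Longrightarrow> (x - orth_proj V x) \<bullet> w = 0"
proof -
  obtain y z where "y \<in> span V" "\<And>w. w \<in> span V \<Longrightarrow> orthogonal z w" "x = y + z"
    using orthogonal_subspace_decomp_exists by blast
  then have "\<exists>p. p \<in> V \<and> (\<forall>w\<in>V. (x - p) \<bullet> w = 0)"
    using assms by (intro exI[of _ y]) (auto simp: orthogonal_def span_base span_eq_iff[THEN iffD2])
  then have *: "orth_proj V x \<in> V \<and> (\<forall>w\<in>V. (x - orth_proj V x) \<bullet> w = 0)"
    unfolding orth_proj_def by (rule someI_ex)
  then show "orth_proj V x \<in> V" and "\<And>w. w \<in> V \<Longrightarrow> (x - orth_proj V x) \<bullet> w = 0"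
    by auto
qed

lemma orth_proj_unique:
  assumes V: "subspace V" and p: "p \<in> V" "\<And>w. w \<in> V \<Longrightarrow> (x - p) \<bullet> w = 0"
  shows "orth_proj V x = p"
proof -
  let ?q = "orth_proj V x"
  have d: "?q - p \<in> V"
    using orth_proj[OF V, of x] p subspace_diff[OF V] by blast
  have "(?q - p) \<bullet> (?q - p) = (x - p) \<bullet> (?q - p) - (x - ?q) \<bullet> (?q - p)"
    by (simp add: inner_diff_left)
  also have "\<dots> = 0"
    using p(2)[OF d] orth_proj(2)[OF V d] by simp
  finally show ?thesis by simp
qed

lemma linear_orth_proj:
  assumes V: "subspace V"
  shows "linear (orth_proj V)"
proof (rule linearI)
  show "orth_proj V (x + y) = orth_proj V x + orth_proj V y" for x y
  proof (rule orth_proj_unique[OF V])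
    show "orth_proj V x + orth_proj V y \<in> V"
      using orth_proj(1)[OF V] subspace_add[OF V] by blast
    show "(x + y - (orth_proj V x + orth_proj V y)) \<bullet> w = 0" if "w \<in> V" for w
      using orth_proj(2)[OF V that, of x] orth_proj(2)[OF V that, of y]
      by (simp add: inner_diff_left inner_add_left)
  qed
  show "orth_proj V (c *\<^sub>R x) = c *\<^sub>R orth_proj V x" for c x
  proof (rule orth_proj_unique[OF V])
    show "c *\<^sub>R orth_proj V x \<in> V"
      using orth_proj(1)[OF V] subspace_scale[OF V] by blast
    show "(c *\<^sub>R x - c *\<^sub>R orth_proj V x) \<bullet> w = 0" if "w \<in> V" for w
      using orth_proj(2)[OF V that, of x] by (simp add: inner_diff_left)
  qed
qed

lemma orth_proj_self: "subspace V \<Longrightarrow> x \<in> V \<Longrightarrow> orth_proj V x = x"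
  by (rule orth_proj_unique) auto

lemma orth_proj_perp_zero: "subspace V \<Longrightarrow> x \<in> V\<^sup>\<bottom> \<Longrightarrow> orth_proj V x = 0"
  by (rule orth_proj_unique) (auto simp: subspace_0 mem_orthogonal_comp)

lemma perp_perp: "subspace (V :: 'a::euclidean_space set) \<Longrightarrow> V\<^sup>\<bottom>\<^sup>\<bottom> = V"
  by (rule orthogonal_comp_self)

lemma orth_proj_perp:
  assumes V: "subspace (V :: 'a::euclidean_space set)"
  shows "orth_proj (V\<^sup>\<bottom>) x = x - orth_proj V x"
proof (rule orth_proj_unique[OF subspace_orthogonal_comp])
  show "x - orth_proj V x \<in> V\<^sup>\<bottom>"
    using orth_proj(2)[OF V] by (auto simp: mem_orthogonal_comp)
  show "(x - (x - orth_proj V x)) \<bullet> w = 0" if "w \<in> V\<^sup>\<bottom>" for w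
    using that orth_proj(1)[OF V, of x] by (auto simp: mem_orthogonal_comp inner_commute)
qed

text \<open>Pythagoras; in particular \<open>orth_proj V x\<close> is the point of \<open>V\<close> nearest to \<open>x\<close>, so that distances to
  \<open>V\<close> are norms of orthogonal components.\<close>

lemma orth_proj_minimal:
  assumes V: "subspace (V :: 'a::euclidean_space set)" and w: "w \<in> V"
  shows "(norm (x - w))\<^sup>2 = (norm (x - orth_proj V x))\<^sup>2 + (norm (orth_proj V x - w))\<^sup>2"
proof -
  let ?p = "orth_proj V x"
  have "?p - w \<in> V" using orth_proj(1)[OF V] w subspace_diff[OF V] by blast
  then have "(x - ?p) \<bullet> (?p - w) = 0" by (rule orth_proj(2)[OF V])
  then show ?thesis
    unfolding power2_norm_eq_inner by (simp add: inner_diff_left inner_diff_right inner_commute)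
qed

lemma infdist_subspace:
  assumes V: "subspace (V :: 'a::euclidean_space set)"
  shows "infdist x V = norm (x - orth_proj V x)"
proof (rule antisym)
  show "infdist x V \<le> norm (x - orth_proj V x)"
    using infdist_le[OF orth_proj(1)[OF V], of x x] by (simp add: dist_norm)
  have ne: "V \<noteq> {}" using V subspace_0 by blast
  have "norm (x - orth_proj V x) \<le> dist x w" if "w \<in> V" for w
  proof -
    have "(norm (x - orth_proj V x))\<^sup>2 \<le> (norm (x - w))\<^sup>2"
      using orth_proj_minimal[OF V that, of x] by simp
    then show ?thesis by (simp add: dist_norm)
  qed
  then show "norm (x - orth_proj V x) \<le> infdist x V"
    unfolding infdist_notempty[OF ne] by (intro cINF_greatest[OF ne])
qed

lemma infdist_perp:
  "subspace V \<Longrightarrow> infdist x (V\<^sup>\<bottom>) = norm (orth_proj V x)"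
  by (simp add: infdist_subspace subspace_orthogonal_comp orth_proj_perp)

lemma infdist_pythagoras:
  assumes V: "subspace (V :: 'a::euclidean_space set)"
  shows "(norm x)\<^sup>2 = (infdist x V)\<^sup>2 + (infdist x (V\<^sup>\<bottom>))\<^sup>2"
  using orth_proj_minimal[OF V subspace_0[OF V], of x] by (simp add: infdist_perp[OF V] infdist_subspace[OF V])

lemma infdist_scale:
  assumes V: "subspace (V :: 'a::euclidean_space set)"
  shows "infdist (c *\<^sub>R x) V = \<bar>c\<bar> * infdist x V"
proof -
  have "c *\<^sub>R x - orth_proj V (c *\<^sub>R x) = c *\<^sub>R (x - orth_proj V x)"
    using linear_scale[OF linear_orth_proj[OF V]] by (simp add: scaleR_diff_right)
  then show ?thesis by (simp add: infdist_subspace V)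
qed

lemma infdist_le_norm: "subspace (V :: 'a::euclidean_space set) \<Longrightarrow> infdist x V \<le> norm x"
  using infdist_le[OF subspace_0, of V x] by simp

lemma infdist_add_subspace:
  assumes V: "subspace (V :: 'a::euclidean_space set)" and w: "w \<in> V"
  shows "infdist (x + w) V = infdist x V"
  using linear_add[OF linear_orth_proj[OF V], of x w] orth_proj_self[OF V w]
  by (simp add: infdist_subspace V)

lemma infdist_subspace_eq_0: "subspace (V :: 'a::euclidean_space set) \<Longrightarrow> infdist x V = 0 \<longleftrightarrow> x \<in> V"
  using in_closed_iff_infdist_zero[OF closed_subspace, of V x] subspace_0[of V] by auto

lemma infdist_subspace_less_iff:
  assumes V: "subspace (V :: 'a::euclidean_space set)"
  shows "infdist x V < r \<longleftrightarrow> V \<inter> ball x r \<noteq> {}"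
proof
  assume "infdist x V < r"
  then have "orth_proj V x \<in> V \<inter> ball x r"
    by (auto simp: infdist_subspace V orth_proj(1) dist_norm)
  then show "V \<inter> ball x r \<noteq> {}" by blast
next
  assume "V \<inter> ball x r \<noteq> {}"
  then obtain w where "w \<in> V" "dist x w < r" by auto
  then show "infdist x V < r" using infdist_le[of w V x] by simp
qed

lemma dim_perp: "subspace V \<Longrightarrow> dim (V\<^sup>\<bottom>) = DIM('a) - dim (V :: 'a::euclidean_space set)"
  using dim_subspace_orthogonal_to_vectors[OF _ subspace_UNIV, of V]
  by (simp add: orthogonal_comp_def)

lemma orthogonal_transformation_inner: "orthogonal_transformation R \<Longrightarrow> R x \<bullet> R y = x \<bullet> y"
  by (simp add: orthogonal_transformation_def)

lemma infdist_orthogonal_image: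
  assumes R: "orthogonal_transformation (R :: 'a::euclidean_space \<Rightarrow> 'a)" and V: "subspace V"
  shows "infdist (R x) (R ` V) = infdist x V"
proof -
  have ne: "V \<noteq> {}" using V subspace_0 by blast
  have "dist (R x) (R a) = dist x a" for a
    using orthogonal_transformation_isometry[THEN iffD1, OF R] by blast
  then show ?thesis using ne by (simp add: infdist_notempty image_image)
qed

lemma perp_orthogonal_image:
  assumes R: "orthogonal_transformation (R :: 'a::euclidean_space \<Rightarrow> 'a)"
  shows "(R ` V)\<^sup>\<bottom> = R ` (V\<^sup>\<bottom>)"
proof (intro set_eqI iffI)
  fix x assume x: "x \<in> (R ` V)\<^sup>\<bottom>"
  obtain y where y: "x = R y" using orthogonal_transformation_surj[OF R] by (metis surjD)
  have "y \<in> V\<^sup>\<bottom>"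
    using x unfolding y by (auto simp: mem_orthogonal_comp orthogonal_transformation_inner[OF R])
  then show "x \<in> R ` (V\<^sup>\<bottom>)" using y by blast
qed (auto simp: mem_orthogonal_comp orthogonal_transformation_inner[OF R])

lemma subspace_orthogonal_image:
  "orthogonal_transformation R \<Longrightarrow> subspace V \<Longrightarrow> subspace (R ` V)"
  by (simp add: linear_subspace_image orthogonal_transformation_linear)

lemma dim_orthogonal_image:
  "orthogonal_transformation (R :: 'a::euclidean_space \<Rightarrow> 'a) \<Longrightarrow> dim (R ` V) = dim V"
  by (intro dim_image_eq)
    (auto simp: orthogonal_transformation_linear intro: inj_on_subset[OF orthogonal_transformation_inj])

text \<open>An isometry between two subspaces of equal dimension and one between their complements
  combine to an orthogonal map of the whole space.\<close>

lemma orthogonal_transformation_subspace_transitive: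
  fixes V W :: "'a::euclidean_space set"
  assumes V: "subspace V" and W: "subspace W" and d: "dim V = dim W"
  obtains R where "orthogonal_transformation R" "R ` V = W"
proof -
  obtain f where f: "linear f" "f ` V = W" "\<And>x. x \<in> V \<Longrightarrow> norm (f x) = norm x"
    using isometries_subspaces[OF V W d] by metis
  have "dim (V\<^sup>\<bottom>) = dim (W\<^sup>\<bottom>)" using dim_perp[OF V] dim_perp[OF W] d by simp
  then obtain g where g: "linear g" "g ` (V\<^sup>\<bottom>) = W\<^sup>\<bottom>" "\<And>x. x \<in> V\<^sup>\<bottom> \<Longrightarrow> norm (g x) = norm x"
    using isometries_subspaces[OF subspace_orthogonal_comp[of V] subspace_orthogonal_comp[of W]] by metis
  define R where "R = (\<lambda>x. f (orth_proj V x) + g (orth_proj (V\<^sup>\<bottom>) x))"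
  have "linear R"
    unfolding R_def
    using linear_compose[OF linear_orth_proj[OF V] f(1)]
      linear_compose[OF linear_orth_proj[OF subspace_orthogonal_comp[of V]] g(1)]
    by (intro linear_compose_add) (simp_all add: o_def)
  moreover have "norm (R x) = norm x" for x
  proof -
    let ?p = "orth_proj V x" and ?q = "orth_proj (V\<^sup>\<bottom>) x"
    have p: "?p \<in> V" and q: "?q \<in> V\<^sup>\<bottom>"
      using orth_proj(1)[OF V] orth_proj(1)[OF subspace_orthogonal_comp] by blast+
    have fg: "f ?p \<bullet> g ?q = 0"
      using p q f(2) g(2) by (metis image_eqI inner_commute mem_orthogonal_comp)
    have pq: "?p \<bullet> ?q = 0" using p q by (metis inner_commute mem_orthogonal_comp)
    have "(norm (R x))\<^sup>2 = (norm (f ?p))\<^sup>2 + (norm (g ?q))\<^sup>2"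
      unfolding R_def power2_norm_eq_inner
      using fg by (simp add: inner_add_left inner_add_right inner_commute)
    also have "\<dots> = (norm ?p)\<^sup>2 + (norm ?q)\<^sup>2" using f(3)[OF p] g(3)[OF q] by simp
    also have "\<dots> = (norm (?p + ?q))\<^sup>2"
      unfolding power2_norm_eq_inner
      using pq by (simp add: inner_add_left inner_add_right inner_commute)
    also have "?p + ?q = x" by (simp add: orth_proj_perp[OF V])
    finally show ?thesis by simp
  qed
  ultimately have R: "orthogonal_transformation R" by (simp add: orthogonal_transformation)
  have "R x = f x" if "x \<in> V" for x
    using that unfolding R_def
    by (simp add: orth_proj_self[OF V] orth_proj_perp[OF V] linear_0[OF g(1)])
  then have "R ` V = W" using f(2) by (metis image_cong)
  then show ?thesis using R that by blast
qed

section \<open>The Borel sets of the Fell topology\<close>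

text \<open>Centres and radii of a countable base of balls.\<close>

definition rat_balls :: "('a::euclidean_space \<times> real) set" where
  "rat_balls = (SOME D. countable D \<and> (\<forall>U. open U \<longrightarrow> U \<noteq> {} \<longrightarrow> (\<exists>d\<in>D. d \<in> U)))
     \<times> range (\<lambda>n. 1 / real (Suc n))"

lemma rat_balls:
  shows countable_rat_balls: "countable (rat_balls :: ('a::euclidean_space \<times> real) set)"
    and rat_balls_ex: "open U \<Longrightarrow> x \<in> U \<Longrightarrow> \<exists>(c, r)\<in>rat_balls. x \<in> ball c r \<and> cball (c::'a) r \<subseteq> U"
proof -
  define D :: "'a set" where
    "D = (SOME D. countable D \<and> (\<forall>U. open U \<longrightarrow> U \<noteq> {} \<longrightarrow> (\<exists>d\<in>D. d \<in> U)))"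
  obtain D0 :: "'a set" where "countable D0" "\<And>U. open U \<Longrightarrow> U \<noteq> {} \<Longrightarrow> \<exists>d\<in>D0. d \<in> U"
    using countable_dense_setE by metis
  then have "\<exists>D. countable D \<and> (\<forall>U. open (U :: 'a set) \<longrightarrow> U \<noteq> {} \<longrightarrow> (\<exists>d\<in>D. d \<in> U))"
    by blast
  from someI_ex[OF this]
  have D: "countable D" "\<And>U. open U \<Longrightarrow> U \<noteq> {} \<Longrightarrow> \<exists>d\<in>D. d \<in> U"
    unfolding D_def by blast+
  have rb: "rat_balls = D \<times> range (\<lambda>n. 1 / real (Suc n))"
    by (simp add: rat_balls_def D_def)
  show "countable (rat_balls :: ('a \<times> real) set)" unfolding rb using D(1) by auto
  assume U: "open U" "x \<in> U"
  then obtain e where e: "e > 0" "ball x e \<subseteq> U" by (meson openE)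
  obtain n where n: "1 / real (Suc n) < e / 2"
    using nat_approx_posE[of "e/2"] e(1) by auto
  obtain d where d: "d \<in> D" "d \<in> ball x (1 / real (Suc n))"
    using D(2)[of "ball x (1 / real (Suc n))"] by auto
  have "cball d (1 / real (Suc n)) \<subseteq> U"
  proof
    fix y assume "y \<in> cball d (1 / real (Suc n))"
    then have "dist x y < e"
      using d(2) n dist_triangle[of x y d] by simp
    then show "y \<in> U" using e(2) by auto
  qed
  then show "\<exists>(c, r)\<in>rat_balls. x \<in> ball c r \<and> cball c r \<subseteq> U"
    unfolding rb using d by (intro bexI[of _ "(d, 1 / real (Suc n))"]) (auto simp: dist_commute)
qed

lemma open_diff_closedin:
  assumes "open X" "closedin (top_of_set X) F"
  shows "open (X - F)"
  using assms by (metis closedin_def openin_open_trans topspace_euclidean_subtopology)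

lemma compact_cover_rat_balls:
  fixes C :: "'a::euclidean_space set"
  assumes "compact C" "open U" "C \<subseteq> U"
  obtains I where "I \<subseteq> rat_balls" "finite I" "C \<subseteq> (\<Union>(c, r)\<in>I. ball c r)"
    "\<And>c r. (c, r) \<in> I \<Longrightarrow> cball c r \<subseteq> U"
proof -
  let ?B = "{b \<in> rat_balls. cball (fst b) (snd b) \<subseteq> U}"
  have "C \<subseteq> (\<Union>b\<in>?B. ball (fst b) (snd b))"
    using rat_balls_ex[OF assms(2)] assms(3) by fastforce
  then obtain I where I: "I \<subseteq> ?B" "finite I" "C \<subseteq> (\<Union>b\<in>I. ball (fst b) (snd b))"
    by (rule compactE_image[OF assms(1), rotated]) auto
  show ?thesis
  proof (rule that[of I])
    show "C \<subseteq> (\<Union>(c, r)\<in>I. ball c r)" using I(3) by (simp add: case_prod_unfold)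
    show "cball c r \<subseteq> U" if "(c, r) \<in> I" for c r using I(1) that by force
    show "I \<subseteq> rat_balls" using I(1) by blast
  qed (fact I(2))
qed

definition closeds :: "'a::topological_space set \<Rightarrow> 'a set set" where
  "closeds X = {F. closedin (top_of_set X) F}"

text \<open>The set of all closed sets is included to serve as the empty intersection.\<close>

definition fell_subbase :: "'a::euclidean_space set \<Rightarrow> 'a set set set" where
  "fell_subbase X = {closeds X} \<union>
     (\<lambda>(c, r). {F \<in> closeds X. F \<inter> cball c r = {}}) ` {(c, r) \<in> rat_balls. cball c r \<subseteq> X} \<union>
     (\<lambda>(c, r). {F \<in> closeds X. F \<inter> ball c r \<noteq> {}}) ` {(c, r) \<in> rat_balls. cball c r \<subseteq> X}"

lemma countable_fell_subbase: "countable (fell_subbase X)"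
proof -
  have "countable {(c, r) \<in> rat_balls. cball c r \<subseteq> X}"
    by (rule countable_subset[OF _ countable_rat_balls]) auto
  then show ?thesis unfolding fell_subbase_def by auto
qed

text \<open>A closed set misses a compact \<open>C\<close> iff it misses a finite cover of \<open>C\<close> by closed balls, and hits an
  open set iff it hits one of the balls that exhaust it.\<close>

lemma fell_generated_by_subbase:
  fixes X :: "'a::euclidean_space set"
  assumes X: "open X" and U: "openin (fell_topology X) U"
  shows "generate_topology_on (fell_subbase X) U"
proof (rule generate_topology_on_coarsest[OF istopology_generate_topology_on _
      openin_topology_generated_by[OF U[unfolded fell_topology_def]]])
  fix s assume s: "s \<in> {{F. closedin (top_of_set X) F \<and> F \<inter> C = {}} |C. compact C \<and> C \<subseteq> X} \<union>
               {{F. closedin (top_of_set X) F \<and> F \<inter> U \<noteq> {}} |U. openin (top_of_set X) U}"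
  let ?G = "generate_topology_on (fell_subbase X)"
  let ?Bs = "{(c, r) \<in> rat_balls. cball c r \<subseteq> X}"
  consider C where "compact C" "C \<subseteq> X" "s = {F \<in> closeds X. F \<inter> C = {}}"
    | V where "openin (top_of_set X) V" "s = {F \<in> closeds X. F \<inter> V \<noteq> {}}"
    using s by (auto simp: closeds_def)
  then show "?G s"
  proof cases
    case (1 C)
    define G where "G I = {F \<in> closeds X. \<forall>(c, r)\<in>I. F \<inter> cball c r = {}}" for I
    have G: "?G (G I)" if "finite I" "I \<subseteq> ?Bs" for I
      using that
    proof (induction I)
      case empty
      show ?case by (rule generate_topology_on.Basis) (auto simp: G_def fell_subbase_def)
    next
      case (insert b I)
      obtain c r where b: "b = (c, r)" by force
      have "{F \<in> closeds X. F \<inter> cball c r = {}} \<in> fell_subbase X"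
        using insert.prems b unfolding fell_subbase_def by auto
      then have "?G ({F \<in> closeds X. F \<inter> cball c r = {}} \<inter> G I)"
        using insert by (intro generate_topology_on.Int[OF generate_topology_on.Basis]) auto
      moreover have "{F \<in> closeds X. F \<inter> cball c r = {}} \<inter> G I = G (insert b I)"
        by (auto simp: G_def b)
      ultimately show ?case by simp
    qed
    have "s = (\<Union>I\<in>{I. finite I \<and> I \<subseteq> ?Bs \<and> C \<subseteq> (\<Union>(c, r)\<in>I. ball c r)}. G I)" (is "_ = ?R")
    proof (intro set_eqI iffI)
      fix F assume F: "F \<in> s"
      have "open (X - F)" using F 1 X by (auto simp: closeds_def intro: open_diff_closedin)
      moreover have "C \<subseteq> X - F" using F 1 by auto
      ultimately obtain I where I: "I \<subseteq> rat_balls" "finite I" "C \<subseteq> (\<Union>(c, r)\<in>I. ball c r)"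
        "\<And>c r. (c, r) \<in> I \<Longrightarrow> cball c r \<subseteq> X - F"
        using compact_cover_rat_balls[OF 1(1)] by metis
      have "F \<inter> cball c r = {}" "cball c r \<subseteq> X" if "(c, r) \<in> I" for c r
        using I(4)[OF that] by blast+
      then have "F \<in> G I" "I \<subseteq> ?Bs" using F I(1) unfolding 1(3) G_def by blast+
      then show "F \<in> ?R" using I by blast
    next
      fix F assume "F \<in> ?R"
      then obtain I where I: "C \<subseteq> (\<Union>(c, r)\<in>I. ball c r)" "F \<in> G I" by blast
      have "x \<notin> F" if "x \<in> C" for x
      proof -
        obtain c r where "(c, r) \<in> I" "x \<in> ball c r" using I(1) \<open>x \<in> C\<close> by blast
        then show ?thesis using I(2) ball_subset_cball[of c r] unfolding G_def by blast
      qed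
      then show "F \<in> s" using I(2) unfolding 1(3) G_def by blast
    qed
    moreover have "?G ?R" by (rule generate_topology_on.UN) (use G in auto)
    ultimately show ?thesis by simp
  next
    case (2 V)
    have V: "open V" "V \<subseteq> X" using 2(1) X by (auto dest: openin_open_trans openin_imp_subset)
    have "s = (\<Union>(c, r)\<in>{(c, r) \<in> ?Bs. cball c r \<subseteq> V}. {F \<in> closeds X. F \<inter> ball c r \<noteq> {}})" (is "_ = ?R")
    proof (intro set_eqI iffI)
      fix F assume F: "F \<in> s"
      then obtain x where x: "x \<in> F" "x \<in> V" using 2 by auto
      then obtain c r where "(c, r) \<in> rat_balls" "x \<in> ball c r" "cball c r \<subseteq> V"
        using rat_balls_ex[OF V(1)] by blast
      then show "F \<in> ?R" using F V x unfolding 2(2)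
        by (intro UN_I[of "(c, r)"]) auto
    next
      fix F assume "F \<in> ?R"
      then obtain c r where "cball c r \<subseteq> V" "F \<in> closeds X" "F \<inter> ball c r \<noteq> {}" by blast
      then show "F \<in> s" using ball_subset_cball[of c r] unfolding 2(2) by blast
    qed
    moreover have "?G ?R"
      by (intro generate_topology_on.UN) (auto intro!: generate_topology_on.Basis simp: fell_subbase_def)
    ultimately show ?thesis by simp
  qed
qed

lemma topspace_fell [simp]: "topspace (fell_topology X) = closeds X"
  unfolding fell_topology_def topology_generated_by_topspace closeds_def by auto

lemma space_borel_of [simp]: "space (borel_of T) = topspace T"
  by (simp add: borel_of_def space_measure_of_conv)

lemma sets_borel_of: "sets (borel_of T) = sigma_sets (topspace T) {U. openin T U}"
  unfolding borel_of_def by (rule sets_measure_of) (auto dest: openin_subset)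

text \<open>Missing a compact set amounts to missing one of countably many finite covers by balls.\<close>

lemma miss_measurable:
  fixes X :: "'a::euclidean_space set"
  assumes X: "open X" and f: "\<And>\<omega>. \<omega> \<in> space N \<Longrightarrow> f \<omega> \<in> closeds X"
    and hit: "\<And>c r. cball c r \<subseteq> X \<Longrightarrow> {\<omega>\<in>space N. f \<omega> \<inter> ball c r \<noteq> {}} \<in> sets N"
    and C: "compact C" "C \<subseteq> X"
  shows "{\<omega>\<in>space N. f \<omega> \<inter> C = {}} \<in> sets N"
proof -
  let ?J = "{I. I \<subseteq> rat_balls \<and> finite I \<and> (\<forall>(c, r)\<in>I. cball c r \<subseteq> X) \<and> C \<subseteq> (\<Union>(c, r)\<in>I. ball c r)}"
  have "{\<omega>\<in>space N. f \<omega> \<inter> C = {}} =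
      (\<Union>I\<in>?J. {\<omega>\<in>space N. \<forall>b\<in>I. f \<omega> \<inter> ball (fst b) (snd b) = {}})" (is "?L = ?R")
  proof (intro set_eqI iffI)
    fix \<omega> assume w: "\<omega> \<in> ?L"
    then have "open (X - f \<omega>)" "C \<subseteq> X - f \<omega>"
      using f X C by (auto simp: closeds_def intro: open_diff_closedin)
    then obtain I where I: "I \<subseteq> rat_balls" "finite I" "C \<subseteq> (\<Union>(c, r)\<in>I. ball c r)"
      "\<And>c r. (c, r) \<in> I \<Longrightarrow> cball c r \<subseteq> X - f \<omega>"
      using compact_cover_rat_balls[OF C(1)] by metis
    have "\<forall>(c, r)\<in>I. cball c r \<subseteq> X" using I(4) by blast
    then have "I \<in> ?J" using I by blast
    moreover have "\<forall>b\<in>I. f \<omega> \<inter> ball (fst b) (snd b) = {}"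
    proof
      fix b assume "b \<in> I"
      then have "cball (fst b) (snd b) \<subseteq> X - f \<omega>" using I(4)[of "fst b" "snd b"] by simp
      then show "f \<omega> \<inter> ball (fst b) (snd b) = {}" using ball_subset_cball[of "fst b" "snd b"] by blast
    qed
    ultimately show "\<omega> \<in> ?R" using w by blast
  next
    fix \<omega> assume "\<omega> \<in> ?R"
    then obtain I where I: "C \<subseteq> (\<Union>(c, r)\<in>I. ball c r)" "\<omega> \<in> space N"
      "\<forall>b\<in>I. f \<omega> \<inter> ball (fst b) (snd b) = {}" by blast
    then have "f \<omega> \<inter> C = {}" by fastforce
    then show "\<omega> \<in> ?L" using I by blast
  qed
  moreover have "countable ?J"
    by (rule countable_subset[OF _ countable_Collect_finite_subset[OF countable_rat_balls]]) auto
  moreover have "{\<omega>\<in>space N. \<forall>b\<in>I. f \<omega> \<inter> ball (fst b) (snd b) = {}} \<in> sets N" if "I \<in> ?J" for I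
  proof (rule sets.sets_Collect_finite_All)
    show "{\<omega>\<in>space N. f \<omega> \<inter> ball (fst b) (snd b) = {}} \<in> sets N" if "b \<in> I" for b
    proof -
      have "{\<omega>\<in>space N. f \<omega> \<inter> ball (fst b) (snd b) = {}} =
          space N - {\<omega>\<in>space N. f \<omega> \<inter> ball (fst b) (snd b) \<noteq> {}}" by auto
      then show ?thesis using hit[of "fst b" "snd b"] \<open>I \<in> ?J\<close> that by (auto simp: case_prod_beta)
    qed
    show "finite I" using that by simp
  qed
  ultimately show ?thesis by (simp only:) (rule sets.countable_UN', auto)
qed

text \<open>The subbase given by rational balls is countable, so every open set of the Fell topology is
  a countable union of finite intersections of subbasic sets; a set-valued map is measurable as
  soon as the events that it hits a ball are.\<close>

lemma measurable_borel_of_fell: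
  fixes X :: "'a::euclidean_space set"
  assumes X: "open X" and \<F>: "\<F> \<subseteq> closeds X"
    and f: "\<And>\<omega>. \<omega> \<in> space N \<Longrightarrow> f \<omega> \<in> \<F>"
    and hit: "\<And>c r. cball c r \<subseteq> X \<Longrightarrow> {\<omega>\<in>space N. f \<omega> \<inter> ball c r \<noteq> {}} \<in> sets N"
  shows "f \<in> measurable N (borel_of (subtopology (fell_topology X) \<F>))"
proof -
  have fX: "\<And>\<omega>. \<omega> \<in> space N \<Longrightarrow> f \<omega> \<in> closeds X" using f \<F> by blast
  have basic: "f -` s \<inter> space N \<in> sets N" if s: "s \<in> fell_subbase X" for s
  proof -
    consider "s = closeds X"
      | c r where "cball c r \<subseteq> X" "s = {F \<in> closeds X. F \<inter> cball c r = {}}"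
      | c r where "cball c r \<subseteq> X" "s = {F \<in> closeds X. F \<inter> ball c r \<noteq> {}}"
      using s unfolding fell_subbase_def by blast
    then show ?thesis
    proof cases
      case 1
      then have "f -` s \<inter> space N = space N" using fX by auto
      then show ?thesis by simp
    next
      case (2 c r)
      then have "f -` s \<inter> space N = {\<omega>\<in>space N. f \<omega> \<inter> cball c r = {}}" using fX by auto
      then show ?thesis using miss_measurable[OF X fX hit compact_cball 2(1)] by simp
    next
      case (3 c r)
      then have "f -` s \<inter> space N = {\<omega>\<in>space N. f \<omega> \<inter> ball c r \<noteq> {}}" using fX by auto
      then show ?thesis using hit[OF 3(1)] by simp
    qed
  qed
  have op: "f -` U \<inter> space N \<in> sets N" if U: "openin (fell_topology X) U" for U
  proof -
    have "(arbitrary union_of finite' intersection_of (\<lambda>x. x \<in> fell_subbase X)) U"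
      using fell_generated_by_subbase[OF X U] by (simp add: generate_topology_on_eq)
    then obtain \<U> where \<U>: "\<And>u. u \<in> \<U> \<Longrightarrow> (finite' intersection_of (\<lambda>x. x \<in> fell_subbase X)) u" "U = \<Union>\<U>"
      by (auto simp: union_of_def)
    have ex: "\<exists>\<I>. finite \<I> \<and> \<I> \<subseteq> fell_subbase X \<and> \<I> \<noteq> {} \<and> u = \<Inter>\<I>" if "u \<in> \<U>" for u
      using \<U>(1)[OF that] by (auto simp: intersection_of_def)
    have "\<U> \<subseteq> Inter ` {\<I>. \<I> \<subseteq> fell_subbase X \<and> finite \<I>}" using ex by fastforce
    then have "countable \<U>"
      using countable_subset countable_image countable_Collect_finite_subset[OF countable_fell_subbase]
      by (metis (no_types, lifting) Collect_cong)
    moreover have "f -` u \<inter> space N \<in> sets N" if u: "u \<in> \<U>" for u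
    proof -
      obtain \<I> where I: "finite \<I>" "\<I> \<subseteq> fell_subbase X" "\<I> \<noteq> {}" "u = \<Inter>\<I>" using ex[OF u] by blast
      have "f -` u \<inter> space N = (\<Inter>i\<in>\<I>. f -` i \<inter> space N)" using I by auto
      also have "\<dots> \<in> sets N" by (rule sets.finite_INT) (use I basic in auto)
      finally show ?thesis .
    qed
    moreover have "f -` U \<inter> space N = (\<Union>u\<in>\<U>. f -` u \<inter> space N)" using \<U>(2) by auto
    ultimately show ?thesis by (simp only:) (rule sets.countable_UN', auto)
  qed
  show ?thesis
    unfolding borel_of_def
  proof (rule measurable_measure_of)
    show "f \<in> space N \<rightarrow> topspace (subtopology (fell_topology X) \<F>)" using f fX by auto
    fix A assume "A \<in> {U. openin (subtopology (fell_topology X) \<F>) U}"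
    then obtain U where U: "openin (fell_topology X) U" "A = U \<inter> \<F>" by (auto simp: openin_subtopology)
    have "f -` A \<inter> space N = f -` U \<inter> space N" using U f by auto
    then show "f -` A \<inter> space N \<in> sets N" using op[OF U(1)] by simp
  qed (use openin_subset in blast)
qed

lemma openin_fell_hit: "openin (top_of_set X) U \<Longrightarrow> openin (fell_topology X) {F \<in> closeds X. F \<inter> U \<noteq> {}}"
  unfolding fell_topology_def closeds_def by (rule topology_generated_by_Basis) auto

lemma openin_fell_miss: "compact C \<Longrightarrow> C \<subseteq> X \<Longrightarrow> openin (fell_topology X) {F \<in> closeds X. F \<inter> C = {}}"
  unfolding fell_topology_def closeds_def by (rule topology_generated_by_Basis) auto

lemma sets_borel_of_hit:
  assumes "open X" "\<F> \<subseteq> closeds X" "open U" "U \<subseteq> X"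
  shows "{F \<in> \<F>. F \<inter> U \<noteq> {}} \<in> sets (borel_of (subtopology (fell_topology X) \<F>))"
proof -
  have "openin (top_of_set X) U" using assms by (simp add: open_subset)
  from openin_fell_hit[OF this]
  have "openin (subtopology (fell_topology X) \<F>) ({F \<in> closeds X. F \<inter> U \<noteq> {}} \<inter> \<F>)"
    by (simp add: openin_subtopology_Int)
  moreover have "{F \<in> closeds X. F \<inter> U \<noteq> {}} \<inter> \<F> = {F \<in> \<F>. F \<inter> U \<noteq> {}}" using assms by auto
  ultimately show ?thesis by (simp add: sets_borel_of)
qed

lemma sets_borel_of_miss:
  assumes "\<F> \<subseteq> closeds X" "compact C" "C \<subseteq> X"
  shows "{F \<in> \<F>. F \<inter> C = {}} \<in> sets (borel_of (subtopology (fell_topology X) \<F>))"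
proof -
  from openin_fell_miss[OF assms(2,3)]
  have "openin (subtopology (fell_topology X) \<F>) ({F \<in> closeds X. F \<inter> C = {}} \<inter> \<F>)"
    by (simp add: openin_subtopology_Int)
  moreover have "{F \<in> closeds X. F \<inter> C = {}} \<inter> \<F> = {F \<in> \<F>. F \<inter> C = {}}" using assms by auto
  ultimately show ?thesis by (simp add: sets_borel_of)
qed

text \<open>Two closed sets are disjoint within a compact set iff finitely many rational balls separate
  them there.\<close>

lemma disjoint_within_compact_measurable:
  fixes X :: "'a::euclidean_space set"
  assumes X: "open X" and C: "compact C" "C \<subseteq> X"
    and f: "\<And>\<omega>. \<omega> \<in> space N \<Longrightarrow> f \<omega> \<in> closeds X"
    and g: "\<And>\<omega>. \<omega> \<in> space N \<Longrightarrow> g \<omega> \<in> closeds X"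
    and fm: "\<And>C. compact C \<Longrightarrow> C \<subseteq> X \<Longrightarrow> {\<omega>\<in>space N. f \<omega> \<inter> C = {}} \<in> sets N"
    and gm: "\<And>C. compact C \<Longrightarrow> C \<subseteq> X \<Longrightarrow> {\<omega>\<in>space N. g \<omega> \<inter> C = {}} \<in> sets N"
  shows "{\<omega>\<in>space N. f \<omega> \<inter> g \<omega> \<inter> C = {}} \<in> sets N"
proof -
  let ?J = "{I. I \<subseteq> (rat_balls :: ('a \<times> real) set) \<and> finite I}"
  define O' where "O' I = (\<Union>b\<in>I. ball (fst b) (snd b))" for I :: "('a \<times> real) set"
  define K' where "K' I = (\<Union>b\<in>I. cball (fst b) (snd b))" for I :: "('a \<times> real) set"
  have OK: "O' I \<subseteq> K' I" for I unfolding O'_def K'_def using ball_subset_cball by blast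
  have "{\<omega>\<in>space N. f \<omega> \<inter> g \<omega> \<inter> C = {}} = (\<Union>I\<in>?J.
      {\<omega>\<in>space N. f \<omega> \<inter> (C - O' I) = {}} \<inter> {\<omega>\<in>space N. g \<omega> \<inter> (C \<inter> K' I) = {}})" (is "?L = ?R")
  proof (intro set_eqI iffI)
    fix \<omega> assume w: "\<omega> \<in> ?L"
    have "compact (f \<omega> \<inter> C)"
    proof -
      have "closedin (top_of_set C) (f \<omega> \<inter> C)"
      proof -
        have "closedin (top_of_set X) (f \<omega>)" using f w by (auto simp: closeds_def)
        then obtain T where "closed T" "f \<omega> = T \<inter> X" by (auto simp: closedin_closed)
        then have "f \<omega> \<inter> C = C \<inter> T" using C by auto
        then show ?thesis using \<open>closed T\<close> by (metis closedin_closed_Int)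
      qed
      then show ?thesis using C(1) closedin_compact by blast
    qed
    moreover have "open (X - g \<omega>)" using g X w by (auto simp: closeds_def intro: open_diff_closedin)
    moreover have "f \<omega> \<inter> C \<subseteq> X - g \<omega>" using w C by auto
    ultimately obtain I where I: "I \<subseteq> rat_balls" "finite I" "f \<omega> \<inter> C \<subseteq> (\<Union>(c, r)\<in>I. ball c r)"
      "\<And>c r. (c, r) \<in> I \<Longrightarrow> cball c r \<subseteq> X - g \<omega>"
      using compact_cover_rat_balls by metis
    have "f \<omega> \<inter> (C - O' I) = {}" using I(3) by (auto simp: O'_def case_prod_beta)
    moreover have "g \<omega> \<inter> (C \<inter> K' I) = {}" using I(4) by (fastforce simp: K'_def)
    ultimately show "\<omega> \<in> ?R" using I w by blast
  next
    fix \<omega> assume "\<omega> \<in> ?R"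
    then show "\<omega> \<in> ?L" using OK by blast
  qed
  moreover have "countable ?J"
    by (rule countable_subset[OF _ countable_Collect_finite_subset[OF countable_rat_balls]]) auto
  moreover have "{\<omega>\<in>space N. f \<omega> \<inter> (C - O' I) = {}} \<inter> {\<omega>\<in>space N. g \<omega> \<inter> (C \<inter> K' I) = {}} \<in> sets N"
    if "I \<in> ?J" for I
  proof (intro sets.Int fm gm)
    show "compact (C - O' I)" using C by (intro compact_diff) (auto simp: O'_def)
    have "closed (K' I)" using that by (auto simp: K'_def intro!: closed_UN)
    then show "compact (C \<inter> K' I)" using C by (intro compact_Int_closed)
  qed (use C in auto)
  ultimately show ?thesis by (simp only:) (rule sets.countable_UN', auto)
qed

section \<open>The Grassmannian as a measurable space\<close>

definition subspaces :: "nat \<Rightarrow> 'a::euclidean_space set set" where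
  "subspaces k = {V. subspace V \<and> dim V = k}"

text \<open>The generators require distances from finitely many points to be large. They are stable under
  intersections, hence determine finite measures, and being open conditions they can be
  approximated from within by slightly stronger ones.\<close>

definition Gr_events :: "nat \<Rightarrow> 'a::euclidean_space set set set" where
  "Gr_events k = {{V \<in> subspaces k. \<forall>(y, r)\<in>I. r < infdist y V} | I. finite I}"

definition Gr :: "nat \<Rightarrow> 'a::euclidean_space set measure" where
  "Gr k = sigma (subspaces k) (Gr_events k)"

lemma space_Gr [simp]: "space (Gr k) = subspaces k"
  by (simp add: Gr_def space_measure_of_conv)

lemma sets_Gr: "sets (Gr k) = sigma_sets (subspaces k) (Gr_events k)"
  unfolding Gr_def by (rule sets_measure_of) (auto simp: Gr_events_def)

lemma Int_stable_Gr_events: "Int_stable (Gr_events k :: 'a::euclidean_space set set set)"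
proof (rule Int_stableI)
  fix A B :: "'a set set" assume "A \<in> Gr_events k" "B \<in> Gr_events k"
  then obtain I J where "finite I" "finite J"
    "A = {V \<in> subspaces k. \<forall>(y, r)\<in>I. r < infdist y V}"
    "B = {V \<in> subspaces k. \<forall>(y, r)\<in>J. r < infdist y V}"
    unfolding Gr_events_def by blast
  then have "finite (I \<union> J)" "A \<inter> B = {V \<in> subspaces k. \<forall>(y, r)\<in>I \<union> J. r < infdist y V}" by auto
  then show "A \<inter> B \<in> Gr_events k" unfolding Gr_events_def by blast
qed

lemma measurable_infdist_Gr: "(\<lambda>V. infdist y V) \<in> borel_measurable (Gr k)"
proof (subst borel_measurable_iff_greater, intro allI)
  fix r
  have "{V \<in> subspaces k. \<forall>(y, r)\<in>{(y, r)}. r < infdist y V} \<in> Gr_events k"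
    unfolding Gr_events_def by blast
  then show "{V \<in> space (Gr k). r < infdist y V} \<in> sets (Gr k)"
    unfolding sets_Gr by (auto intro: sigma_sets.Basic)
qed

lemma measurable_GrI:
  fixes f :: "'w \<Rightarrow> 'a::euclidean_space set"
  assumes "\<And>\<omega>. \<omega> \<in> space N \<Longrightarrow> f \<omega> \<in> subspaces k"
    and m: "\<And>y. (\<lambda>\<omega>. infdist y (f \<omega>)) \<in> borel_measurable N"
  shows "f \<in> measurable N (Gr k)"
  unfolding Gr_def
proof (rule measurable_measure_of)
  fix A :: "'a set set" assume "A \<in> Gr_events k"
  then obtain I where I: "finite I" "A = {V \<in> subspaces k. \<forall>(y, r)\<in>I. r < infdist y V}"
    unfolding Gr_events_def by blast
  have "f -` A \<inter> space N = {\<omega> \<in> space N. \<forall>p\<in>I. snd p < infdist (fst p) (f \<omega>)}"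
    using assms(1) I by (auto simp: case_prod_beta)
  also have "\<dots> \<in> sets N"
    using m I(1) by (intro sets.sets_Collect_finite_All) (auto intro!: borel_measurable_less)
  finally show "f -` A \<inter> space N \<in> sets N" .
qed (use assms(1) in \<open>auto simp: Gr_events_def\<close>)

text \<open>Distances to \<open>V\<close> depend continuously on the point, so joint measurability reduces to points of a
  countable dense set.\<close>

lemma measurable_infdist_joint:
  fixes g :: "'w \<Rightarrow> 'a::euclidean_space"
  assumes f: "f \<in> measurable N (Gr k)" and g: "g \<in> borel_measurable N"
  shows "(\<lambda>\<omega>. infdist (g \<omega>) (f \<omega>)) \<in> borel_measurable N"
proof (subst borel_measurable_iff_less, intro allI)
  fix a :: real
  have m: "(\<lambda>\<omega>. infdist c (f \<omega>)) \<in> borel_measurable N" for c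
    by (rule measurable_compose[OF f measurable_infdist_Gr])
  have "infdist x V < a \<longleftrightarrow>
      (\<exists>p\<in>rat_balls. \<exists>q\<in>\<rat>. dist x (fst p) < q \<and> infdist (fst p) V < a - q)" for x :: "'a::euclidean_space" and V
  proof
    assume l: "infdist x V < a"
    then obtain q where q: "q \<in> \<rat>" "0 < q" "q < (a - infdist x V) / 2"
      using Rats_dense_in_real[of 0 "(a - infdist x V) / 2"] by auto
    obtain c r where c: "(c, r) \<in> rat_balls" "x \<in> ball c r" "cball c r \<subseteq> ball x q"
      using rat_balls_ex[of "ball x q" x] q by auto
    have "0 \<le> dist c x" by simp
    also have "dist c x < r" using c(2) by simp
    finally have "c \<in> cball c r" by simp
    then have "dist x c < q" using c(3) by (meson mem_ball subsetD)
    moreover have "infdist c V < a - q"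
      using infdist_triangle[of c V x] q calculation by (simp add: dist_commute)
    ultimately show "\<exists>p\<in>rat_balls. \<exists>q\<in>\<rat>. dist x (fst p) < q \<and> infdist (fst p) V < a - q"
      using c(1) q(1) by force
  next
    assume "\<exists>p\<in>rat_balls. \<exists>q\<in>\<rat>. dist x (fst p) < q \<and> infdist (fst p) V < a - q"
    then show "infdist x V < a" using infdist_triangle[of x V] by (smt (verit))
  qed
  then have "{\<omega> \<in> space N. infdist (g \<omega>) (f \<omega>) < a} =
      {\<omega> \<in> space N. \<exists>p\<in>rat_balls. \<exists>q\<in>\<rat>. dist (g \<omega>) (fst p) < q \<and> infdist (fst p) (f \<omega>) < a - q}"
    by simp
  also have "\<dots> \<in> sets N"
  proof (intro sets.sets_Collect_countable_Ex' sets.sets_Collect_conj)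
    show "{\<omega> \<in> space N. dist (g \<omega>) (fst p) < q} \<in> sets N" for p q
      using g by measurable
    show "{\<omega> \<in> space N. infdist (fst p) (f \<omega>) < a - q} \<in> sets N" for p q
      using m[of "fst p"] by measurable
  qed (auto simp: countable_rat_balls countable_rat)
  finally show "{\<omega> \<in> space N. infdist (g \<omega>) (f \<omega>) < a} \<in> sets N" .
qed

lemma perp_subspaces: "V \<in> subspaces k \<Longrightarrow> V\<^sup>\<bottom> \<in> subspaces (DIM('a) - k)"
  for V :: "'a::euclidean_space set"
  by (simp add: subspaces_def subspace_orthogonal_comp dim_perp)

lemma measurable_perp:
  "orthogonal_comp \<in> measurable (Gr k) (Gr (DIM('a) - k) :: 'a::euclidean_space set measure)"
proof (rule measurable_GrI)
  fix y :: 'a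
  have "(\<lambda>V. sqrt ((norm y)\<^sup>2 - (infdist y V)\<^sup>2)) \<in> borel_measurable (Gr k)"
    using measurable_infdist_Gr[of y k] by measurable
  moreover have "infdist y (V\<^sup>\<bottom>) = sqrt ((norm y)\<^sup>2 - (infdist y V)\<^sup>2)" if "V \<in> space (Gr k)" for V
    using infdist_pythagoras[of V y] that by (auto simp: subspaces_def infdist_nonneg)
  ultimately show "(\<lambda>V. infdist y (V\<^sup>\<bottom>)) \<in> borel_measurable (Gr k)"
    by (subst measurable_cong)
qed (auto simp: perp_subspaces)

lemma orthogonal_image_subspaces:
  "orthogonal_transformation (R :: 'a \<Rightarrow> 'a) \<Longrightarrow> V \<in> subspaces k \<Longrightarrow> R ` V \<in> subspaces k"
  for V :: "'a::euclidean_space set"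
  by (simp add: subspaces_def subspace_orthogonal_image dim_orthogonal_image)

lemma measurable_orthogonal_image:
  assumes R: "orthogonal_transformation (R :: 'a::euclidean_space \<Rightarrow> 'a)"
  shows "(`) R \<in> measurable (Gr k) (Gr k)"
proof (rule measurable_GrI)
  fix y
  obtain x where x: "y = R x" using orthogonal_transformation_surj[OF R] by (metis surjD)
  have "infdist y (R ` V) = infdist x V" if "V \<in> space (Gr k)" for V
    using infdist_orthogonal_image[OF R] that x by (auto simp: subspaces_def)
  then show "(\<lambda>V. infdist y (R ` V)) \<in> borel_measurable (Gr k)"
    using measurable_infdist_Gr[of x k] by (subst measurable_cong)
qed (auto simp: orthogonal_image_subspaces[OF R])

text \<open>A union over rational multiples of \<open>x\<close> makes the span of \<open>V\<close> and \<open>x\<close> depend measurably on both.\<close>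

lemma infdist_span_insert_less:
  assumes V: "subspace (V :: 'a::euclidean_space set)"
  shows "infdist z (span (insert x V)) < a \<longleftrightarrow> (\<exists>t\<in>\<rat>. infdist (z - t *\<^sub>R x) V < a)"
proof
  assume "infdist z (span (insert x V)) < a"
  then obtain y where y: "y \<in> span (insert x V)" "dist z y < a"
    using infdist_subspace_less_iff[of "span (insert x V)" z a] by auto
  then obtain s where s: "y - s *\<^sub>R x \<in> V"
    using V by (auto simp: span_insert span_eq_iff[THEN iffD2])
  have "continuous_on UNIV (\<lambda>t. infdist (z - t *\<^sub>R x) V)" by (intro continuous_intros)
  then have "open {t. infdist (z - t *\<^sub>R x) V < a}"
    by (intro open_Collect_less continuous_intros)
  moreover have "infdist (z - s *\<^sub>R x) V < a"
    using infdist_le[OF s, of "z - s *\<^sub>R x"] y(2) by (simp add: dist_norm)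
  ultimately obtain e where e: "e > 0" "ball s e \<subseteq> {t. infdist (z - t *\<^sub>R x) V < a}"
    by (meson openE mem_Collect_eq)
  obtain t where "t \<in> \<rat>" "s < t" "t < s + e" using Rats_dense_in_real[of s "s + e"] e by auto
  moreover from this have "t \<in> ball s e" by (simp add: dist_real_def)
  ultimately show "\<exists>t\<in>\<rat>. infdist (z - t *\<^sub>R x) V < a" using e(2) by blast
next
  assume "\<exists>t\<in>\<rat>. infdist (z - t *\<^sub>R x) V < a"
  then obtain t w where w: "w \<in> V" "dist (z - t *\<^sub>R x) w < a"
    using infdist_subspace_less_iff[OF V] by auto
  have "t *\<^sub>R x + w \<in> span (insert x V)"
    using w by (intro span_add span_scale span_base) auto
  from infdist_le[OF this, of z] w(2) show "infdist z (span (insert x V)) < a"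
    by (simp add: dist_norm algebra_simps)
qed

text \<open>Adding a vector to a subspace. The value \<open>V0\<close>, taken when the dimension would not grow, only keeps
  the map within the subspaces of the right dimension.\<close>

definition ins :: "'a::euclidean_space set \<Rightarrow> 'a set \<times> 'a \<Rightarrow> 'a set" where
  "ins V0 = (\<lambda>(V, x). if x \<in> V then V0 else span (insert x V))"

lemma dim_span_insert: "subspace V \<Longrightarrow> x \<notin> V \<Longrightarrow> dim (span (insert x V)) = Suc (dim V)"
  for V :: "'a::euclidean_space set"
  by (simp add: dim_insert span_eq_iff[THEN iffD2])

lemma measurable_ins:
  fixes V0 :: "'a::euclidean_space set"
  assumes V0: "V0 \<in> subspaces (Suc k)"
  shows "ins V0 \<in> measurable (Gr k \<Otimes>\<^sub>M borel) (Gr (Suc k))"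
proof (rule measurable_GrI)
  show "ins V0 \<omega> \<in> subspaces (Suc k)" if "\<omega> \<in> space (Gr k \<Otimes>\<^sub>M borel)" for \<omega>
    using that V0 by (auto simp: ins_def space_pair_measure subspaces_def dim_span_insert
        split: prod.splits simp del: dim_span)
  fix z :: 'a
  let ?N = "Gr k \<Otimes>\<^sub>M (borel :: 'a measure)"
  have m: "(\<lambda>\<omega>. infdist (z - t *\<^sub>R snd \<omega>) (fst \<omega>)) \<in> borel_measurable ?N" for t
    by (rule measurable_infdist_joint[of _ _ k]) measurable
  have m0: "(\<lambda>\<omega>. infdist (snd \<omega>) (fst \<omega>)) \<in> borel_measurable ?N"
    by (rule measurable_infdist_joint[of _ _ k]) measurable
  have "(\<lambda>\<omega>. infdist z (span (insert (snd \<omega>) (fst \<omega>)))) \<in> borel_measurable ?N"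
  proof (subst borel_measurable_iff_less, intro allI)
    fix a
    have "{\<omega> \<in> space ?N. infdist z (span (insert (snd \<omega>) (fst \<omega>))) < a} =
        {\<omega> \<in> space ?N. \<exists>t\<in>\<rat>. infdist (z - t *\<^sub>R snd \<omega>) (fst \<omega>) < a}"
      by (auto simp: space_pair_measure subspaces_def infdist_span_insert_less)
    also have "\<dots> \<in> sets ?N"
    proof (intro sets.sets_Collect_countable_Ex' countable_rat)
      show "{\<omega> \<in> space ?N. infdist (z - t *\<^sub>R snd \<omega>) (fst \<omega>) < a} \<in> sets ?N" for t
        using m[of t] by measurable
    qed
    finally show "{\<omega> \<in> space ?N. infdist z (span (insert (snd \<omega>) (fst \<omega>))) < a} \<in> sets ?N" .
  qed
  then have "(\<lambda>\<omega>. if infdist (snd \<omega>) (fst \<omega>) = 0 then infdist z V0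
      else infdist z (span (insert (snd \<omega>) (fst \<omega>)))) \<in> borel_measurable ?N"
    using m0 by (intro measurable_If borel_measurable_eq) simp_all
  then show "(\<lambda>\<omega>. infdist z (ins V0 \<omega>)) \<in> borel_measurable ?N"
    by (rule measurable_cong[THEN iffD1, rotated])
      (auto simp: ins_def space_pair_measure subspaces_def infdist_subspace_eq_0)
qed

subsection \<open>Transversality\<close>

text \<open>For linear subspaces this says that \<open>V\<close> and \<open>L\<close> together span the whole space.\<close>

definition transv :: "'a::euclidean_space set \<Rightarrow> 'a set \<Rightarrow> bool" where
  "transv V L \<longleftrightarrow> (\<forall>z. \<exists>v\<in>V. z + v \<in> L)"

lemma transv_Basis:
  assumes V: "subspace V" and L: "subspace L" and b: "\<And>b. b \<in> Basis \<Longrightarrow> \<exists>v\<in>V. b + v \<in> L"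
  shows "transv V L"
proof -
  obtain v where v: "\<And>b. b \<in> Basis \<Longrightarrow> v b \<in> V \<and> b + v b \<in> L" using b by metis
  have "\<exists>w\<in>V. z + w \<in> L" for z
  proof
    show "(\<Sum>b\<in>Basis. (z \<bullet> b) *\<^sub>R v b) \<in> V"
      using v V by (intro subspace_sum subspace_scale) auto
    have "(\<Sum>b\<in>Basis. (z \<bullet> b) *\<^sub>R (b + v b)) \<in> L"
      using v L by (intro subspace_sum subspace_scale) auto
    then show "z + (\<Sum>b\<in>Basis. (z \<bullet> b) *\<^sub>R v b) \<in> L"
      by (simp add: scaleR_add_right sum.distrib euclidean_representation)
  qed
  then show ?thesis by (simp add: transv_def)
qed

lemma closeds_UNIV [simp]: "closeds UNIV = Collect closed"
  by (simp add: closeds_def)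

text \<open>It is enough that \<open>L\<close> meets the translates of \<open>V\<close> by basis vectors, and each of these finitely many
  intersections is exhausted by compact parts.\<close>

lemma sets_Gr_transv:
  fixes L :: "'a::euclidean_space set"
  assumes L: "subspace L"
  shows "{V \<in> subspaces k. transv V L} \<in> sets (Gr k)"
proof -
  have hit: "{V \<in> space (Gr k). V \<inter> ball c r \<noteq> {}} \<in> sets (Gr k)" for c :: 'a and r
  proof -
    have "{V \<in> space (Gr k). V \<inter> ball c r \<noteq> {}} = {V \<in> space (Gr k). infdist c V < r}"
      by (intro Collect_cong conj_cong refl) (simp add: subspaces_def infdist_subspace_less_iff)
    also have "\<dots> \<in> sets (Gr k)" using measurable_infdist_Gr[of c k] by (intro borel_measurable_less) auto
    finally show ?thesis .
  qed
  have cl: "V \<in> closeds UNIV" if "V \<in> space (Gr k)" for V :: "'a set"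
    using that by (simp add: subspaces_def closed_subspace)
  have miss: "{V \<in> space (Gr k). V \<inter> C = {}} \<in> sets (Gr k)" if "compact C" for C :: "'a set"
    using that miss_measurable[of UNIV "Gr k" "\<lambda>V. V"] cl hit by auto
  have one: "{V \<in> space (Gr k). \<exists>v\<in>V. b + v \<in> L} \<in> sets (Gr k)" for b
  proof -
    have clL: "closed {v. b + v \<in> L}"
    proof -
      have "closed ((+) (- b) ` L)" using closed_subspace[OF L] by (rule closed_translation)
      moreover have "(+) (- b) ` L = {v. b + v \<in> L}" by (force simp: image_iff)
      ultimately show ?thesis by simp
    qed
    have "{V \<in> space (Gr k). V \<inter> {v. b + v \<in> L} \<inter> cball 0 (real n) = {}} \<in> sets (Gr k)" for n
    proof (rule disjoint_within_compact_measurable[of UNIV])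
      show "{V \<in> space (Gr k). {v. b + v \<in> L} \<inter> C = {}} \<in> sets (Gr k)" for C
        by (cases "{v. b + v \<in> L} \<inter> C = {}") (auto simp: sets.top[of "Gr k", simplified])
    qed (use cl miss clL in auto)
    then have "space (Gr k) - (\<Inter>n. {V \<in> space (Gr k). V \<inter> {v. b + v \<in> L} \<inter> cball 0 (real n) = {}})
        \<in> sets (Gr k)" by (intro sets.Diff sets.top sets.countable_INT) auto
    moreover have "space (Gr k) - (\<Inter>n. {V \<in> space (Gr k). V \<inter> {v. b + v \<in> L} \<inter> cball 0 (real n) = {}})
        = {V \<in> space (Gr k). \<exists>v\<in>V. b + v \<in> L}"
      using real_arch_simple by fastforce
    ultimately show ?thesis by simp
  qed
  have "{V \<in> subspaces k. transv V L} = {V \<in> space (Gr k). \<forall>b\<in>Basis. \<exists>v\<in>V. b + v \<in> L}"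
    using transv_Basis[OF _ L] by (auto simp: transv_def subspaces_def)
  also have "\<dots> \<in> sets (Gr k)" using one by (intro sets.sets_Collect_finite_All) auto
  finally show ?thesis .
qed

section \<open>Rotation invariance of Lebesgue measure\<close>

text \<open>Two measures, of which one is invariant under all reflections and the other is quasi-invariant
  under translations, are comparable: compute the mass of all \<open>(x, y)\<close> with \<open>T x \<in> A\<close> and
  \<open>y - T x \<in> B\<close> in both orders.\<close>

lemma Fubini_comparison:
  fixes M :: "'b measure" and N :: "'a::euclidean_space measure" and \<kappa> :: ennreal
  assumes "sigma_finite_measure M" "sigma_finite_measure N" and N: "sets N = sets borel"
    and T: "T \<in> borel_measurable M" and A: "A \<in> sets borel" and B: "B \<in> sets borel"
    and qB: "\<And>x. x \<in> A \<Longrightarrow> emeasure N B \<le> \<kappa> * emeasure N {y. y - x \<in> B}"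
    and qA: "\<And>x. x \<in> B \<Longrightarrow> emeasure N {y. y - x \<in> A} \<le> \<kappa> * emeasure N A"
    and refl: "AE y in N. emeasure M {z \<in> space M. T z \<in> A \<and> y - T z \<in> B}
                         = emeasure M {z \<in> space M. T z \<in> B \<and> y - T z \<in> A}"
  shows "emeasure M {z \<in> space M. T z \<in> A} * emeasure N B
       \<le> \<kappa>\<^sup>2 * (emeasure M {z \<in> space M. T z \<in> B} * emeasure N A)"
proof -
  interpret M: sigma_finite_measure M by fact
  interpret N: sigma_finite_measure N by fact
  interpret MN: pair_sigma_finite M N ..
  have spN: "space N = UNIV" using N by (metis sets_eq_imp_space_eq space_borel)
  have shift: "{y. y - x \<in> D} \<in> sets N" if "D \<in> sets borel" for x D
  proof -
    have "(\<lambda>y. y - x) -` D \<inter> space borel \<in> sets borel"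
      using that by (intro measurable_sets[of _ borel borel]) auto
    then show ?thesis by (simp add: N vimage_def)
  qed
  have TD: "{z \<in> space M. T z \<in> D} \<in> sets M" if "D \<in> sets borel" for D
    using measurable_sets[OF T that] by (simp add: vimage_def Int_def conj_commute)
  define S where "S C D = {p \<in> space (M \<Otimes>\<^sub>M N). T (fst p) \<in> C \<and> snd p - T (fst p) \<in> D}" for C D
  have S: "S C D \<in> sets (M \<Otimes>\<^sub>M N)" if "C \<in> sets borel" "D \<in> sets borel" for C D
  proof -
    have f: "(\<lambda>p. T (fst p)) \<in> borel_measurable (M \<Otimes>\<^sub>M N)"
      using T by measurable
    have "snd \<in> measurable (M \<Otimes>\<^sub>M N) borel" using N measurable_snd by (metis measurable_cong_sets)
    then have g: "(\<lambda>p. snd p - T (fst p)) \<in> borel_measurable (M \<Otimes>\<^sub>M N)" using f by simp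
    have "S C D = ((\<lambda>p. T (fst p)) -` C \<inter> space (M \<Otimes>\<^sub>M N)) \<inter>
        ((\<lambda>p. snd p - T (fst p)) -` D \<inter> space (M \<Otimes>\<^sub>M N))" by (auto simp: S_def)
    also have "\<dots> \<in> sets (M \<Otimes>\<^sub>M N)"
      by (intro sets.Int measurable_sets[OF f] measurable_sets[OF g] that)
    finally show ?thesis .
  qed
  have fst: "emeasure (M \<Otimes>\<^sub>M N) (S C D) =
      (\<integral>\<^sup>+z. emeasure N {y. y - T z \<in> D} * indicator {z \<in> space M. T z \<in> C} z \<partial>M)"
    if "C \<in> sets borel" "D \<in> sets borel" for C D
    unfolding N.emeasure_pair_measure_alt[OF S[OF that]]
  proof (rule nn_integral_cong)
    fix z assume z: "z \<in> space M"
    have "Pair z -` S C D = (if T z \<in> C then {y. y - T z \<in> D} else {})"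
      using z by (auto simp: S_def space_pair_measure spN)
    then show "emeasure N (Pair z -` S C D) = emeasure N {y. y - T z \<in> D} * indicator {z \<in> space M. T z \<in> C} z"
      using z by (auto simp: indicator_def)
  qed
  have snd: "emeasure (M \<Otimes>\<^sub>M N) (S C D) = (\<integral>\<^sup>+y. emeasure M {z \<in> space M. T z \<in> C \<and> y - T z \<in> D} \<partial>N)"
    if "C \<in> sets borel" "D \<in> sets borel" for C D
    unfolding MN.emeasure_pair_measure_alt2[OF S[OF that]]
    by (intro nn_integral_cong arg_cong[where f="emeasure M"]) (auto simp: S_def space_pair_measure spN)
  have eq: "emeasure (M \<Otimes>\<^sub>M N) (S A B) = emeasure (M \<Otimes>\<^sub>M N) (S B A)"
    unfolding snd[OF A B] snd[OF B A] using refl by (rule nn_integral_cong_AE)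
  have "emeasure M {z \<in> space M. T z \<in> A} * emeasure N B =
      (\<integral>\<^sup>+z. emeasure N B * indicator {z \<in> space M. T z \<in> A} z \<partial>M)"
    using TD[OF A] by (simp add: nn_integral_cmult_indicator mult.commute)
  also have "\<dots> \<le> (\<integral>\<^sup>+z. \<kappa> * (emeasure N {y. y - T z \<in> B} * indicator {z \<in> space M. T z \<in> A} z) \<partial>M)"
    using qB by (intro nn_integral_mono) (auto simp: indicator_def)
  also have "\<dots> = \<kappa> * emeasure (M \<Otimes>\<^sub>M N) (S A B)"
  proof -
    have "(\<lambda>z. emeasure N (Pair z -` S UNIV B)) \<in> borel_measurable M"
      by (rule N.measurable_emeasure_Pair[OF S]) (use B in auto)
    moreover have "Pair z -` S UNIV B = {y. y - T z \<in> B}" if "z \<in> space M" for z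
      using that by (auto simp: S_def space_pair_measure spN)
    ultimately have "(\<lambda>z. emeasure N {y. y - T z \<in> B}) \<in> borel_measurable M"
      by (subst measurable_cong[symmetric, where f="\<lambda>z. emeasure N (Pair z -` S UNIV B)"]) auto
    then show ?thesis unfolding fst[OF A B] using TD[OF A] by (intro nn_integral_cmult borel_measurable_times_ennreal borel_measurable_indicator)
  qed
  also have "\<dots> \<le> \<kappa> * (\<kappa> * emeasure N A * emeasure M {z \<in> space M. T z \<in> B})"
  proof (rule mult_left_mono)
    have "emeasure (M \<Otimes>\<^sub>M N) (S A B) =
        (\<integral>\<^sup>+z. emeasure N {y. y - T z \<in> A} * indicator {z \<in> space M. T z \<in> B} z \<partial>M)"
      unfolding eq by (rule fst[OF B A])
    also have "\<dots> \<le> (\<integral>\<^sup>+z. (\<kappa> * emeasure N A) * indicator {z \<in> space M. T z \<in> B} z \<partial>M)"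
      using qA by (intro nn_integral_mono) (auto simp: indicator_def)
    also have "\<dots> = \<kappa> * emeasure N A * emeasure M {z \<in> space M. T z \<in> B}"
      using TD[OF B] by (simp add: nn_integral_cmult_indicator)
    finally show "emeasure (M \<Otimes>\<^sub>M N) (S A B) \<le> \<kappa> * emeasure N A * emeasure M {z \<in> space M. T z \<in> B}" .
  qed simp
  finally show ?thesis by (simp add: power2_eq_square mult_ac)
qed

lemma lborel_distr_reflect: "distr lborel borel (\<lambda>x. t - x) = (lborel :: 'a::euclidean_space measure)"
  using lborel_affine[of "-1" t] by (simp add: density_1)

lemma emeasure_lborel_reflect:
  fixes t :: "'a::euclidean_space"
  assumes "A \<in> sets borel"
  shows "emeasure lborel {x. t - x \<in> A} = emeasure lborel A"
proof -
  have "emeasure lborel A = emeasure (distr lborel borel (\<lambda>x. t - x)) A"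
    by (simp add: lborel_distr_reflect)
  also have "\<dots> = emeasure lborel ((\<lambda>x. t - x) -` A)"
    using assms by (subst emeasure_distr) auto
  finally show ?thesis by (simp add: vimage_def)
qed

lemma emeasure_lborel_shift:
  fixes t :: "'a::euclidean_space"
  assumes "A \<in> sets borel"
  shows "emeasure lborel {x. x - t \<in> A} = emeasure lborel A"
proof -
  have "emeasure lborel A = emeasure (distr lborel borel ((+) (- t))) A"
    by (simp add: lborel_distr_plus)
  also have "\<dots> = emeasure lborel ((+) (- t) -` A)"
    using assms by (subst emeasure_distr) auto
  finally show ?thesis by (simp add: vimage_def)
qed

lemma orthogonal_transformation_borel:
  fixes R :: "'a::euclidean_space \<Rightarrow> 'a"
  shows "orthogonal_transformation R \<Longrightarrow> R \<in> borel_measurable borel"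
  by (intro borel_measurable_continuous_onI linear_continuous_on
      linear_conv_bounded_linear[THEN iffD1] orthogonal_transformation_linear)

text \<open>The image measure is translation-invariant, so it is proportional to Lebesgue measure by
  \<open>Fubini_comparison\<close> with constant \<open>1\<close>; the unit ball, which is preserved, gives the factor \<open>1\<close>.\<close>

lemma lborel_orthogonal_transformation:
  fixes R :: "'a::euclidean_space \<Rightarrow> 'a"
  assumes R: "orthogonal_transformation R"
  shows "distr lborel borel R = lborel"
proof (rule measure_eqI)
  let ?N = "distr lborel borel R"
  have Rm: "R \<in> borel_measurable lborel" using orthogonal_transformation_borel[OF R] by simp
  have pre: "R -` A \<in> sets borel" if "A \<in> sets borel" for A
    using measurable_sets[OF orthogonal_transformation_borel[OF R] that] by simp
  have N: "emeasure ?N A = emeasure lborel (R -` A)" if "A \<in> sets borel" for A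
    using that Rm by (subst emeasure_distr) auto
  have Nshift: "emeasure ?N {y. y - x \<in> A} = emeasure ?N A" if A: "A \<in> sets borel" for A x
  proof -
    have sh: "{y. y - x \<in> A} \<in> sets borel"
      using measurable_sets[of "\<lambda>y. y - x" borel borel A] A by (simp add: vimage_def)
    obtain t where t: "x = R t" using orthogonal_transformation_surj[OF R] by (metis surjD)
    have "R -` {y. y - x \<in> A} = {z. z - t \<in> R -` A}"
      by (simp add: t vimage_def linear_diff[OF orthogonal_transformation_linear[OF R]])
    then show ?thesis using emeasure_lborel_shift[OF pre[OF A], of t] by (simp add: N[OF sh] N[OF A])
  qed
  have RB: "R -` ball 0 r = ball 0 r" for r
    using orthogonal_transformation_norm[OF R] by auto
  have comp: "emeasure lborel A * emeasure ?N B \<le> emeasure lborel B * emeasure ?N A"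
    if "A \<in> sets borel" "B \<in> sets borel" for A B
  proof -
    have "emeasure lborel {z \<in> space lborel. z \<in> A} * emeasure ?N B
       \<le> 1\<^sup>2 * (emeasure lborel {z \<in> space lborel. z \<in> B} * emeasure ?N A)"
    proof (rule Fubini_comparison[where T="\<lambda>z. z"])
      show "sigma_finite_measure ?N"
      proof
        show "\<exists>A. countable A \<and> A \<subseteq> sets ?N \<and> \<Union>A = space ?N \<and> (\<forall>a\<in>A. emeasure ?N a \<noteq> \<infinity>)"
        proof (intro exI[of _ "range (\<lambda>n::nat. ball 0 (real n))"] conjI ballI)
          show "\<Union>(range (\<lambda>n::nat. ball 0 (real n))) = space ?N"
            using reals_Archimedean2 by fastforce
          fix a assume "a \<in> range (\<lambda>n::nat. ball (0::'a) (real n))"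
          then obtain n where "a = ball 0 (real n)" by blast
          then show "emeasure ?N a \<noteq> \<infinity>"
            using emeasure_lborel_ball_finite[of "0::'a" "real n"] by (auto simp: N RB)
        qed auto
      qed
      show "AE y in ?N. emeasure lborel {z \<in> space lborel. z \<in> A \<and> y - z \<in> B} =
          emeasure lborel {z \<in> space lborel. z \<in> B \<and> y - z \<in> A}"
      proof (rule AE_I2)
        fix y :: 'a
        have "{z. y - z \<in> A} \<in> sets borel"
          using measurable_sets[of "\<lambda>z. y - z" borel borel A] that by (simp add: vimage_def)
        then have "{z. z \<in> B \<and> y - z \<in> A} \<in> sets borel" using that by (auto simp: Collect_conj_eq)
        from emeasure_lborel_reflect[OF this, of y]
        show "emeasure lborel {z \<in> space lborel. z \<in> A \<and> y - z \<in> B} =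
            emeasure lborel {z \<in> space lborel. z \<in> B \<and> y - z \<in> A}"
          by (simp add: conj_commute)
      qed
    qed (use that Nshift lborel.sigma_finite_measure_axioms in auto)
    then show ?thesis by simp
  qed
  fix A assume A: "A \<in> sets ?N"
  let ?B = "ball (0::'a) 1"
  have B: "emeasure ?N ?B = emeasure lborel ?B" by (simp add: N RB)
  have fin: "emeasure lborel ?B \<noteq> \<infinity>" "emeasure lborel ?B \<noteq> 0"
    using emeasure_bounded_finite[of "?B"] content_ball_pos[of 1 "0::'a"] by (auto simp: measure_def)
  have "emeasure lborel A * emeasure lborel ?B = emeasure lborel ?B * emeasure ?N A"
    using comp[of A ?B] comp[of ?B A] A B by (intro antisym) (auto simp: mult.commute)
  then show "emeasure ?N A = emeasure lborel A"
    using fin ennreal_mult_cancel_left[of "emeasure lborel ?B" "emeasure ?N A" "emeasure lborel A"]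
    by (simp add: mult.commute)
qed simp

section \<open>The invariant probability measure on the Grassmannian\<close>

definition rot_inv :: "nat \<Rightarrow> 'a::euclidean_space set measure \<Rightarrow> bool" where
  "rot_inv k \<mu> \<longleftrightarrow> prob_space \<mu> \<and> sets \<mu> = sets (Gr k) \<and>
     (\<forall>R. orthogonal_transformation R \<longrightarrow> distr \<mu> (Gr k) ((`) R) = \<mu>)"

lemma rot_inv_space: "rot_inv k \<mu> \<Longrightarrow> space \<mu> = subspaces k"
  using sets_eq_imp_space_eq[of \<mu> "Gr k"] by (simp add: rot_inv_def)

subsection \<open>Uniqueness\<close>

text \<open>A rotation-invariant notion of nearness on the Grassmannian, phrased through the functions that
  generate its events. By homogeneity it compares the distance functions on the unit ball.\<close>

definition close :: "real \<Rightarrow> 'a::euclidean_space set \<Rightarrow> 'a set \<Rightarrow> bool" where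
  "close e V W \<longleftrightarrow> (\<forall>y. \<bar>infdist y V - infdist y W\<bar> \<le> e * norm y)"

lemma close_sym: "close e V W \<Longrightarrow> close e W V"
  by (simp add: close_def abs_minus_commute)

lemma close_rat:
  assumes e: "e > 0"
  shows "close e V W \<longleftrightarrow> (\<forall>p\<in>rat_balls. \<bar>infdist (fst p) V - infdist (fst p) W\<bar> \<le> e * norm (fst p))"
proof
  assume *: "\<forall>p\<in>rat_balls. \<bar>infdist (fst p) V - infdist (fst p) W\<bar> \<le> e * norm (fst p)"
  show "close e V W"
    unfolding close_def
  proof (rule allI, rule field_le_epsilon)
    fix y :: 'a and d :: real assume d: "0 < d"
    define q where "q = d / (2 + e)"
    have q: "q > 0" using d e by (simp add: q_def)
    have qd: "(2 + e) * q = d" using e by (simp add: q_def)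
    obtain c r where c: "(c, r) \<in> rat_balls" "y \<in> ball c r" "cball c r \<subseteq> ball y q"
      using rat_balls_ex[of "ball y q" y] q by auto
    have "0 \<le> dist c y" by simp
    also have "dist c y < r" using c(2) by simp
    finally have "c \<in> cball c r" by simp
    then have yc: "dist y c < q" using c(3) by (meson mem_ball subsetD)
    have "norm c \<le> norm y + q" using yc norm_triangle_ineq2[of c y] by (simp add: dist_norm norm_minus_commute)
    then have "e * norm c \<le> e * norm y + e * q" using e by (simp add: distrib_left[symmetric])
    moreover have "\<bar>infdist c V - infdist c W\<bar> \<le> e * norm c" using bspec[OF * c(1)] by simp
    moreover have "\<bar>infdist y V - infdist c V\<bar> < q" "\<bar>infdist y W - infdist c W\<bar> < q"
      using infdist_triangle_abs[of y V c] infdist_triangle_abs[of y W c] yc by linarith+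
    moreover have "d = 2 * q + e * q" using qd by (simp add: algebra_simps)
    ultimately show "\<bar>infdist y V - infdist y W\<bar> \<le> e * norm y + d" by linarith
  qed
qed (simp add: close_def)

lemma sets_close:
  assumes e: "e > 0"
  shows "{p \<in> space (Gr k \<Otimes>\<^sub>M Gr k). close e (fst p) (snd p)} \<in> sets (Gr k \<Otimes>\<^sub>M Gr k)"
  unfolding close_rat[OF e]
proof (intro sets.sets_Collect_countable_All' countable_rat_balls)
  fix b :: "'a \<times> real"
  have "(\<lambda>p. \<bar>infdist (fst b) (fst p) - infdist (fst b) (snd p)\<bar>) \<in> borel_measurable (Gr k \<Otimes>\<^sub>M Gr k)"
    by (intro borel_measurable_abs borel_measurable_diff measurable_compose[OF measurable_fst measurable_infdist_Gr]
        measurable_compose[OF measurable_snd measurable_infdist_Gr])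
  then show "{p \<in> space (Gr k \<Otimes>\<^sub>M Gr k). \<bar>infdist (fst b) (fst p) - infdist (fst b) (snd p)\<bar> \<le> e * norm (fst b)}
      \<in> sets (Gr k \<Otimes>\<^sub>M Gr k)" by (intro borel_measurable_le) auto
qed

lemma sets_close1:
  assumes "e > 0" "V \<in> subspaces k"
  shows "{W \<in> subspaces k. close e V W} \<in> sets (Gr k)"
proof -
  have "Pair V -` {p \<in> space (Gr k \<Otimes>\<^sub>M Gr k). close e (fst p) (snd p)} \<in> sets (Gr k)"
    by (rule sets_Pair1[OF sets_close[OF assms(1)]])
  also have "Pair V -` {p \<in> space (Gr k \<Otimes>\<^sub>M Gr k). close e (fst p) (snd p)} = {W \<in> subspaces k. close e V W}"
    using assms by (auto simp: space_pair_measure)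
  finally show ?thesis .
qed

lemma close_orthogonal_image:
  assumes R: "orthogonal_transformation (R :: 'a::euclidean_space \<Rightarrow> 'a)"
    and "subspace V" "subspace W"
  shows "close e (R ` V) (R ` W) \<longleftrightarrow> close e V W"
proof -
  have "close e (R ` V) (R ` W) \<longleftrightarrow> (\<forall>y. \<bar>infdist (R y) (R ` V) - infdist (R y) (R ` W)\<bar> \<le> e * norm (R y))"
    unfolding close_def using orthogonal_transformation_surj[OF R] by (metis surjD)
  also have "\<dots> \<longleftrightarrow> close e V W"
    using assms by (simp add: close_def infdist_orthogonal_image orthogonal_transformation_norm)
  finally show ?thesis .
qed

text \<open>Orthogonal maps act transitively on subspaces of equal dimension and preserve \<open>close e\<close>.\<close>

lemma rot_inv_close_const:
  fixes \<mu> :: "'a::euclidean_space set measure"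
  assumes \<mu>: "rot_inv k \<mu>" and e: "e > 0" and VV': "V \<in> subspaces k" "V' \<in> subspaces k"
  shows "emeasure \<mu> {W \<in> subspaces k. close e V W} = emeasure \<mu> {W \<in> subspaces k. close e V' W}"
proof -
  obtain R where R: "orthogonal_transformation R" "R ` V = V'"
    by (rule orthogonal_transformation_subspace_transitive[of V V']) (use VV' in \<open>simp_all add: subspaces_def\<close>)
  have m: "(`) R \<in> measurable \<mu> (Gr k)"
    using measurable_orthogonal_image[OF R(1), of k] \<mu> by (simp add: rot_inv_def cong: measurable_cong_sets)
  have "emeasure \<mu> {W \<in> subspaces k. close e V' W} =
      emeasure (distr \<mu> (Gr k) ((`) R)) {W \<in> subspaces k. close e V' W}"
    using \<mu> R(1) by (simp add: rot_inv_def)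
  also have "\<dots> = emeasure \<mu> ((`) R -` {W \<in> subspaces k. close e V' W} \<inter> space \<mu>)"
    by (rule emeasure_distr[OF m sets_close1[OF e VV'(2)]])
  also have "(`) R -` {W \<in> subspaces k. close e V' W} \<inter> space \<mu> = {W \<in> subspaces k. close e V W}"
  proof (intro set_eqI iffI)
    fix W assume W: "W \<in> {W \<in> subspaces k. close e V W}"
    then have "close e (R ` V) (R ` W)"
      using close_orthogonal_image[OF R(1), of V W] VV'(1) by (simp add: subspaces_def)
    then show "W \<in> (`) R -` {W \<in> subspaces k. close e V' W} \<inter> space \<mu>"
      using W orthogonal_image_subspaces[OF R(1), of W k] by (simp add: R(2) rot_inv_space[OF \<mu>])
  next
    fix W assume "W \<in> (`) R -` {W \<in> subspaces k. close e V' W} \<inter> space \<mu>"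
    then have W: "W \<in> subspaces k" "close e (R ` V) (R ` W)" by (simp_all add: R(2) rot_inv_space[OF \<mu>])
    then show "W \<in> {W \<in> subspaces k. close e V W}"
      using close_orthogonal_image[OF R(1), of V W] VV'(1) by (simp add: subspaces_def)
  qed
  finally show ?thesis by simp
qed

text \<open>The functions \<open>y \<mapsto> infdist y V\<close> are 1-Lipschitz, so their values on a finite net of the
  unit ball, rounded to a grid, determine \<open>V\<close> up to the relation \<open>close e\<close>.\<close>

lemma finite_close_net:
  assumes e: "e > 0"
  obtains \<V> where "finite \<V>" "\<V> \<subseteq> subspaces k"
    "\<And>W :: 'a::euclidean_space set. W \<in> subspaces k \<Longrightarrow> \<exists>V\<in>\<V>. close e V W"
proof -
  \<comment> \<open>Three errors add up: two from moving to a net point, one from rounding on the grid.\<close>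
  define d where "d = e / 4"
  have d: "d > 0" using e by (simp add: d_def)
  have "cball (0::'a) 1 \<subseteq> (\<Union>y\<in>cball 0 1. ball y d)" using d by auto
  then obtain Y where Y: "Y \<subseteq> cball (0::'a) 1" "finite Y" "cball 0 1 \<subseteq> (\<Union>y\<in>Y. ball y d)"
    using compactE_image[OF compact_cball, of "cball (0::'a) 1" "\<lambda>y. ball y d"] by (metis open_ball)
  define g where "g W = (\<lambda>y\<in>Y. \<lfloor>infdist y W / d\<rfloor>)" for W :: "'a set"
  have "g ` subspaces k \<subseteq> (\<Pi>\<^sub>E y\<in>Y. {0..\<lfloor>1 / d\<rfloor>})"
  proof
    fix h assume "h \<in> g ` subspaces k"
    then obtain W where W: "subspace W" "h = g W" by (auto simp: subspaces_def)
    have "\<lfloor>infdist y W / d\<rfloor> \<in> {0..\<lfloor>1 / d\<rfloor>}" if "y \<in> Y" for y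
    proof -
      have "infdist y W \<le> 1" using infdist_le_norm[OF W(1), of y] Y(1) that by force
      then have "infdist y W / d \<le> 1 / d" using d by (simp add: divide_right_mono)
      then show ?thesis using d infdist_nonneg[of y W] by (auto intro: floor_mono)
    qed
    then show "h \<in> (\<Pi>\<^sub>E y\<in>Y. {0..\<lfloor>1 / d\<rfloor>})" unfolding W(2) g_def by auto
  qed
  then have "finite (g ` subspaces k)" using Y(2) by (rule finite_subset[OF _ finite_PiE]) auto
  then obtain \<V> where \<V>: "\<V> \<subseteq> subspaces k" "finite \<V>" "g ` subspaces k = g ` \<V>"
    using finite_subset_image[of "g ` subspaces k" g "subspaces k"] by auto
  have "\<exists>V\<in>\<V>. close e V W" if W: "W \<in> subspaces k" for W
  proof -
    obtain V where V: "V \<in> \<V>" "g V = g W" using \<V>(3) W by (metis imageE imageI)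
    have sV: "subspace V" and sW: "subspace W" using V \<V> W by (auto simp: subspaces_def)
    have net: "\<bar>infdist y V - infdist y W\<bar> \<le> d" if "y \<in> Y" for y
    proof -
      have "\<lfloor>infdist y V / d\<rfloor> = \<lfloor>infdist y W / d\<rfloor>" using V(2) that unfolding g_def by (metis restrict_apply')
      then have "\<bar>infdist y V / d - infdist y W / d\<bar> \<le> 1" by linarith
      then have "\<bar>infdist y V - infdist y W\<bar> / d \<le> 1"
        using d by (metis abs_divide abs_of_pos diff_divide_distrib)
      then show ?thesis using d by (simp add: divide_le_eq)
    qed
    have unit: "\<bar>infdist x V - infdist x W\<bar> \<le> e" if x: "x \<in> cball 0 1" for x
    proof -
      obtain y where "y \<in> Y" "x \<in> ball y d" using Y(3) x by blast
      then have y: "y \<in> Y" "dist y x < d" by simp_all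
      have "\<bar>infdist x V - infdist y V\<bar> < d" "\<bar>infdist x W - infdist y W\<bar> < d"
        using infdist_triangle_abs[of x V y] infdist_triangle_abs[of x W y] y(2) by (simp_all add: dist_commute)
      then show ?thesis using net[OF y(1)] d unfolding d_def by linarith
    qed
    have "\<bar>infdist x V - infdist x W\<bar> \<le> e * norm x" for x
    proof (cases "x = 0")
      case True
      then show ?thesis using sV sW by (simp add: infdist_subspace_eq_0[THEN iffD2] subspace_0)
    next
      case False
      define u where "u = (1 / norm x) *\<^sub>R x"
      have x: "x = norm x *\<^sub>R u" and u: "u \<in> cball 0 1" using False by (simp_all add: u_def)
      have "infdist x V = norm x * infdist u V" "infdist x W = norm x * infdist u W"
        using infdist_scale[OF sV, of "norm x" u] infdist_scale[OF sW, of "norm x" u] x[symmetric] by simp_all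
      then have "\<bar>infdist x V - infdist x W\<bar> = norm x * \<bar>infdist u V - infdist u W\<bar>"
        by (simp add: abs_mult right_diff_distrib[symmetric])
      also have "\<dots> \<le> norm x * e" using unit[OF u] by (simp add: mult_left_mono)
      finally show ?thesis by (simp add: mult.commute)
    qed
    then show ?thesis using V by (auto simp: close_def)
  qed
  with \<V> show ?thesis using that by blast
qed

text \<open>Finitely many neighbourhoods, all of the same mass, cover the Grassmannian.\<close>

lemma rot_inv_close_pos:
  fixes \<mu> :: "'a::euclidean_space set measure"
  assumes \<mu>: "rot_inv k \<mu>" and e: "e > 0" and V: "V \<in> subspaces k"
  shows "emeasure \<mu> {W \<in> subspaces k. close e V W} > 0"
proof (rule ccontr)
  assume "\<not> ?thesis"
  then have 0: "emeasure \<mu> {W \<in> subspaces k. close e V' W} = 0" if "V' \<in> subspaces k" for V'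
    using rot_inv_close_const[OF \<mu> e V that] by simp
  interpret prob_space \<mu> using \<mu> by (simp add: rot_inv_def)
  obtain \<V> where \<V>: "finite \<V>" "\<V> \<subseteq> subspaces k" "\<And>W :: 'a set. W \<in> subspaces k \<Longrightarrow> \<exists>V\<in>\<V>. close e V W"
    using finite_close_net[OF e] by metis
  have s: "{W \<in> subspaces k. close e V' W} \<in> sets \<mu>" if "V' \<in> \<V>" for V'
    using sets_close1[OF e] \<V>(2) that \<mu> by (auto simp: rot_inv_def)
  have "(\<Union>V'\<in>\<V>. {W \<in> subspaces k. close e V' W}) \<in> null_sets \<mu>"
  proof (rule null_sets_UN')
    show "{W \<in> subspaces k. close e V' W} \<in> null_sets \<mu>" if "V' \<in> \<V>" for V'
      using s[OF that] 0 \<V>(2) that by (intro null_setsI) auto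
  qed (simp add: \<V>(1) countable_finite)
  moreover have "(\<Union>V'\<in>\<V>. {W \<in> subspaces k. close e V' W}) = space \<mu>"
    using \<V> rot_inv_space[OF \<mu>] by blast
  ultimately show False using emeasure_space_1 by auto
qed

text \<open>The pairs \<open>(V, W)\<close> of close subspaces with \<open>V \<in> U'\<close> are among those with \<open>W \<in> U\<close>; integrating in either
  order, every section is a neighbourhood, of a mass that does not depend on its centre.\<close>

lemma rot_inv_le:
  fixes \<mu> \<nu> :: "'a::euclidean_space set measure"
  assumes \<mu>: "rot_inv k \<mu>" and \<nu>: "rot_inv k \<nu>" and e: "e > 0"
    and U: "U \<in> sets (Gr k)" and U': "U' \<in> sets (Gr k)"
    and UU': "\<And>V W. V \<in> U' \<Longrightarrow> W \<in> subspaces k \<Longrightarrow> close e V W \<Longrightarrow> W \<in> U"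
    and V0: "V0 \<in> subspaces k"
  shows "emeasure \<nu> U' * emeasure \<mu> {W \<in> subspaces k. close e V0 W} \<le>
     emeasure \<mu> U * emeasure \<nu> {W \<in> subspaces k. close e V0 W}"
proof -
  interpret M: prob_space \<mu> using \<mu> by (simp add: rot_inv_def)
  interpret N: prob_space \<nu> using \<nu> by (simp add: rot_inv_def)
  interpret NM: pair_sigma_finite \<nu> \<mu> ..
  have ss: "sets (\<nu> \<Otimes>\<^sub>M \<mu>) = sets (Gr k \<Otimes>\<^sub>M Gr k)"
    using \<mu> \<nu> by (intro sets_pair_measure_cong) (auto simp: rot_inv_def)
  have sp: "space (\<nu> \<Otimes>\<^sub>M \<mu>) = subspaces k \<times> subspaces k"
    using rot_inv_space[OF \<mu>] rot_inv_space[OF \<nu>] by (simp add: space_pair_measure)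
  define S where "S C D = {p \<in> space (Gr k \<Otimes>\<^sub>M Gr k). close e (fst p) (snd p)} \<inter> (C \<times> D)" for C D :: "'a set set"
  have S: "S C D \<in> sets (\<nu> \<Otimes>\<^sub>M \<mu>)" if "C \<in> sets (Gr k)" "D \<in> sets (Gr k)" for C D
    unfolding ss S_def using sets_close[OF e] that by auto
  have spG: "subspaces k \<in> sets (Gr k)" using sets.top[of "Gr k"] by simp
  have sub: "C \<subseteq> subspaces k" if "C \<in> sets (Gr k)" for C using sets.sets_into_space[OF that] by simp
  let ?g = "emeasure \<mu> {W \<in> subspaces k. close e V0 W}"
  let ?h = "emeasure \<nu> {W \<in> subspaces k. close e V0 W}"
  have "emeasure \<nu> U' * ?g = (\<integral>\<^sup>+V. ?g * indicator U' V \<partial>\<nu>)"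
    using U' \<nu> by (subst nn_integral_cmult_indicator) (auto simp: rot_inv_def mult.commute)
  also have "\<dots> = (\<integral>\<^sup>+V. emeasure \<mu> (Pair V -` S U' (subspaces k)) \<partial>\<nu>)"
  proof (rule nn_integral_cong)
    fix V assume "V \<in> space \<nu>"
    then have V: "V \<in> subspaces k" using rot_inv_space[OF \<nu>] by simp
    have "Pair V -` S U' (subspaces k) = (if V \<in> U' then {W \<in> subspaces k. close e V W} else {})"
      using V by (auto simp: S_def space_pair_measure)
    then show "?g * indicator U' V = emeasure \<mu> (Pair V -` S U' (subspaces k))"
      by (simp add: rot_inv_close_const[OF \<mu> e V V0] indicator_def)
  qed
  also have "\<dots> = emeasure (\<nu> \<Otimes>\<^sub>M \<mu>) (S U' (subspaces k))"
    by (rule M.emeasure_pair_measure_alt[OF S[OF U' spG], symmetric])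
  also have "\<dots> \<le> emeasure (\<nu> \<Otimes>\<^sub>M \<mu>) (S (subspaces k) U)"
  proof (rule emeasure_mono[OF _ S[OF spG U]])
    show "S U' (subspaces k) \<subseteq> S (subspaces k) U"
    proof
      fix p assume p: "p \<in> S U' (subspaces k)"
      then have "fst p \<in> U'" "snd p \<in> subspaces k" "close e (fst p) (snd p)" by (auto simp: S_def)
      then have "snd p \<in> U" "fst p \<in> subspaces k" using UU' sub[OF U'] by blast+
      then show "p \<in> S (subspaces k) U" using p by (auto simp: S_def)
    qed
  qed
  also have "\<dots> = (\<integral>\<^sup>+W. emeasure \<nu> ((\<lambda>V. (V, W)) -` S (subspaces k) U) \<partial>\<mu>)"
    by (rule NM.emeasure_pair_measure_alt2[OF S[OF spG U]])
  also have "\<dots> = (\<integral>\<^sup>+W. ?h * indicator U W \<partial>\<mu>)"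
  proof (rule nn_integral_cong)
    fix W assume "W \<in> space \<mu>"
    then have W: "W \<in> subspaces k" using rot_inv_space[OF \<mu>] by simp
    have "(\<lambda>V. (V, W)) -` S (subspaces k) U = (if W \<in> U then {V \<in> subspaces k. close e W V} else {})"
      using W close_sym by (auto simp: S_def space_pair_measure)
    then show "emeasure \<nu> ((\<lambda>V. (V, W)) -` S (subspaces k) U) = ?h * indicator U W"
      by (simp add: rot_inv_close_const[OF \<nu> e W V0] indicator_def)
  qed
  also have "\<dots> = emeasure \<mu> U * ?h"
    using U \<mu> by (subst nn_integral_cmult_indicator) (auto simp: rot_inv_def mult.commute)
  finally show ?thesis .
qed

text \<open>Both measures give all \<open>close e\<close>-neighbourhoods the same positive mass, whence by Fubini the
  measure of a set is at most that of its neighbourhood under the other measure.\<close>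

lemma rot_inv_unique:
  fixes \<mu> \<nu> :: "'a::euclidean_space set measure"
  assumes \<mu>: "rot_inv k \<mu>" and \<nu>: "rot_inv k \<nu>"
  shows "\<mu> = \<nu>"
proof -
  have spG: "subspaces k \<in> sets (Gr k :: 'a set measure)" using sets.top[of "Gr k"] by simp
  have nbhd: "emeasure \<nu> U' \<le> emeasure \<mu> U"
    if \<mu>: "rot_inv k \<mu>" and \<nu>: "rot_inv k \<nu>" and e: "e > 0"
      and U: "U \<in> sets (Gr k)" and U': "U' \<in> sets (Gr k)"
      and UU': "\<And>V W. V \<in> U' \<Longrightarrow> W \<in> subspaces k \<Longrightarrow> close e V W \<Longrightarrow> W \<in> U"
    for U U' :: "'a set set" and e and \<mu> \<nu> :: "'a set measure"
  proof -
    interpret M: prob_space \<mu> using \<mu> by (simp add: rot_inv_def)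
    interpret N: prob_space \<nu> using \<nu> by (simp add: rot_inv_def)
    obtain V0 :: "'a set" where V0: "V0 \<in> subspaces k" using M.not_empty rot_inv_space[OF \<mu>] by auto
    let ?g = "emeasure \<mu> {W \<in> subspaces k. close e V0 W}"
    let ?h = "emeasure \<nu> {W \<in> subspaces k. close e V0 W}"
    have one: "emeasure \<mu> (subspaces k) = 1" "emeasure \<nu> (subspaces k) = 1"
      using M.emeasure_space_1 N.emeasure_space_1 rot_inv_space[OF \<mu>] rot_inv_space[OF \<nu>] by auto
    \<comment> \<open>For the whole Grassmannian the comparison shows that the two neighbourhood masses agree.\<close>
    have "?g \<le> ?h" using rot_inv_le[OF \<mu> \<nu> e spG spG _ V0] one by simp
    moreover have "?h \<le> ?g" using rot_inv_le[OF \<nu> \<mu> e spG spG _ V0] one by simp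
    ultimately have gh: "?g = ?h" by simp
    have "?g > 0" "?g \<noteq> \<top>" using rot_inv_close_pos[OF \<mu> e V0] M.emeasure_finite by auto
    moreover have "emeasure \<nu> U' * ?g \<le> emeasure \<mu> U * ?g"
      using rot_inv_le[OF \<mu> \<nu> e U U' UU' V0] gh by simp
    ultimately show ?thesis
      by (subst (asm) (1 2) mult.commute, subst (asm) ennreal_mult_le_mult_iff) auto
  qed
  have le: "emeasure \<nu> U \<le> emeasure \<mu> U"
    if \<mu>: "rot_inv k \<mu>" and \<nu>: "rot_inv k \<nu>" and U: "U \<in> Gr_events k"
    for U :: "'a set set" and \<mu> \<nu> :: "'a set measure"
  proof -
    obtain I where I: "finite I" "U = {V \<in> subspaces k. \<forall>(y, r)\<in>I. r < infdist y V}"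
      using U unfolding Gr_events_def by blast
    \<comment> \<open>The events \<open>U' n\<close> increase to \<open>U\<close>, and subspaces close to an element of \<open>U' n\<close> lie in \<open>U\<close>.\<close>
    define U' where "U' n = {V \<in> subspaces k. \<forall>(y, r)\<in>(\<lambda>(y, r). (y, r + norm y / real (Suc n))) ` I. r < infdist y V}"
      for n
    have U'_alt: "U' n = {V \<in> subspaces k. \<forall>p\<in>I. snd p + norm (fst p) / real (Suc n) < infdist (fst p) V}" for n
      by (auto simp: U'_def case_prod_beta)
    have "U' n \<in> Gr_events k" for n unfolding U'_def Gr_events_def using I(1) by blast
    then have U's: "U' n \<in> sets (Gr k)" for n unfolding sets_Gr by (rule sigma_sets.Basic)
    have Us: "U \<in> sets (Gr k)" unfolding sets_Gr using U by (rule sigma_sets.Basic)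
    have "emeasure \<nu> (U' n) \<le> emeasure \<mu> U" for n
    proof (rule nbhd[OF \<mu> \<nu> _ Us U's])
      show "(1 / real (Suc n)) > 0" by simp
      fix V W assume VW: "V \<in> U' n" "W \<in> subspaces k" "close (1 / real (Suc n)) V W"
      have "snd p < infdist (fst p) W" if "p \<in> I" for p
      proof -
        have "\<bar>infdist (fst p) V - infdist (fst p) W\<bar> \<le> 1 / real (Suc n) * norm (fst p)"
          using VW(3) unfolding close_def by blast
        moreover have "snd p + norm (fst p) / real (Suc n) < infdist (fst p) V"
          using VW(1) that by (auto simp: U'_alt)
        ultimately show ?thesis by (simp add: abs_le_iff)
      qed
      then show "W \<in> U" using VW(2) unfolding I(2) by auto
    qed
    moreover have "incseq U'"
    proof (rule incseq_SucI, rule subsetI)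
      fix n V assume V: "V \<in> U' n"
      have "snd p + norm (fst p) / real (Suc (Suc n)) < infdist (fst p) V" if "p \<in> I" for p
      proof -
        have "norm (fst p) / real (Suc (Suc n)) \<le> norm (fst p) / real (Suc n)"
          by (intro divide_left_mono) auto
        moreover have "snd p + norm (fst p) / real (Suc n) < infdist (fst p) V"
          using V that by (simp add: U'_alt)
        ultimately show ?thesis by linarith
      qed
      then show "V \<in> U' (Suc n)" using V by (simp add: U'_alt)
    qed
    moreover have "(\<Union>n. U' n) = U"
    proof (intro set_eqI iffI)
      fix V assume "V \<in> (\<Union>n. U' n)"
      then obtain n where V: "V \<in> U' n" by blast
      have "snd p < infdist (fst p) V" if "p \<in> I" for p
      proof -
        have "0 \<le> norm (fst p) / real (Suc n)" by simp
        moreover have "snd p + norm (fst p) / real (Suc n) < infdist (fst p) V"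
          using V that by (simp add: U'_alt)
        ultimately show ?thesis by linarith
      qed
      then show "V \<in> U" using V by (simp add: U'_alt I(2) case_prod_beta)
    next
      fix V assume V: "V \<in> U"
      have "\<forall>\<^sub>F n in sequentially. snd p + norm (fst p) / real (Suc n) < infdist (fst p) V" if "p \<in> I" for p
      proof -
        have "(\<lambda>n. snd p + norm (fst p) / real (Suc n)) \<longlonglongrightarrow> snd p + 0"
          by (intro tendsto_add tendsto_const LIMSEQ_Suc[OF lim_const_over_n])
        moreover have "snd p + 0 < infdist (fst p) V" using V that unfolding I(2) by force
        ultimately show ?thesis by (rule order_tendstoD)
      qed
      then have "\<forall>\<^sub>F n in sequentially. \<forall>p\<in>I. snd p + norm (fst p) / real (Suc n) < infdist (fst p) V"
        by (intro eventually_ball_finite[OF I(1)]) blast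
      then obtain n where "\<forall>p\<in>I. snd p + norm (fst p) / real (Suc n) < infdist (fst p) V"
        using eventually_happens'[OF sequentially_bot] by blast
      then show "V \<in> (\<Union>n. U' n)" using V unfolding U'_alt I(2) by blast
    qed
    moreover have "range U' \<subseteq> sets \<nu>" using U's \<nu> by (auto simp: rot_inv_def)
    ultimately have "(SUP n. emeasure \<nu> (U' n)) = emeasure \<nu> U" using SUP_emeasure_incseq[of U' \<nu>] by simp
    then show ?thesis using \<open>\<And>n. emeasure \<nu> (U' n) \<le> emeasure \<mu> U\<close> by (metis SUP_least)
  qed
  show ?thesis
  proof (rule measure_eqI_generator_eq[OF Int_stable_Gr_events])
    show "Gr_events k \<subseteq> Pow (subspaces k)" by (auto simp: Gr_events_def)
    show "emeasure \<mu> X = emeasure \<nu> X" if "X \<in> Gr_events k" for X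
      using le[OF \<mu> \<nu> that] le[OF \<nu> \<mu> that] by simp
    show "sets \<mu> = sigma_sets (subspaces k) (Gr_events k)" "sets \<nu> = sigma_sets (subspaces k) (Gr_events k)"
      using \<mu> \<nu> by (auto simp: rot_inv_def sets_Gr)
    have "{V \<in> subspaces k. \<forall>(y, r)\<in>{}. r < infdist y V} \<in> Gr_events k" unfolding Gr_events_def by blast
    then show "range (\<lambda>n::nat. subspaces k) \<subseteq> Gr_events k" by auto
    show "emeasure \<mu> (subspaces k) \<noteq> \<infinity>" for i :: nat
      using prob_space.emeasure_space_1[of \<mu>] \<mu> rot_inv_space[OF \<mu>] by (simp add: rot_inv_def)
  qed auto
qed

subsection \<open>Existence\<close>

definition unif_ball :: "'a::euclidean_space measure" where
  "unif_ball = uniform_measure lborel (ball 0 1)"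

lemma lborel_unit_ball:
  "emeasure lborel (ball (0::'a::euclidean_space) 1) \<noteq> 0"
  "emeasure lborel (ball (0::'a) 1) \<noteq> \<infinity>"
  using emeasure_lborel_ball_finite[of "0::'a" 1] content_ball_pos[of 1 "0::'a"] by (auto simp: measure_def)

lemma prob_space_unif_ball: "prob_space unif_ball"
  unfolding unif_ball_def by (rule prob_space_uniform_measure[OF lborel_unit_ball])

lemma sets_unif_ball [simp, measurable_cong]: "sets unif_ball = sets borel"
  by (simp add: unif_ball_def)

lemma space_unif_ball [simp]: "space unif_ball = UNIV"
  by (simp add: unif_ball_def)

lemma unif_ball_orthogonal:
  fixes R :: "'a::euclidean_space \<Rightarrow> 'a"
  assumes R: "orthogonal_transformation R"
  shows "distr unif_ball borel R = unif_ball"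
proof (rule measure_eqI)
  fix A assume "A \<in> sets (distr unif_ball borel R)"
  then have A: "A \<in> sets borel" by simp
  have Rm: "R \<in> borel_measurable borel" by (rule orthogonal_transformation_borel[OF R])
  have pre: "R -` A \<in> sets borel" if "A \<in> sets borel" for A
    using measurable_sets[OF Rm that] by simp
  have Rb: "R -` ball 0 1 = ball 0 1" using orthogonal_transformation_norm[OF R] by auto
  have lb: "emeasure lborel (R -` B) = emeasure lborel B" if "B \<in> sets borel" for B
  proof -
    have "emeasure lborel B = emeasure (distr lborel borel R) B"
      by (simp add: lborel_orthogonal_transformation[OF R])
    also have "\<dots> = emeasure lborel (R -` B)" using Rm that by (subst emeasure_distr) auto
    finally show ?thesis by simp
  qed
  have "emeasure (distr unif_ball borel R) A = emeasure unif_ball (R -` A)"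
    using A Rm by (subst emeasure_distr) (auto cong: measurable_cong_sets)
  also have "\<dots> = emeasure lborel (R -` (ball 0 1 \<inter> A)) / emeasure lborel (ball (0::'a) 1)"
    unfolding unif_ball_def using pre[OF A] by (subst emeasure_uniform_measure) (auto simp: Rb)
  also have "\<dots> = emeasure unif_ball A"
    unfolding unif_ball_def lb[OF sets.Int[OF borel_open[OF open_ball] A]]
    using A by (subst emeasure_uniform_measure) auto
  finally show "emeasure (distr unif_ball borel R) A = emeasure unif_ball A" .
qed simp

lemma AE_unif_ball_subspace:
  fixes V :: "'a::euclidean_space set"
  assumes "subspace V" "dim V < DIM('a)"
  shows "AE x in unif_ball. x \<notin> V"
  unfolding unif_ball_def
proof (rule AE_uniform_measureI)
  have "negligible V" using assms(2) by (rule negligible_lowdim)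
  moreover have "V \<in> sets borel" using closed_subspace[OF assms(1)] by auto
  ultimately have "V \<in> null_sets lborel"
    by (metis negligible_iff_null_sets null_sets_completion_iff sets_lborel)
  then show "AE x in lborel. x \<in> ball 0 1 \<longrightarrow> x \<notin> V" using AE_not_in by fastforce
qed simp

lemma span_insert_image:
  assumes "orthogonal_transformation (R :: 'a::euclidean_space \<Rightarrow> 'a)"
  shows "span (insert (R x) (R ` V)) = R ` span (insert x V)"
  using linear_span_image[OF orthogonal_transformation_linear[OF assms], of "insert x V"] by simp

text \<open>It makes no difference to which of the two subspaces a vector is added; this lets the induction for
  almost sure transversality enlarge \<open>L\<close> instead of \<open>V\<close>.\<close>

lemma transv_span_insert:
  assumes V: "subspace V" and L: "subspace L" and t: "transv V (span (insert x L))"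
  shows "transv (span (insert x V)) L"
  unfolding transv_def
proof
  fix z
  obtain v where v: "v \<in> V" "z + v \<in> span (insert x L)" using t by (auto simp: transv_def)
  then obtain s where s: "z + v - s *\<^sub>R x \<in> L" using L by (auto simp: span_insert span_eq_iff[THEN iffD2])
  have "v - s *\<^sub>R x \<in> span (insert x V)" using v(1) by (intro span_diff span_scale span_base) auto
  then show "\<exists>w\<in>span (insert x V). z + w \<in> L" using s by (intro bexI) (auto simp: algebra_simps)
qed

text \<open>The span of independent uniformly distributed vectors is invariant, and almost surely each
  new vector leaves any prescribed proper subspace; this gives existence by adding one vector at a
  time, together with transversality to every fixed subspace of complementary dimension.\<close>

lemma rot_inv_exists:
  assumes "k \<le> DIM('a::euclidean_space)"
  shows "\<exists>\<mu>. rot_inv k \<mu> \<and> (\<forall>L :: 'a set. subspace L \<longrightarrow> DIM('a) \<le> dim L + k \<longrightarrow> (AE V in \<mu>. transv V L))"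
  using assms
proof (induction k)
  case 0
  have sp: "subspaces 0 = {{0 :: 'a}}"
    by (auto simp: subspaces_def dest: subspace_0)
  let ?\<mu> = "return (Gr 0) {0 :: 'a}"
  have in0: "{0 :: 'a} \<in> space (Gr 0)" by (simp add: sp)
  have "distr ?\<mu> (Gr 0) ((`) R) = ?\<mu>" if R: "orthogonal_transformation R" for R :: "'a \<Rightarrow> 'a"
    using distr_return[OF measurable_orthogonal_image[OF R] in0] linear_0[OF orthogonal_transformation_linear[OF R]]
    by simp
  then have "rot_inv 0 ?\<mu>" by (auto simp: rot_inv_def intro!: prob_space_return in0)
  moreover have "AE V in ?\<mu>. transv V L" if "subspace L" "DIM('a) \<le> dim L + 0" for L :: "'a set"
  proof -
    have "dim L = DIM('a)" using that(2) dim_subset_UNIV[of L] by simp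
    then have "span L = UNIV" by (simp only: dim_eq_full)
    then have "L = UNIV" using that(1) by (metis span_eq_iff)
    then show ?thesis by (intro AE_I2) (auto simp: transv_def sp)
  qed
  ultimately show ?case by blast
next
  case (Suc k)
  from Suc.IH[OF Suc_leD[OF Suc.prems]] obtain \<mu> :: "'a set measure" where \<mu>: "rot_inv k \<mu>"
    and tr: "\<And>L. subspace L \<Longrightarrow> DIM('a) \<le> dim L + k \<Longrightarrow> AE V in \<mu>. transv V L" by blast
  have k: "k < DIM('a)" using Suc.prems by simp
  interpret M: prob_space \<mu> using \<mu> by (simp add: rot_inv_def)
  interpret U: prob_space "unif_ball :: 'a measure" by (rule prob_space_unif_ball)
  interpret MU: pair_prob_space \<mu> "unif_ball :: 'a measure" ..

  have sM [measurable_cong]: "sets \<mu> = sets (Gr k)" using \<mu> by (simp add: rot_inv_def)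
  have spM: "space \<mu> = subspaces k" by (rule rot_inv_space[OF \<mu>])
  have sMU: "sets (\<mu> \<Otimes>\<^sub>M unif_ball) = sets (Gr k \<Otimes>\<^sub>M borel)"
    by (intro sets_pair_measure_cong sM sets_unif_ball)
  obtain V0 :: "'a set" where V0: "V0 \<in> subspaces (Suc k)"
    by (rule choose_subspace_of_subspace[of "Suc k" "UNIV :: 'a set"])
      (use Suc.prems in \<open>simp_all add: subspaces_def\<close>)
  have insm: "ins V0 \<in> measurable (\<mu> \<Otimes>\<^sub>M unif_ball) (Gr (Suc k))"
    using measurable_ins[OF V0] measurable_cong_sets[OF sMU refl] by blast
  define \<nu> where "\<nu> = distr (\<mu> \<Otimes>\<^sub>M unif_ball) (Gr (Suc k)) (ins V0)"
  have memset: "{p \<in> space (\<mu> \<Otimes>\<^sub>M unif_ball). snd p \<notin> fst p} \<in> sets (\<mu> \<Otimes>\<^sub>M unif_ball)"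
  proof -
    have "(\<lambda>p. infdist (snd p) (fst p)) \<in> borel_measurable (\<mu> \<Otimes>\<^sub>M unif_ball)"
      by (rule measurable_infdist_joint[of _ _ k]) measurable
    then have "{p \<in> space (\<mu> \<Otimes>\<^sub>M unif_ball). 0 < infdist (snd p) (fst p)} \<in> sets (\<mu> \<Otimes>\<^sub>M unif_ball)"
      by (intro borel_measurable_less) auto
    moreover have "0 < infdist (snd p) (fst p) \<longleftrightarrow> snd p \<notin> fst p" if "p \<in> space (\<mu> \<Otimes>\<^sub>M unif_ball)" for p
    proof -
      have "subspace (fst p)" using that spM by (auto simp: space_pair_measure subspaces_def)
      from infdist_subspace_eq_0[OF this, of "snd p"] infdist_nonneg[of "snd p" "fst p"]
      show ?thesis by linarith
    qed
    ultimately show ?thesis by (simp cong: conj_cong)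
  qed
  have AE_notin: "AE p in \<mu> \<Otimes>\<^sub>M unif_ball. snd p \<notin> fst p"
    using memset
  proof (rule MU.AE_pair_measure)
    show "AE V in \<mu>. AE x in unif_ball. snd (V, x) \<notin> fst (V, x)"
    proof (rule AE_I2)
      fix V assume "V \<in> space \<mu>"
      then have "subspace V" "dim V < DIM('a)" using k by (auto simp: spM subspaces_def)
      then show "AE x in unif_ball. snd (V, x) \<notin> fst (V, x)" unfolding fst_conv snd_conv
        by (rule AE_unif_ball_subspace)
    qed
  qed
  have inv: "distr \<nu> (Gr (Suc k)) ((`) R) = \<nu>" if R: "orthogonal_transformation R" for R :: "'a \<Rightarrow> 'a"
  proof -
    let ?R2 = "\<lambda>(V, x). (R ` V, R x)"
    have Rm: "(`) R \<in> measurable \<mu> (Gr k)"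
      using measurable_orthogonal_image[OF R, of k] by (simp add: sM cong: measurable_cong_sets)
    have Rx: "R \<in> measurable unif_ball borel"
      using orthogonal_transformation_borel[OF R] by (simp cong: measurable_cong_sets)
    have "distr \<mu> (Gr k) ((`) R) \<Otimes>\<^sub>M distr unif_ball borel R = distr (\<mu> \<Otimes>\<^sub>M unif_ball) (Gr k \<Otimes>\<^sub>M borel) ?R2"
      using Rm Rx by (rule pair_measure_distr) (simp add: unif_ball_orthogonal[OF R] U.sigma_finite_measure_axioms)
    then have d2: "distr (\<mu> \<Otimes>\<^sub>M unif_ball) (Gr k \<Otimes>\<^sub>M borel) ?R2 = \<mu> \<Otimes>\<^sub>M unif_ball"
      using \<mu> R by (simp add: unif_ball_orthogonal[OF R] rot_inv_def)
    have R2m: "?R2 \<in> measurable (\<mu> \<Otimes>\<^sub>M unif_ball) (Gr k \<Otimes>\<^sub>M borel)"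
      unfolding case_prod_beta'
      by (intro measurable_Pair measurable_compose[OF measurable_fst Rm] measurable_compose[OF measurable_snd Rx])
    have "distr \<nu> (Gr (Suc k)) ((`) R) = distr (\<mu> \<Otimes>\<^sub>M unif_ball) (Gr (Suc k)) ((`) R \<circ> ins V0)"
      unfolding \<nu>_def by (rule distr_distr[OF measurable_orthogonal_image[OF R] insm])
    also have "\<dots> = distr (\<mu> \<Otimes>\<^sub>M unif_ball) (Gr (Suc k)) (ins V0 \<circ> ?R2)"
    proof (rule distr_cong_AE[OF refl refl])
      show "AE p in \<mu> \<Otimes>\<^sub>M unif_ball. ((`) R \<circ> ins V0) p = (ins V0 \<circ> ?R2) p"
        using AE_notin
      proof eventually_elim
        case (elim p)
        have "R (snd p) \<notin> R ` fst p" using elim orthogonal_transformation_inj[OF R] by (auto dest: injD)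
        then show ?case using elim by (simp add: ins_def case_prod_beta span_insert_image[OF R])
      qed
      show "(`) R \<circ> ins V0 \<in> measurable (\<mu> \<Otimes>\<^sub>M unif_ball) (Gr (Suc k))"
        by (rule measurable_comp[OF insm measurable_orthogonal_image[OF R]])
      show "ins V0 \<circ> ?R2 \<in> measurable (\<mu> \<Otimes>\<^sub>M unif_ball) (Gr (Suc k))"
        by (rule measurable_comp[OF R2m measurable_ins[OF V0]])
    qed
    also have "\<dots> = distr (distr (\<mu> \<Otimes>\<^sub>M unif_ball) (Gr k \<Otimes>\<^sub>M borel) ?R2) (Gr (Suc k)) (ins V0)"
      by (rule distr_distr[OF measurable_ins[OF V0] R2m, symmetric])
    also have "\<dots> = \<nu>" unfolding d2 \<nu>_def ..
    finally show ?thesis .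
  qed
  have "prob_space \<nu>" unfolding \<nu>_def by (rule MU.prob_space_distr[OF insm])
  then have "rot_inv (Suc k) \<nu>" using inv by (auto simp: rot_inv_def) (simp_all add: \<nu>_def)
  moreover have "AE V in \<nu>. transv V L" if L: "subspace L" "DIM('a) \<le> dim L + Suc k" for L :: "'a set"
  proof -
    let ?P = "\<lambda>p. snd p \<notin> fst p \<longrightarrow> transv (ins V0 p) L"
    have ms: "{p \<in> space (\<mu> \<Otimes>\<^sub>M unif_ball). transv (ins V0 p) L} \<in> sets (\<mu> \<Otimes>\<^sub>M unif_ball)"
    proof -
      have "ins V0 -` {V \<in> subspaces (Suc k). transv V L} \<inter> space (\<mu> \<Otimes>\<^sub>M unif_ball) \<in> sets (\<mu> \<Otimes>\<^sub>M unif_ball)"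
        by (rule measurable_sets[OF insm sets_Gr_transv[OF L(1)]])
      also have "ins V0 -` {V \<in> subspaces (Suc k). transv V L} \<inter> space (\<mu> \<Otimes>\<^sub>M unif_ball) =
          {p \<in> space (\<mu> \<Otimes>\<^sub>M unif_ball). transv (ins V0 p) L}"
        using measurable_space[OF insm] by auto
      finally show ?thesis .
    qed
    have msP: "{p \<in> space (\<mu> \<Otimes>\<^sub>M unif_ball). ?P p} \<in> sets (\<mu> \<Otimes>\<^sub>M unif_ball)"
      by (rule sets.sets_Collect_imp[OF ms memset])
    have x: "AE x in unif_ball. DIM('a) \<le> dim (span (insert x L)) + k"
    proof (cases "dim L < DIM('a)")
      case True
      show ?thesis
        using AE_unif_ball_subspace[OF L(1) True]
      proof eventually_elim
        case (elim x)
        then show ?case using L dim_span_insert[OF L(1) elim] by simp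
      qed
    next
      case False
      have "dim L \<le> dim (span (insert x L))" for x by (intro dim_subset) (auto intro: span_base)
      then show ?thesis using False by (intro AE_I2) (meson add_increasing2 leI le_trans zero_le)
    qed
    have "AE x in unif_ball. AE V in \<mu>. ?P (V, x)"
      using x
    proof eventually_elim
      case (elim x)
      have "AE V in \<mu>. transv V (span (insert x L))" by (rule tr[OF subspace_span elim])
      moreover have "AE V in \<mu>. subspace V" by (intro AE_I2) (simp add: spM subspaces_def)
      ultimately show ?case
      proof eventually_elim
        case (elim V)
        then show ?case using transv_span_insert[OF elim(2) L(1) elim(1)] by (simp add: ins_def)
      qed
    qed
    then have "AE V in \<mu>. AE x in unif_ball. ?P (V, x)"
      using MU.AE_commute[of "\<lambda>V x. ?P (V, x)"] msP by simp
    with msP have "AE p in \<mu> \<Otimes>\<^sub>M unif_ball. ?P p" by (rule MU.AE_pair_measure)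
    with AE_notin have "AE p in \<mu> \<Otimes>\<^sub>M unif_ball. transv (ins V0 p) L" by eventually_elim simp
    then show ?thesis unfolding \<nu>_def using insm sets_Gr_transv[OF L(1), of "Suc k"]
      by (subst AE_distr_iff) auto
  qed
  ultimately show ?case by blast
qed

definition haar :: "nat \<Rightarrow> 'a::euclidean_space set measure" where
  "haar k = (THE \<mu>. rot_inv k \<mu>)"

lemma haar_eqI: "rot_inv k \<mu> \<Longrightarrow> haar k = \<mu>"
  unfolding haar_def by (intro the_equality) (auto intro: rot_inv_unique)

lemma haar:
  assumes "k \<le> DIM('a::euclidean_space)"
  shows rot_inv_haar: "rot_inv k (haar k :: 'a set measure)"
    and AE_haar_transv: "\<And>L :: 'a set. subspace L \<Longrightarrow> DIM('a) \<le> dim L + k \<Longrightarrow> AE V in haar k. transv V L"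
proof -
  obtain \<mu> :: "'a set measure" where \<mu>: "rot_inv k \<mu>"
    "\<And>L. subspace L \<Longrightarrow> DIM('a) \<le> dim L + k \<Longrightarrow> AE V in \<mu>. transv V L"
    using rot_inv_exists[OF assms] by blast
  with haar_eqI[OF \<mu>(1)]
  show "rot_inv k (haar k :: 'a set measure)"
    "\<And>L :: 'a set. subspace L \<Longrightarrow> DIM('a) \<le> dim L + k \<Longrightarrow> AE V in haar k. transv V L" by auto
qed

lemma sets_haar: "k \<le> DIM('a::euclidean_space) \<Longrightarrow> sets (haar k :: 'a set measure) = sets (Gr k)"
  using rot_inv_haar by (auto simp: rot_inv_def)

lemma space_haar: "k \<le> DIM('a::euclidean_space) \<Longrightarrow> space (haar k :: 'a set measure) = subspaces k"
  using rot_inv_haar rot_inv_space by blast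

lemma prob_space_haar: "k \<le> DIM('a::euclidean_space) \<Longrightarrow> prob_space (haar k :: 'a set measure)"
  using rot_inv_haar by (auto simp: rot_inv_def)

text \<open>The image under taking complements is again invariant, so uniqueness applies.\<close>

lemma haar_perp:
  assumes k: "k \<le> DIM('a::euclidean_space)"
  shows "distr (haar k) (Gr (DIM('a) - k)) orthogonal_comp = (haar (DIM('a) - k) :: 'a set measure)"
proof (rule haar_eqI[symmetric])
  let ?H = "haar k :: 'a set measure" and ?l = "DIM('a) - k"
  have m: "orthogonal_comp \<in> measurable ?H (Gr ?l)"
    using measurable_perp[of k] by (simp add: sets_haar[OF k] cong: measurable_cong_sets)
  interpret prob_space ?H by (rule prob_space_haar[OF k])
  have "distr (distr ?H (Gr ?l) orthogonal_comp) (Gr ?l) ((`) R) = distr ?H (Gr ?l) orthogonal_comp"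
    if R: "orthogonal_transformation R" for R :: "'a \<Rightarrow> 'a"
  proof -
    have Rm: "(`) R \<in> measurable ?H (Gr k)"
      using measurable_orthogonal_image[OF R, of k] by (simp add: sets_haar[OF k] cong: measurable_cong_sets)
    have "distr (distr ?H (Gr ?l) orthogonal_comp) (Gr ?l) ((`) R) = distr ?H (Gr ?l) ((`) R \<circ> orthogonal_comp)"
      by (rule distr_distr[OF measurable_orthogonal_image[OF R] m])
    also have "(`) R \<circ> orthogonal_comp = orthogonal_comp \<circ> (`) R"
      by (rule ext) (simp add: perp_orthogonal_image[OF R])
    also have "distr ?H (Gr ?l) (orthogonal_comp \<circ> (`) R) = distr (distr ?H (Gr k) ((`) R)) (Gr ?l) orthogonal_comp"
      by (rule distr_distr[OF measurable_perp Rm, symmetric])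
    also have "distr ?H (Gr k) ((`) R) = ?H" using rot_inv_haar[OF k] R by (auto simp: rot_inv_def)
    finally show ?thesis .
  qed
  then show "rot_inv ?l (distr ?H (Gr ?l) orthogonal_comp)"
    using prob_space_distr[OF m] by (simp add: rot_inv_def)
qed

section \<open>Geometry of the Beltrami-Klein model\<close>

lemma space_form_0 [simp]: "space_form 0 = UNIV"
  by (simp add: space_form_def)

lemma open_space_form [simp]: "open (space_form K)"
  by (simp add: space_form_def)

lemma zero_in_space_form [simp]: "K \<le> 0 \<Longrightarrow> 0 \<in> space_form K"
  by (auto simp: space_form_def)

lemma in_space_form_iff:
  assumes "K \<le> 0"
  shows "x \<in> space_form K \<longleftrightarrow> 0 < 1 + K * (norm x)\<^sup>2"
proof (cases "K = 0")
  case False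
  then have K: "0 < - K" using assms by simp
  have "x \<in> space_form K \<longleftrightarrow> norm x * sqrt (- K) < 1"
    using K by (simp add: space_form_def less_divide_eq)
  also have "\<dots> \<longleftrightarrow> norm x * sqrt (- K) < sqrt 1" by simp
  also have "norm x * sqrt (- K) = sqrt ((norm x)\<^sup>2 * (- K))" unfolding real_sqrt_mult by simp
  also have "sqrt ((norm x)\<^sup>2 * (- K)) < sqrt 1 \<longleftrightarrow> (norm x)\<^sup>2 * (- K) < 1"
    by (rule real_sqrt_less_iff)
  also have "\<dots> \<longleftrightarrow> 0 < 1 + K * (norm x)\<^sup>2" unfolding mult_minus_right mult.commute[of K] by linarith
  finally show ?thesis .
qed simp

lemma in_space_form_mono:
  assumes "K \<le> 0" "norm x \<le> norm y" "y \<in> space_form K"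
  shows "x \<in> space_form K"
proof -
  have "(norm x)\<^sup>2 \<le> (norm y)\<^sup>2" using assms(2) by simp
  then have "K * (norm y)\<^sup>2 \<le> K * (norm x)\<^sup>2" using assms(1) by (rule mult_left_mono_neg)
  then show ?thesis using assms by (simp add: in_space_form_iff)
qed

lemma sf_dist_commute: "sf_dist K x y = sf_dist K y x"
  by (simp add: sf_dist_def dist_commute inner_commute mult.commute)

text \<open>The defect in the Cauchy-Schwarz inequality governs how far the hyperbolic distance is from
  the Euclidean one.\<close>

lemma Cauchy_Schwarz_defect:
  fixes x y :: "'a::real_inner"
  shows "(norm x)\<^sup>2 * (norm y)\<^sup>2 - (x \<bullet> y)\<^sup>2 = (norm x)\<^sup>2 * (norm (x - y))\<^sup>2 - (x \<bullet> (x - y))\<^sup>2"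
  unfolding power2_norm_eq_inner
  by (simp add: inner_diff_left inner_diff_right inner_commute power2_eq_square algebra_simps)

text \<open>In terms of \<open>sinh\<close> the distance formula has no cancellation near the diagonal: up to powers of \<open>K\<close>, the
  numerator is the squared Euclidean distance minus the Cauchy-Schwarz defect, both of second order.\<close>

lemma sf_dist_sinh:
  fixes x y :: "'a::euclidean_space"
  assumes K: "K < 0" and x: "x \<in> space_form K" and y: "y \<in> space_form K"
  defines "D \<equiv> (1 + K * (norm x)\<^sup>2) * (1 + K * (norm y)\<^sup>2)"
    and "\<delta> \<equiv> sqrt (- K) * sf_dist K x y"
  shows "0 \<le> \<delta>" and "0 < D"
    and "cosh \<delta> = (1 + K * (x \<bullet> y)) / sqrt D"
    and "(sinh \<delta>)\<^sup>2 = (- K * (norm (x - y))\<^sup>2 - K\<^sup>2 * ((norm x)\<^sup>2 * (norm y)\<^sup>2 - (x \<bullet> y)\<^sup>2)) / D"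
    and "- K * (norm (x - y))\<^sup>2 \<le> (sinh \<delta>)\<^sup>2"
    and "(sinh \<delta>)\<^sup>2 \<le> - K * (norm (x - y))\<^sup>2 / D"
proof -
  let ?N = "- K * (norm (x - y))\<^sup>2 - K\<^sup>2 * ((norm x)\<^sup>2 * (norm y)\<^sup>2 - (x \<bullet> y)\<^sup>2)"
  have a: "0 < 1 + K * (norm x)\<^sup>2" and b: "0 < 1 + K * (norm y)\<^sup>2"
    using x y K by (simp_all add: in_space_form_iff)
  show D: "0 < D" unfolding D_def by (rule mult_pos_pos[OF a b])
  have N: "(1 + K * (x \<bullet> y))\<^sup>2 = D + ?N"
  proof -
    have "(norm (x - y))\<^sup>2 = (norm x)\<^sup>2 - 2 * (x \<bullet> y) + (norm y)\<^sup>2"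
      unfolding power2_norm_eq_inner by (simp add: inner_diff_left inner_diff_right inner_commute)
    then show ?thesis unfolding D_def by algebra
  qed
  have G: "(norm x)\<^sup>2 * (norm y)\<^sup>2 - (x \<bullet> y)\<^sup>2 \<le> (norm x)\<^sup>2 * (norm (x - y))\<^sup>2"
    using Cauchy_Schwarz_defect[of x y] zero_le_power2[of "x \<bullet> (x - y)"] by linarith
  have G0: "0 \<le> (norm x)\<^sup>2 * (norm y)\<^sup>2 - (x \<bullet> y)\<^sup>2"
    using Cauchy_Schwarz_ineq[of x y] by (simp add: power2_norm_eq_inner)
  have low: "- K * (norm (x - y))\<^sup>2 * (1 + K * (norm x)\<^sup>2) \<le> ?N"
  proof -
    have "K\<^sup>2 * ((norm x)\<^sup>2 * (norm y)\<^sup>2 - (x \<bullet> y)\<^sup>2) \<le> K\<^sup>2 * ((norm x)\<^sup>2 * (norm (x - y))\<^sup>2)"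
      using G by (rule mult_left_mono) simp
    moreover have "- K * (norm (x - y))\<^sup>2 * (1 + K * (norm x)\<^sup>2) =
        - K * (norm (x - y))\<^sup>2 - K\<^sup>2 * ((norm x)\<^sup>2 * (norm (x - y))\<^sup>2)" by algebra
    ultimately show ?thesis by linarith
  qed
  have "0 \<le> - K * (norm (x - y))\<^sup>2 * (1 + K * (norm x)\<^sup>2)" using K a by (intro mult_nonneg_nonneg) auto
  then have N0: "0 \<le> ?N" using low by linarith
  have pos: "0 < 1 + K * (x \<bullet> y)"
  proof -
    have "2 * (x \<bullet> y) \<le> (norm x)\<^sup>2 + (norm y)\<^sup>2"
      unfolding power2_norm_eq_inner using inner_ge_zero[of "x - y"]
      by (simp add: inner_diff_left inner_diff_right inner_commute)
    then have "K * ((norm x)\<^sup>2 + (norm y)\<^sup>2) \<le> K * (2 * (x \<bullet> y))"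
      using K by (intro mult_left_mono_neg) auto
    then show ?thesis using a b by (simp add: algebra_simps)
  qed
  have arg: "(1 + K * (x \<bullet> y)) / sqrt D \<ge> 1"
  proof -
    have "sqrt D \<le> sqrt ((1 + K * (x \<bullet> y))\<^sup>2)" unfolding N using N0 by (intro real_sqrt_le_mono) simp
    then show ?thesis using D pos by (simp add: le_divide_eq)
  qed
  have \<delta>: "\<delta> = arcosh ((1 + K * (x \<bullet> y)) / sqrt D)"
    unfolding \<delta>_def sf_dist_def D_def using K by (simp add: real_sqrt_mult)
  show "0 \<le> \<delta>" unfolding \<delta> using arg by simp
  show ch: "cosh \<delta> = (1 + K * (x \<bullet> y)) / sqrt D" unfolding \<delta> using arg by simp
  have "(sinh \<delta>)\<^sup>2 = (cosh \<delta>)\<^sup>2 - 1" by (simp add: cosh_square_eq)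
  also have "\<dots> = (D + ?N) / D - 1" unfolding ch using D by (simp add: power_divide N)
  also have "\<dots> = ?N / D" using D by (simp add: field_simps)
  finally show sh: "(sinh \<delta>)\<^sup>2 = ?N / D" .
  have "- K * (norm (x - y))\<^sup>2 * D \<le> - K * (norm (x - y))\<^sup>2 * (1 + K * (norm x)\<^sup>2)"
  proof (rule mult_left_mono)
    show "D \<le> 1 + K * (norm x)\<^sup>2"
      unfolding D_def using a K by (intro mult_left_le) (auto intro: mult_nonpos_nonneg)
    show "0 \<le> - K * (norm (x - y))\<^sup>2" using K by (intro mult_nonneg_nonneg) auto
  qed
  then show "- K * (norm (x - y))\<^sup>2 \<le> (sinh \<delta>)\<^sup>2"
    unfolding sh using D low by (simp add: le_divide_eq)
  have "?N \<le> - K * (norm (x - y))\<^sup>2" using G0 by simp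
  then show "(sinh \<delta>)\<^sup>2 \<le> - K * (norm (x - y))\<^sup>2 / D"
    unfolding sh using D by (intro divide_right_mono) auto
qed

lemma sf_dist_nonneg: "K \<le> 0 \<Longrightarrow> x \<in> space_form K \<Longrightarrow> y \<in> space_form K \<Longrightarrow> 0 \<le> sf_dist K x y"
  using sf_dist_sinh(1)[of K x y]
  by (cases "K = 0") (auto simp: sf_dist_def[of 0] zero_le_mult_iff)

lemma real_le_sinh:
  assumes "0 \<le> (x::real)" shows "x \<le> sinh x"
proof -
  have "sinh 0 - 0 \<le> sinh x - x"
  proof (rule DERIV_nonneg_imp_nondecreasing[OF assms])
    fix t :: real assume "0 \<le> t"
    show "\<exists>d. ((\<lambda>x. sinh x - x) has_real_derivative d) (at t) \<and> 0 \<le> d"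
      by (intro exI[of _ "cosh t - 1"] conjI derivative_eq_intros refl) (auto simp: cosh_real_ge_1)
  qed
  then show ?thesis by simp
qed

lemma sinh_le_mult_cosh:
  assumes "0 \<le> (x::real)" shows "sinh x \<le> x * cosh x"
proof -
  have "0 * cosh 0 - sinh 0 \<le> x * cosh x - sinh x"
  proof (rule DERIV_nonneg_imp_nondecreasing[OF assms])
    fix t :: real assume "0 \<le> t"
    then show "\<exists>d. ((\<lambda>x. x * cosh x - sinh x) has_real_derivative d) (at t) \<and> 0 \<le> d"
      by (intro exI[of _ "t * sinh t"] conjI derivative_eq_intros refl | simp)+
  qed
  then show ?thesis by simp
qed

lemma tanh_le_self: "0 \<le> (x::real) \<Longrightarrow> tanh x \<le> x"
  using sinh_le_mult_cosh[of x] cosh_real_pos[of x] by (simp add: tanh_def divide_le_eq)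

text \<open>On a fixed ball the metric of curvature \<open>K\<close> is bi-Lipschitz to the Euclidean one, with
  constants tending to 1 as \<open>K\<close> tends to 0.\<close>

definition lip_lo :: "real \<Rightarrow> real \<Rightarrow> real" where
  "lip_lo K r = 1 / sqrt (1 - 4 * K * r\<^sup>2)"

definition lip_hi :: "real \<Rightarrow> real \<Rightarrow> real" where
  "lip_hi K r = 1 / (1 + K * r\<^sup>2)"

lemma sf_dist_bilipschitz:
  fixes x y :: "'a::euclidean_space"
  assumes K: "K < 0" and r: "0 < 1 + K * r\<^sup>2" "norm x \<le> r" "norm y \<le> r"
  shows "lip_lo K r * dist x y \<le> sf_dist K x y" and "sf_dist K x y \<le> lip_hi K r * dist x y"
proof -
  have nx: "(norm x)\<^sup>2 \<le> r\<^sup>2" and ny: "(norm y)\<^sup>2 \<le> r\<^sup>2" using r by (auto intro: power_mono)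
  have ax: "1 + K * r\<^sup>2 \<le> 1 + K * (norm x)\<^sup>2" and ay: "1 + K * r\<^sup>2 \<le> 1 + K * (norm y)\<^sup>2"
    using nx ny K by auto
  have x: "x \<in> space_form K" and y: "y \<in> space_form K"
    using less_le_trans[OF r(1) ax] less_le_trans[OF r(1) ay] K
    by (simp_all only: in_space_form_iff[OF less_imp_le[OF K]])
  define \<delta> where "\<delta> = sqrt (- K) * sf_dist K x y"
  define D where "D = (1 + K * (norm x)\<^sup>2) * (1 + K * (norm y)\<^sup>2)"
  define e where "e = sqrt (- K) * dist x y"
  note S = sf_dist_sinh[OF K x y, folded D_def \<delta>_def]
  have e2: "e\<^sup>2 = - K * (norm (x - y))\<^sup>2" using K by (simp add: e_def power_mult_distrib dist_norm)
  have e0: "0 \<le> e" using K by (simp add: e_def)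
  have sK: "0 < sqrt (- K)" using K by simp
  have "\<delta> \<le> e * lip_hi K r"
  proof -
    have "(1 + K * r\<^sup>2) * (1 + K * r\<^sup>2) \<le> D"
      unfolding D_def using r(1) ax ay by (intro mult_mono) linarith+
    then have "(1 + K * r\<^sup>2)\<^sup>2 \<le> D" by (simp only: power2_eq_square)
    then have "e\<^sup>2 / D \<le> e\<^sup>2 / (1 + K * r\<^sup>2)\<^sup>2"
      using r S(2) by (intro divide_left_mono) auto
    moreover have "(sinh \<delta>)\<^sup>2 \<le> e\<^sup>2 / D" unfolding e2 by (rule S(6))
    moreover have "(e * lip_hi K r)\<^sup>2 = e\<^sup>2 / (1 + K * r\<^sup>2)\<^sup>2"
      by (simp add: lip_hi_def power_divide)
    ultimately have "(sinh \<delta>)\<^sup>2 \<le> (e * lip_hi K r)\<^sup>2" by linarith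
    then have "sinh \<delta> \<le> e * lip_hi K r"
      by (rule power2_le_imp_le) (use e0 r(1) in \<open>simp add: lip_hi_def\<close>)
    then show ?thesis using real_le_sinh[OF S(1)] by linarith
  qed
  then have "sqrt (- K) * sf_dist K x y \<le> sqrt (- K) * (lip_hi K r * dist x y)"
    by (simp add: \<delta>_def e_def mult_ac)
  then show "sf_dist K x y \<le> lip_hi K r * dist x y" using sK by simp
  have "lip_lo K r * e \<le> \<delta>"
  proof (rule power2_le_imp_le[OF _ S(1)])
    have "dist x y \<le> 2 * r" using r(2,3) norm_triangle_ineq4[of x y] by (simp add: dist_norm)
    then have "(norm (x - y))\<^sup>2 \<le> (2 * r)\<^sup>2" by (intro power_mono) (auto simp: dist_norm)
    then have "(norm (x - y))\<^sup>2 \<le> 4 * r\<^sup>2" by (simp add: power_mult_distrib)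
    then have "- K * (norm (x - y))\<^sup>2 \<le> - K * (4 * r\<^sup>2)" using K by (intro mult_left_mono) auto
    then have e4: "e\<^sup>2 \<le> - 4 * K * r\<^sup>2" unfolding e2 by (simp only: mult.assoc mult.left_commute mult_minus_left)
    have pos: "0 < 1 - 4 * K * r\<^sup>2" using e4 zero_le_power2[of e] by linarith
    have "(lip_lo K r * e)\<^sup>2 = e\<^sup>2 / (1 - 4 * K * r\<^sup>2)"
      using pos by (simp add: lip_lo_def power_divide)
    also have "\<dots> \<le> e\<^sup>2 / (1 + e\<^sup>2)"
    proof (rule divide_left_mono)
      show "1 + e\<^sup>2 \<le> 1 - 4 * K * r\<^sup>2" using e4 by linarith
      show "0 < (1 - 4 * K * r\<^sup>2) * (1 + e\<^sup>2)" using pos by (intro mult_pos_pos add_pos_nonneg) auto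
    qed simp
    also have "\<dots> = 1 - 1 / (1 + e\<^sup>2)"
    proof -
      have "1 + e\<^sup>2 \<noteq> 0" using zero_le_power2[of e] by linarith
      then show ?thesis by (simp add: field_simps)
    qed
    also have "\<dots> \<le> 1 - 1 / (1 + (sinh \<delta>)\<^sup>2)"
    proof -
      have "1 / (1 + (sinh \<delta>)\<^sup>2) \<le> 1 / (1 + e\<^sup>2)"
      proof (rule divide_left_mono)
        show "1 + e\<^sup>2 \<le> 1 + (sinh \<delta>)\<^sup>2" using S(5) unfolding e2 by linarith
        show "0 < (1 + (sinh \<delta>)\<^sup>2) * (1 + e\<^sup>2)" by (intro mult_pos_pos add_pos_nonneg) auto
      qed simp
      then show ?thesis by simp
    qed
    also have "\<dots> = (sinh \<delta>)\<^sup>2 / (cosh \<delta>)\<^sup>2"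
    proof -
      have "1 + (sinh \<delta>)\<^sup>2 \<noteq> 0" using zero_le_power2[of "sinh \<delta>"] by linarith
      then have "1 - 1 / (1 + (sinh \<delta>)\<^sup>2) = (sinh \<delta>)\<^sup>2 / (1 + (sinh \<delta>)\<^sup>2)"
        by (simp add: diff_divide_eq_iff)
      then show ?thesis by (simp add: cosh_square_eq add.commute)
    qed
    also have "\<dots> \<le> \<delta>\<^sup>2"
    proof -
      have "(sinh \<delta>)\<^sup>2 \<le> (\<delta> * cosh \<delta>)\<^sup>2" using sinh_le_mult_cosh[OF S(1)] S(1) by (intro power_mono) auto
      then show ?thesis using cosh_real_pos[of \<delta>] by (simp add: divide_le_eq power_mult_distrib)
    qed
    finally show "(lip_lo K r * e)\<^sup>2 \<le> \<delta>\<^sup>2" .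
  qed
  then have "sqrt (- K) * (lip_lo K r * dist x y) \<le> sqrt (- K) * sf_dist K x y"
    by (simp add: \<delta>_def e_def mult_ac)
  then show "lip_lo K r * dist x y \<le> sf_dist K x y" using sK by simp
qed

text \<open>The Euclidean radius, in the model, of the ball of radius \<open>u\<close> around the base point.\<close>

definition rad :: "real \<Rightarrow> real \<Rightarrow> real" where
  "rad K u = (if K = 0 then u else tanh (sqrt (- K) * u) / sqrt (- K))"

lemma rad_bounds:
  assumes "K \<le> 0" "u > 0"
  shows "0 < rad K u" "rad K u \<le> u" "norm x \<le> rad K u \<Longrightarrow> x \<in> space_form K"
proof -
  show "0 < rad K u" using assms by (auto simp: rad_def)
  show "rad K u \<le> u"
    using assms tanh_le_self[of "sqrt (- K) * u"] by (auto simp: rad_def divide_le_eq mult.commute)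
  show "x \<in> space_form K" if "norm x \<le> rad K u"
  proof (cases "K = 0")
    case False
    then have "rad K u < 1 / sqrt (- K)"
      using assms by (simp add: rad_def divide_strict_right_mono tanh_real_lt_1)
    then show ?thesis using that False by (simp add: space_form_def)
  qed simp
qed

lemma sf_dist_le_iff:
  fixes x :: "'a::euclidean_space"
  assumes K: "K \<le> 0" and u: "0 \<le> u" and x: "x \<in> space_form K"
  shows "sf_dist K x 0 \<le> u \<longleftrightarrow> norm x \<le> rad K u"
proof (cases "K = 0")
  case False
  then have K: "K < 0" using K by simp
  define s where "s = sqrt (- K)"
  have s: "0 < s" and s2: "s\<^sup>2 = - K" using K by (simp_all add: s_def)
  have z: "0 \<in> space_form K" using K by simp
  have a: "0 < 1 + K * (norm x)\<^sup>2" using x K by (simp add: in_space_form_iff)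
  have ch: "cosh (s * sf_dist K x 0) = 1 / sqrt (1 + K * (norm x)\<^sup>2)"
    using sf_dist_sinh(3)[OF K x z] by (simp add: s_def)
  have nn: "0 \<le> s * sf_dist K x 0" using sf_dist_sinh(1)[OF K x z] by (simp add: s_def)
  have "sf_dist K x 0 \<le> u \<longleftrightarrow> s * sf_dist K x 0 \<le> s * u" using s by simp
  also have "\<dots> \<longleftrightarrow> 1 / sqrt (1 + K * (norm x)\<^sup>2) \<le> cosh (s * u)"
    unfolding ch[symmetric] using nn s u by (subst cosh_real_nonneg_le_iff) auto
  also have "\<dots> \<longleftrightarrow> 1 / cosh (s * u) \<le> sqrt (1 + K * (norm x)\<^sup>2)"
    using a cosh_real_pos[of "s * u"] by (simp add: field_simps)
  also have "\<dots> \<longleftrightarrow> (1 / cosh (s * u))\<^sup>2 \<le> 1 + K * (norm x)\<^sup>2"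
    using real_le_rsqrt[of "1 / cosh (s * u)"] a sqrt_le_D
    by (smt (verit) cosh_real_pos divide_pos_pos real_le_rsqrt real_sqrt_abs real_sqrt_le_iff)
  also have "\<dots> \<longleftrightarrow> (s * norm x)\<^sup>2 \<le> (tanh (s * u))\<^sup>2"
  proof -
    have "(tanh (s * u))\<^sup>2 = 1 - (1 / cosh (s * u))\<^sup>2"
    proof -
      have "(cosh (s * u))\<^sup>2 > 0" by simp
      moreover have "(sinh (s * u))\<^sup>2 = (cosh (s * u))\<^sup>2 - 1" by (simp add: cosh_square_eq)
      ultimately show ?thesis by (simp only: tanh_def power_divide diff_divide_distrib) simp
    qed
    moreover have "(s * norm x)\<^sup>2 = - (K * (norm x)\<^sup>2)" by (simp add: power_mult_distrib s2)
    ultimately show ?thesis by linarith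
  qed
  also have "\<dots> \<longleftrightarrow> s * norm x \<le> tanh (s * u)"
    using s u by (intro power_mono_iff) auto
  also have "\<dots> \<longleftrightarrow> norm x \<le> rad K u"
    using s K by (simp add: rad_def s_def[symmetric] le_divide_eq mult.commute)
  finally show ?thesis .
qed (simp add: sf_dist_def rad_def)

lemma sf_ball_eq:
  assumes "K \<le> 0" "u > 0"
  shows "sf_ball K u = cball (0 :: 'a::euclidean_space) (rad K u)"
proof (intro set_eqI)
  fix x :: 'a
  have "x \<in> space_form K" if "norm x \<le> rad K u" using rad_bounds(3)[OF assms that] .
  then show "x \<in> sf_ball K u \<longleftrightarrow> x \<in> cball 0 (rad K u)"
    using sf_dist_le_iff[of K u x] assms by (auto simp: sf_ball_def)
qed

text \<open>The distance from the base point is an increasing function of the norm, so that nearest points of a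
  set are the same for all curvatures.\<close>

lemma sf_dist_mono:
  fixes x y :: "'a::euclidean_space"
  assumes K: "K \<le> 0" and y: "y \<in> space_form K" and n: "norm x \<le> norm y"
  shows "sf_dist K 0 x \<le> sf_dist K 0 y"
proof -
  have x: "x \<in> space_form K" by (rule in_space_form_mono[OF K n y])
  have nn: "0 \<le> sf_dist K y 0" by (rule sf_dist_nonneg[OF K y]) (simp add: K)
  have "norm y \<le> rad K (sf_dist K y 0)" using sf_dist_le_iff[OF K nn y] by simp
  then have "sf_dist K x 0 \<le> sf_dist K y 0" using sf_dist_le_iff[OF K nn x] n by simp
  then show ?thesis by (simp add: sf_dist_commute)
qed

subsection \<open>Limits as the curvature tends to 0\<close>

lemma lip_lo_tendsto: "((\<lambda>K. lip_lo K r) \<longlongrightarrow> 1) (at_left 0)"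
  unfolding lip_lo_def by (auto intro!: tendsto_eq_intros)

lemma lip_hi_tendsto: "((\<lambda>K. lip_hi K r) \<longlongrightarrow> 1) (at_left 0)"
  unfolding lip_hi_def by (auto intro!: tendsto_eq_intros)

lemma lip_hi_pos_eventually: "\<forall>\<^sub>F K in at_left 0. 0 < 1 + K * (r::real)\<^sup>2"
proof -
  have "((\<lambda>K::real. 1 + K * r\<^sup>2) \<longlongrightarrow> 1) (at_left 0)" by (auto intro!: tendsto_eq_intros)
  then show ?thesis by (rule order_tendstoD) simp
qed

lemma sqrt_neg_tendsto: "((\<lambda>K::real. sqrt (- K)) \<longlongrightarrow> 0) (at_left 0)"
  by (auto intro!: tendsto_eq_intros)

lemma rad_tendsto: "((\<lambda>K. rad K u) \<longlongrightarrow> u) (at_left 0)"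
proof -
  have "((\<lambda>t. tanh (t * u)) has_real_derivative u) (at 0)"
    by (auto intro!: derivative_eq_intros)
  then have lim: "(\<lambda>t. tanh (t * u) / t) \<midarrow>0\<rightarrow> u" unfolding DERIV_def by simp
  have "filterlim (\<lambda>K::real. sqrt (- K)) (at 0) (at_left 0)"
    unfolding filterlim_at using sqrt_neg_tendsto
    by (auto intro!: eventually_at_leftI[of "-1"])
  from filterlim_compose[OF lim this]
  have "((\<lambda>K. tanh (sqrt (- K) * u) / sqrt (- K)) \<longlongrightarrow> u) (at_left 0)" .
  moreover have "\<forall>\<^sub>F K in at_left 0. tanh (sqrt (- K) * u) / sqrt (- K) = rad K u"
    by (rule eventually_at_leftI[of "-1"]) (auto simp: rad_def)
  ultimately show ?thesis by (rule Lim_transform_eventually)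
qed

section \<open>Flats of the model\<close>

definition model_part :: "real \<Rightarrow> 'a::euclidean_space set \<Rightarrow> 'a set" where
  "model_part K V = V \<inter> space_form K"

text \<open>Flats are parametrised by the orthogonal complement \<open>V\<close> of their direction rather than by the
  direction itself, because \<open>V\<close> is the subspace over which the point \<open>z\<close> is integrated.\<close>

definition flat_at :: "real \<Rightarrow> 'a::euclidean_space set \<Rightarrow> 'a \<Rightarrow> 'a set" where
  "flat_at K V z = {y \<in> space_form K. y - z \<in> V\<^sup>\<bottom>}"

lemma span_model_part:
  assumes V: "subspace V" and K: "K \<le> 0"
  shows "span (model_part K V) = (V :: 'a::euclidean_space set)"
proof
  show "span (model_part K V) \<subseteq> V" using V by (simp add: span_minimal model_part_def)
  obtain e where e: "e > 0" "ball (0::'a) e \<subseteq> space_form K"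
    using open_contains_ball[THEN iffD1, OF open_space_form, of K] zero_in_space_form[OF K] by blast
  show "V \<subseteq> span (model_part K V)"
  proof
    fix v assume v: "v \<in> V"
    define c where "c = e / (2 * (norm v + 1))"
    have c: "c > 0" unfolding c_def using e by (intro divide_pos_pos mult_pos_pos add_nonneg_pos) auto
    have "c * norm v \<le> c * (norm v + 1)" using c by simp
    also have "\<dots> = e / 2" unfolding c_def using norm_ge_zero[of v] by (simp add: field_simps add_nonneg_eq_0_iff)
    finally have "norm (c *\<^sub>R v) < e" using c e by simp
    then have "c *\<^sub>R v \<in> model_part K V" using e(2) v V by (auto simp: model_part_def subspace_scale)
    then have "(1 / c) *\<^sub>R (c *\<^sub>R v) \<in> span (model_part K V)" by (intro span_scale span_base)
    then show "v \<in> span (model_part K V)" using c by simp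
  qed
qed

lemma flats0_eq:
  assumes K: "K \<le> 0"
  shows "flats0 K k = model_part K ` (subspaces k :: 'a::euclidean_space set set)"
proof (intro set_eqI iffI)
  fix L :: "'a set" assume "L \<in> flats0 K k"
  then obtain A where A: "affine A" "aff_dim A = int k" "L = A \<inter> space_form K" "0 \<in> L"
    by (auto simp: flats0_def flats_def)
  then have "subspace A" by (simp add: subspace_affine)
  moreover have "dim A = k" using aff_dim_zero[of A] A by (auto simp: hull_inc)
  ultimately show "L \<in> model_part K ` subspaces k" using A by (auto simp: subspaces_def model_part_def)
next
  fix L :: "'a set" assume "L \<in> model_part K ` subspaces k"
  then obtain A where A: "subspace A" "dim A = k" "L = A \<inter> space_form K"
    by (auto simp: subspaces_def model_part_def)
  have "aff_dim A = int k" using A subspace_0[OF A(1)] aff_dim_zero[of A] by (auto simp: hull_inc)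
  then show "L \<in> flats0 K k"
    using A subspace_0[OF A(1)] K unfolding flats0_def flats_def
    by (auto intro!: exI[of _ A] simp: subspace_imp_affine)
qed

lemma flats_closeds: "(flats K k :: 'a::euclidean_space set set) \<subseteq> closeds (space_form K)"
proof
  fix F :: "'a set" assume "F \<in> flats K k"
  then obtain A where "affine A" "F = space_form K \<inter> A" by (auto simp: flats_def)
  then show "F \<in> closeds (space_form K)"
    using closed_affine_hull[of A] by (simp add: closeds_def closedin_closed_Int affine_hull_eq[THEN iffD2])
qed

lemma flats0_closeds: "flats0 K k \<subseteq> closeds (space_form K)"
  using flats_closeds by (auto simp: flats0_def)

lemma space_flats0_borel [simp]: "space (flats0_borel K k) = flats0 K k"
  using flats0_closeds by (auto simp: flats0_borel_def)

lemma space_flats_borel [simp]: "space (flats_borel K k) = flats K k"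
  using flats_closeds by (auto simp: flats_borel_def)

lemma measurable_model_part:
  assumes K: "K \<le> 0"
  shows "model_part K \<in> measurable (Gr k :: 'a::euclidean_space set measure) (flats0_borel K k)"
  unfolding flats0_borel_def
proof (rule measurable_borel_of_fell[OF open_space_form flats0_closeds])
  show "model_part K V \<in> flats0 K k" if "V \<in> space (Gr k)" for V :: "'a set"
    using that by (simp add: flats0_eq[OF K])
  fix c :: 'a and r assume c: "cball c r \<subseteq> space_form K"
  have "{V \<in> space (Gr k). model_part K V \<inter> ball c r \<noteq> {}} = {V \<in> space (Gr k). infdist c V < r}"
  proof (intro Collect_cong conj_cong refl)
    fix V :: "'a set" assume "V \<in> space (Gr k)"
    then have V: "subspace V" by (simp add: subspaces_def)
    have "model_part K V \<inter> ball c r = V \<inter> ball c r"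
      using c ball_subset_cball[of c r] by (auto simp: model_part_def)
    then show "model_part K V \<inter> ball c r \<noteq> {} \<longleftrightarrow> infdist c V < r"
      using infdist_subspace_less_iff[OF V] by simp
  qed
  also have "\<dots> \<in> sets (Gr k)" using measurable_infdist_Gr[of c k] by (intro borel_measurable_less) auto
  finally show "{V \<in> space (Gr k). model_part K V \<inter> ball c r \<noteq> {}} \<in> sets (Gr k)" .
qed

lemma span_flats0: "K \<le> 0 \<Longrightarrow> L \<in> flats0 K k \<Longrightarrow> span L \<in> subspaces k \<and> model_part K (span L) = L"
  by (auto simp: flats0_eq subspaces_def span_model_part simp del: dim_span)

text \<open>The span recovers the subspace from its trace, so the trace map is an isomorphism of measurable
  spaces. A distance to the subspace can be read off inside the model after scaling into a small ball.\<close>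

lemma measurable_span_flats0:
  assumes K: "K \<le> 0"
  shows "span \<in> measurable (flats0_borel K k) (Gr k :: 'a::euclidean_space set measure)"
proof (rule measurable_GrI)
  show "span L \<in> subspaces k" if "L \<in> space (flats0_borel K k)" for L :: "'a set"
    using span_flats0[OF K] that by auto
  fix y :: 'a
  obtain e where e: "e > 0" "ball (0::'a) e \<subseteq> space_form K"
    using open_contains_ball[THEN iffD1, OF open_space_form, of K] zero_in_space_form[OF K] by blast
  show "(\<lambda>L. infdist y (span L)) \<in> borel_measurable (flats0_borel K k)"
  proof (subst borel_measurable_iff_less, intro allI)
    fix a :: real
    \<comment> \<open>Small enough that the ball of radius \<open>c * a\<close> around \<open>c *\<^sub>R y\<close> lies in the model.\<close>
    define c where "c = e / (norm y + \<bar>a\<bar> + 1)"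
    have n1: "0 < norm y + \<bar>a\<bar> + 1" by (intro add_nonneg_pos add_nonneg_nonneg) auto
    then have c: "c > 0" unfolding c_def using e by (intro divide_pos_pos)
    have ce: "c * (norm y + \<bar>a\<bar>) < e"
    proof -
      have "c * (norm y + \<bar>a\<bar>) < c * (norm y + \<bar>a\<bar> + 1)" using c by simp
      also have "\<dots> = e" unfolding c_def using n1 by simp
      finally show ?thesis .
    qed
    have sub: "ball (c *\<^sub>R y) (c * a) \<subseteq> space_form K"
    proof
      fix x assume "x \<in> ball (c *\<^sub>R y) (c * a)"
      then have "norm (x - c *\<^sub>R y) < c * a" by (simp add: dist_norm norm_minus_commute)
      also have "c * a \<le> c * \<bar>a\<bar>" using c by (intro mult_left_mono) auto
      finally have "norm x < c * \<bar>a\<bar> + norm (c *\<^sub>R y)" using norm_triangle_sub[of x "c *\<^sub>R y"] by linarith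
      also have "\<dots> = c * (norm y + \<bar>a\<bar>)" using c by (simp add: distrib_left)
      finally show "x \<in> space_form K" using ce e(2) by auto
    qed
    have "{L \<in> space (flats0_borel K k). infdist y (span L) < a} =
        {L \<in> flats0 K k. L \<inter> ball (c *\<^sub>R y) (c * a) \<noteq> {}}"
      unfolding space_flats0_borel
    proof (intro Collect_cong conj_cong refl)
      fix L :: "'a set" assume L: "L \<in> flats0 K k"
      have V: "subspace (span L)" by simp
      have "infdist y (span L) < a \<longleftrightarrow> infdist (c *\<^sub>R y) (span L) < c * a"
        using c by (simp add: infdist_scale[OF V])
      also have "\<dots> \<longleftrightarrow> span L \<inter> ball (c *\<^sub>R y) (c * a) \<noteq> {}"
        by (rule infdist_subspace_less_iff[OF V])
      also have "span L \<inter> ball (c *\<^sub>R y) (c * a) = model_part K (span L) \<inter> ball (c *\<^sub>R y) (c * a)"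
        using sub by (auto simp: model_part_def)
      also have "model_part K (span L) = L" using span_flats0[OF K L] by simp
      finally show "infdist y (span L) < a \<longleftrightarrow> L \<inter> ball (c *\<^sub>R y) (c * a) \<noteq> {}" .
    qed
    also have "\<dots> \<in> sets (flats0_borel K k)"
      unfolding flats0_borel_def by (intro sets_borel_of_hit flats0_closeds sub) auto
    finally show "{L \<in> space (flats0_borel K k). infdist y (span L) < a} \<in> sets (flats0_borel K k)" .
  qed
qed

subsection \<open>Isometries fixing the base point\<close>

lemma orthogonal_transformation_sf_isometry:
  fixes R :: "'a::euclidean_space \<Rightarrow> 'a"
  assumes R: "orthogonal_transformation R" and K: "K \<le> 0"
  shows "sf_isometry K R"
proof -
  have d: "sf_dist K (R x) (R y) = sf_dist K x y" for x y
    using orthogonal_transformation_isometry[THEN iffD1, OF R]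
    by (simp add: sf_dist_def orthogonal_transformation_inner[OF R] orthogonal_transformation_norm[OF R])
  have mem: "R x \<in> space_form K \<longleftrightarrow> x \<in> space_form K" for x
    by (simp add: in_space_form_iff[OF K] orthogonal_transformation_norm[OF R])
  have "R ` space_form K = space_form K"
  proof (intro set_eqI iffI)
    fix y :: 'a assume y: "y \<in> space_form K"
    obtain x where "y = R x" using orthogonal_transformation_surj[OF R] by (metis surjD)
    then show "y \<in> R ` space_form K" using y mem by blast
  qed (use mem in blast)
  then have "bij_betw R (space_form K) (space_form K)"
    using inj_on_subset[OF orthogonal_transformation_inj[OF R]] by (auto simp: bij_betw_def)
  then show ?thesis using d by (simp add: sf_isometry_def)
qed

text \<open>An isometry fixing the base point preserves distances to it, hence norms and then inner
  products; a map of a ball preserving inner products is the restriction of an orthogonal map.\<close>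

lemma sf_isometry_inner:
  fixes \<phi> :: "'a::euclidean_space \<Rightarrow> 'a"
  assumes \<phi>: "sf_isometry K \<phi>" "\<phi> 0 = 0" and K: "K \<le> 0"
    and x: "x \<in> space_form K" and y: "y \<in> space_form K"
  shows "\<phi> x \<bullet> \<phi> y = x \<bullet> y"
proof -
  have mem: "\<phi> x \<in> space_form K" if "x \<in> space_form K" for x
    using \<phi> that by (auto simp: sf_isometry_def bij_betw_def)
  have d: "sf_dist K (\<phi> x) (\<phi> y) = sf_dist K x y" if "x \<in> space_form K" "y \<in> space_form K" for x y
    using \<phi> that by (auto simp: sf_isometry_def)
  have z: "0 \<in> space_form K" using K by simp
  have n: "norm (\<phi> x) = norm x" if x: "x \<in> space_form K" for x
  proof -
    have eq: "sf_dist K (\<phi> x) 0 = sf_dist K x 0" using d[OF x z] \<phi>(2) by simp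
    have nn: "0 \<le> sf_dist K x 0" by (rule sf_dist_nonneg[OF K x z])
    have "norm (\<phi> x) \<le> norm x \<and> norm x \<le> norm (\<phi> x)"
    proof (cases "K = 0")
      case True
      then show ?thesis using eq by (simp add: sf_dist_def)
    next
      case False
      then have K': "K < 0" using K by simp
      have "(1 + K * (norm x)\<^sup>2) > 0" "(1 + K * (norm (\<phi> x))\<^sup>2) > 0"
        using x mem[OF x] K by (simp_all add: in_space_form_iff)
      moreover have "1 / sqrt (1 + K * (norm (\<phi> x))\<^sup>2) = 1 / sqrt (1 + K * (norm x)\<^sup>2)"
        using sf_dist_sinh(3)[OF K' x z] sf_dist_sinh(3)[OF K' mem[OF x] z] eq by auto
      ultimately have "K * (norm (\<phi> x))\<^sup>2 = K * (norm x)\<^sup>2" by auto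
      then show ?thesis using K' by simp
    qed
    then show ?thesis by simp
  qed
  show ?thesis
  proof (cases "K = 0")
    case True
    then have "dist (\<phi> x) (\<phi> y) = dist x y" using d[OF x y] by (simp add: sf_dist_def)
    then have "(norm (\<phi> x - \<phi> y))\<^sup>2 = (norm (x - y))\<^sup>2" by (simp add: dist_norm)
    then have "(norm (\<phi> x))\<^sup>2 - 2 * (\<phi> x \<bullet> \<phi> y) + (norm (\<phi> y))\<^sup>2 = (norm x)\<^sup>2 - 2 * (x \<bullet> y) + (norm y)\<^sup>2"
      unfolding power2_norm_eq_inner by (simp add: inner_diff_left inner_diff_right inner_commute)
    then show ?thesis using n[OF x] n[OF y] by simp
  next
    case False
    then have K': "K < 0" using K by simp
    have D: "(1 + K * (norm x)\<^sup>2) * (1 + K * (norm y)\<^sup>2) > 0" by (rule sf_dist_sinh(2)[OF K' x y])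
    have "(1 + K * (\<phi> x \<bullet> \<phi> y)) / sqrt ((1 + K * (norm x)\<^sup>2) * (1 + K * (norm y)\<^sup>2)) =
        (1 + K * (x \<bullet> y)) / sqrt ((1 + K * (norm x)\<^sup>2) * (1 + K * (norm y)\<^sup>2))"
      using sf_dist_sinh(3)[OF K' x y] sf_dist_sinh(3)[OF K' mem[OF x] mem[OF y]] d[OF x y] n[OF x] n[OF y] by auto
    then show ?thesis using D K' by auto
  qed
qed

text \<open>The orthogonal map is determined by the images of short multiples of the basis vectors.\<close>

lemma sf_isometry_orthogonal:
  fixes \<phi> :: "'a::euclidean_space \<Rightarrow> 'a"
  assumes \<phi>: "sf_isometry K \<phi>" "\<phi> 0 = 0" and K: "K \<le> 0"
  obtains R where "orthogonal_transformation R" "\<And>x. x \<in> space_form K \<Longrightarrow> \<phi> x = R x"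
proof -
  obtain e where e: "e > 0" "ball (0::'a) e \<subseteq> space_form K"
    using open_contains_ball[THEN iffD1, OF open_space_form, of K] zero_in_space_form[OF K] by blast
  define t where "t = e / 2"
  have t: "t > 0" using e by (simp add: t_def)
  have tb: "t *\<^sub>R b \<in> space_form K" if "b \<in> Basis" for b :: 'a
    using that e by (auto simp: t_def)
  define w where "w b = (1 / t) *\<^sub>R \<phi> (t *\<^sub>R b)" for b
  define R where "R = (\<lambda>x. \<Sum>b\<in>Basis. (x \<bullet> b) *\<^sub>R w b)"
  have on: "w b \<bullet> w c = b \<bullet> c" if "b \<in> Basis" "c \<in> Basis" for b c
    using sf_isometry_inner[OF \<phi> K tb[OF that(1)] tb[OF that(2)]] t by (simp add: w_def)
  have "linear R"
    unfolding R_def by (intro linearI) (simp_all add: inner_add_left scaleR_add_left sum.distrib scaleR_sum_right)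
  moreover have RR: "R x \<bullet> R y = x \<bullet> y" for x y
  proof -
    have "R x \<bullet> R y = (\<Sum>b\<in>Basis. \<Sum>c\<in>Basis. (x \<bullet> c) * (y \<bullet> b) * (c \<bullet> b))"
      unfolding R_def inner_sum_left inner_sum_right
      by (intro sum.cong refl) (simp add: on mult.left_commute)
    also have "\<dots> = (\<Sum>b\<in>Basis. (x \<bullet> b) * (y \<bullet> b))"
    proof (rule sum.cong[OF refl])
      fix b :: 'a assume b: "b \<in> Basis"
      have "(\<Sum>c\<in>Basis. (x \<bullet> c) * (y \<bullet> b) * (c \<bullet> b)) = (\<Sum>c\<in>Basis. if c = b then (x \<bullet> b) * (y \<bullet> b) else 0)"
        using b by (intro sum.cong refl) (auto simp: inner_Basis)
      then show "(\<Sum>c\<in>Basis. (x \<bullet> c) * (y \<bullet> b) * (c \<bullet> b)) = (x \<bullet> b) * (y \<bullet> b)" using b by simp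
    qed
    also have "\<dots> = x \<bullet> y" by (rule euclidean_inner[symmetric])
    finally show ?thesis .
  qed
  ultimately have R: "orthogonal_transformation R" by (simp add: orthogonal_transformation_def)
  have "\<phi> x = R x" if x: "x \<in> space_form K" for x
  proof -
    have "\<phi> x \<bullet> R x = (\<Sum>b\<in>Basis. (x \<bullet> b) * ((1 / t) * (\<phi> x \<bullet> \<phi> (t *\<^sub>R b))))"
      by (simp add: R_def w_def inner_sum_right)
    also have "\<dots> = (\<Sum>b\<in>Basis. (x \<bullet> b) * (x \<bullet> b))"
      using t sf_isometry_inner[OF \<phi> K x tb] by (intro sum.cong refl) simp
    also have "\<dots> = x \<bullet> x" by (rule euclidean_inner[symmetric])
    finally have "\<phi> x \<bullet> R x = x \<bullet> x" .
    then have "(\<phi> x - R x) \<bullet> (\<phi> x - R x) = 0"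
      using sf_isometry_inner[OF \<phi> K x x] RR[of x x]
      by (simp add: inner_diff_left inner_diff_right inner_commute)
    then show ?thesis by simp
  qed
  with R show ?thesis using that by blast
qed

subsection \<open>The invariant measure on flats through the base point\<close>

lemma orthogonal_transformation_inverse:
  fixes R :: "'a::euclidean_space \<Rightarrow> 'a"
  assumes R: "orthogonal_transformation R"
  shows "orthogonal_transformation (inv R)" "\<And>A. R ` inv R ` A = A" "\<And>A. inv R ` R ` A = A"
  using orthogonal_transformation_inv[OF R] orthogonal_transformation_surj[OF R] orthogonal_transformation_inj[OF R]
  by (auto simp: image_image surj_f_inv_f inv_f_f)

lemma span_orthogonal_image:
  "orthogonal_transformation (R :: 'a::euclidean_space \<Rightarrow> 'a) \<Longrightarrow> span (R ` A) = R ` span A"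
  by (simp add: linear_span_image orthogonal_transformation_linear)

lemma model_part_orthogonal_image:
  assumes "orthogonal_transformation (R :: 'a::euclidean_space \<Rightarrow> 'a)" "K \<le> 0"
  shows "model_part K (R ` V) = R ` model_part K V"
  using assms by (auto simp: model_part_def in_space_form_iff orthogonal_transformation_norm)

text \<open>Taking traces carries the invariant measure of the Grassmannian to a measure with the required
  invariance. Conversely the spans of the elements of any such measure have a rotation-invariant law,
  so that uniqueness on the Grassmannian makes the defining description unambiguous.\<close>

lemma flats0_measure_eq:
  assumes K: "K \<le> 0" and k: "k \<le> DIM('a::euclidean_space)"
  shows "flats0_measure K k = distr (haar k) (flats0_borel K k :: 'a set measure) (model_part K)"
proof -
  let ?B = "flats0_borel K k :: 'a set measure"
  let ?H = "haar k :: 'a set measure"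
  let ?\<nu> = "distr ?H ?B (model_part K)"
  interpret H: prob_space ?H by (rule prob_space_haar[OF k])
  have mp: "model_part K \<in> measurable ?H ?B"
    using measurable_model_part[OF K, of k] by (simp add: sets_haar[OF k] cong: measurable_cong_sets)
  have sp: "span \<in> measurable ?B (Gr k)" by (rule measurable_span_flats0[OF K])
  have act: "(\<lambda>L. \<phi> ` L) ` A = {F \<in> flats0 K k. inv R ` F \<in> A}"
    if A: "A \<in> sets ?B" and R: "orthogonal_transformation R" and \<phi>: "\<And>x. x \<in> space_form K \<Longrightarrow> \<phi> x = R x"
    for A and \<phi> R :: "'a \<Rightarrow> 'a"
  proof -
    have sub: "A \<subseteq> flats0 K k" using sets.sets_into_space[OF A] by simp
    have stable: "S ` F \<in> flats0 K k" if F: "F \<in> flats0 K k" and S: "orthogonal_transformation S"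
      for F and S :: "'a \<Rightarrow> 'a"
    proof -
      obtain V where "V \<in> subspaces k" "F = model_part K V" using F by (auto simp: flats0_eq[OF K])
      then show ?thesis
        using orthogonal_image_subspaces[OF S, of V k] model_part_orthogonal_image[OF S K, of V]
        by (auto simp: flats0_eq[OF K])
    qed
    have "\<phi> ` L = R ` L" if "L \<in> A" for L
    proof -
      have "L \<subseteq> space_form K" using that sub by (auto simp: flats0_def flats_def)
      then show ?thesis using \<phi> by (intro image_cong) auto
    qed
    then have "(\<lambda>L. \<phi> ` L) ` A = (\<lambda>L. R ` L) ` A" by (rule image_cong[OF refl])
    also have "\<dots> = {F \<in> flats0 K k. inv R ` F \<in> A}"
    proof (intro set_eqI iffI)
      fix F assume "F \<in> (\<lambda>L. R ` L) ` A"
      then obtain L where "L \<in> A" "F = R ` L" by blast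
      then show "F \<in> {F \<in> flats0 K k. inv R ` F \<in> A}"
        using stable[OF _ R, of L] sub orthogonal_transformation_inverse(3)[OF R, of L] by auto
    next
      fix F assume "F \<in> {F \<in> flats0 K k. inv R ` F \<in> A}"
      then show "F \<in> (\<lambda>L. R ` L) ` A"
        using orthogonal_transformation_inverse(2)[OF R, of F] by (intro image_eqI[of _ _ "inv R ` F"]) auto
    qed
    finally show ?thesis .
  qed
  let ?\<Phi> = "\<lambda>\<nu>. prob_space \<nu> \<and> space \<nu> = space ?B \<and> sets \<nu> = sets ?B \<and>
     (\<forall>\<phi>. sf_isometry K \<phi> \<and> \<phi> 0 = 0 \<longrightarrow>
        (\<forall>A\<in>sets \<nu>. emeasure \<nu> ((\<lambda>L. \<phi> ` L) ` A) = emeasure \<nu> A))"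
  have "emeasure ?\<nu> ((\<lambda>L. \<phi> ` L) ` A) = emeasure ?\<nu> A"
    if \<phi>: "sf_isometry K \<phi>" "\<phi> 0 = 0" and A': "A \<in> sets ?\<nu>" for \<phi> :: "'a \<Rightarrow> 'a" and A
  proof -
    have A: "A \<in> sets ?B" using A' by simp
    obtain R where R: "orthogonal_transformation R" "\<And>x. x \<in> space_form K \<Longrightarrow> \<phi> x = R x"
      using sf_isometry_orthogonal[OF \<phi> K] by metis
    let ?Q = "inv R"
    have Q: "orthogonal_transformation ?Q" by (rule orthogonal_transformation_inverse(1)[OF R(1)])
    have Qm: "(`) ?Q \<in> measurable ?H (Gr k)"
      using measurable_orthogonal_image[OF Q, of k] by (simp add: sets_haar[OF k] cong: measurable_cong_sets)
    define S where "S = model_part K -` A \<inter> subspaces k"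
    have S: "S \<in> sets (Gr k)"
      using measurable_sets[OF measurable_model_part[OF K, of k] A] by (simp add: S_def)
    have im: "(\<lambda>L. \<phi> ` L) ` A = {F \<in> flats0 K k. ?Q ` F \<in> A}" by (rule act[OF A R])
    have pre: "model_part K -` ((\<lambda>L. \<phi> ` L) ` A) \<inter> space ?H = (`) ?Q -` S \<inter> space ?H"
    proof (intro set_eqI iffI)
      fix V assume "V \<in> model_part K -` ((\<lambda>L. \<phi> ` L) ` A) \<inter> space ?H"
      then show "V \<in> (`) ?Q -` S \<inter> space ?H"
        unfolding im S_def using model_part_orthogonal_image[OF Q K, of V] orthogonal_image_subspaces[OF Q, of V k]
        by (auto simp: space_haar[OF k])
    next
      fix V assume "V \<in> (`) ?Q -` S \<inter> space ?H"
      then show "V \<in> model_part K -` ((\<lambda>L. \<phi> ` L) ` A) \<inter> space ?H"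
        unfolding im S_def using model_part_orthogonal_image[OF Q K, of V]
        by (auto simp: space_haar[OF k] flats0_eq[OF K])
    qed
    have ims: "(\<lambda>L. \<phi> ` L) ` A \<in> sets ?B"
    proof -
      have "(\<lambda>F. model_part K (?Q ` span F)) \<in> measurable ?B ?B"
        by (rule measurable_compose[OF measurable_compose[OF sp measurable_orthogonal_image[OF Q]]
              measurable_model_part[OF K]])
      from measurable_sets[OF this A]
      have "{F \<in> flats0 K k. model_part K (?Q ` span F) \<in> A} \<in> sets ?B"
        by (simp add: vimage_def Int_def conj_commute)
      moreover have "model_part K (?Q ` span F) = ?Q ` F" if "F \<in> flats0 K k" for F
        using span_flats0[OF K that] by (simp add: model_part_orthogonal_image[OF Q K])
      ultimately show ?thesis unfolding im by (simp cong: conj_cong)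
    qed
    have "emeasure ?\<nu> ((\<lambda>L. \<phi> ` L) ` A) = emeasure ?H ((`) ?Q -` S \<inter> space ?H)"
      unfolding pre[symmetric] by (rule emeasure_distr[OF mp ims])
    also have "\<dots> = emeasure (distr ?H (Gr k) ((`) ?Q)) S" by (rule emeasure_distr[OF Qm S, symmetric])
    also have "distr ?H (Gr k) ((`) ?Q) = ?H" using rot_inv_haar[OF k] Q by (auto simp: rot_inv_def)
    also have "emeasure ?H S = emeasure ?\<nu> A"
      using emeasure_distr[OF mp A] by (simp add: S_def space_haar[OF k])
    finally show ?thesis .
  qed
  then have ex: "?\<Phi> ?\<nu>" using H.prob_space_distr[OF mp] by simp
  have un: "\<nu> = ?\<nu>" if \<nu>: "?\<Phi> \<nu>" for \<nu>
  proof -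
    have s\<nu>: "sets \<nu> = sets ?B" and p\<nu>: "prob_space \<nu>" using \<nu> by auto
    have sp': "span \<in> measurable \<nu> (Gr k)" using sp by (simp add: s\<nu> cong: measurable_cong_sets)
    have space\<nu>: "space \<nu> = flats0 K k" using \<nu> by simp
    have "distr (distr \<nu> (Gr k) span) (Gr k) ((`) R) = distr \<nu> (Gr k) span"
      if R: "orthogonal_transformation R" for R :: "'a \<Rightarrow> 'a"
    proof (rule measure_eqI)
      fix C assume "C \<in> sets (distr (distr \<nu> (Gr k) span) (Gr k) ((`) R))"
      then have C: "C \<in> sets (Gr k)" by simp
      let ?Q = "inv R"
      have Q: "orthogonal_transformation ?Q" by (rule orthogonal_transformation_inverse(1)[OF R])
      have QQ: "inv ?Q = R"
        by (rule inv_inv_eq) (simp add: orthogonal_transformation_bij[OF R])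
      define A where "A = span -` C \<inter> flats0 K k"
      have A: "A \<in> sets ?B" using measurable_sets[OF sp C] by (simp add: A_def)
      have "(\<lambda>L. ?Q ` L) ` A = {F \<in> flats0 K k. R ` F \<in> A}"
        using act[OF A Q] by (simp add: QQ)
      also have "\<dots> = span -` ((`) R -` C \<inter> subspaces k) \<inter> space \<nu>"
      proof (intro set_eqI iffI)
        fix F assume F: "F \<in> {F \<in> flats0 K k. R ` F \<in> A}"
        then show "F \<in> span -` ((`) R -` C \<inter> subspaces k) \<inter> space \<nu>"
          using span_flats0[OF K, of F k] by (auto simp: A_def space\<nu> span_orthogonal_image[OF R])
      next
        fix F assume F: "F \<in> span -` ((`) R -` C \<inter> subspaces k) \<inter> space \<nu>"
        have "R ` F \<in> flats0 K k"
          using F span_flats0[OF K, of F k] orthogonal_image_subspaces[OF R, of "span F" k]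
            model_part_orthogonal_image[OF R K, of "span F"]
          unfolding flats0_eq[OF K] space\<nu> by (metis IntD2 image_eqI)
        then show "F \<in> {F \<in> flats0 K k. R ` F \<in> A}"
          using F by (auto simp: A_def space\<nu> span_orthogonal_image[OF R])
      qed
      finally have im: "(\<lambda>L. ?Q ` L) ` A = span -` ((`) R -` C \<inter> subspaces k) \<inter> space \<nu>" .
      have "emeasure (distr (distr \<nu> (Gr k) span) (Gr k) ((`) R)) C
          = emeasure \<nu> (span -` ((`) R -` C \<inter> subspaces k) \<inter> space \<nu>)"
        using measurable_orthogonal_image[OF R, of k] measurable_sets[OF measurable_orthogonal_image[OF R, of k] C] sp' C
        by (simp add: emeasure_distr)
      also have "\<dots> = emeasure \<nu> A"
      proof -
        have "sf_isometry K ?Q \<and> ?Q 0 = 0"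
          using orthogonal_transformation_sf_isometry[OF Q K] linear_0[OF orthogonal_transformation_linear[OF Q]]
          by simp
        then show ?thesis using \<nu> A s\<nu> im by metis
      qed
      also have "\<dots> = emeasure (distr \<nu> (Gr k) span) C"
        using emeasure_distr[OF sp' C] by (simp add: A_def space\<nu>)
      finally show "emeasure (distr (distr \<nu> (Gr k) span) (Gr k) ((`) R)) C = emeasure (distr \<nu> (Gr k) span) C" .
    qed simp
    then have "rot_inv k (distr \<nu> (Gr k) span)"
      using prob_space.prob_space_distr[OF p\<nu> sp'] by (simp add: rot_inv_def)
    then have "?H = distr \<nu> (Gr k) span" by (rule haar_eqI)
    then have "?\<nu> = distr (distr \<nu> (Gr k) span) ?B (model_part K)" by simp
    also have "\<dots> = distr \<nu> ?B (model_part K \<circ> span)"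
      by (rule distr_distr[OF measurable_model_part[OF K] sp'])
    also have "\<dots> = distr \<nu> \<nu> (\<lambda>x. x)"
      using span_flats0[OF K] by (intro distr_cong) (auto simp: s\<nu> space\<nu>)
    also have "\<dots> = \<nu>" by (rule distr_id)
    finally show ?thesis by simp
  qed
  show ?thesis unfolding flats0_measure_def by (rule the_equality, rule ex, rule un)
qed

subsection \<open>Flats in terms of their direction and a point\<close>

lemma flat_at_eq_affine:
  "flat_at K V z = (\<lambda>y. z + y) ` (V\<^sup>\<bottom>) \<inter> space_form K"
  by (auto simp: flat_at_def image_iff) (metis add.commute diff_add_cancel)

lemma flat_at_in_flats:
  fixes V :: "'a::euclidean_space set"
  assumes V: "subspace V" and ne: "flat_at K V z \<noteq> {}"
  shows "flat_at K V z \<in> flats K (DIM('a) - dim V)"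
proof -
  have s: "subspace (V\<^sup>\<bottom>)" by (rule subspace_orthogonal_comp)
  have "affine ((\<lambda>y. z + y) ` (V\<^sup>\<bottom>))"
    using affine_translation[of "V\<^sup>\<bottom>" z] subspace_imp_affine[OF s] by simp
  moreover have "aff_dim ((\<lambda>y. z + y) ` (V\<^sup>\<bottom>)) = int (DIM('a) - dim V)"
    using aff_dim_subspace[OF s] dim_perp[OF V] by (simp add: aff_dim_translation_eq)
  ultimately show ?thesis
    using ne unfolding flats_def flat_at_eq_affine by blast
qed

lemma flat_at_memD:
  assumes V: "subspace V" and y: "y \<in> flat_at K V z"
  shows "orth_proj V y = orth_proj V z"
proof -
  have "orth_proj V (y - z) = 0" using y orth_proj_perp_zero[OF V] by (simp add: flat_at_def)
  then show ?thesis using linear_diff[OF linear_orth_proj[OF V]] by simp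
qed

lemma flat_at_hits_sf_ball:
  assumes V: "subspace V" and K: "K \<le> 0" and u: "u > 0"
  shows "flat_at K V z \<inter> sf_ball K u \<noteq> {} \<longleftrightarrow> norm (orth_proj V z) \<le> rad K u"
proof
  assume "flat_at K V z \<inter> sf_ball K u \<noteq> {}"
  then obtain y where y: "y \<in> flat_at K V z" "norm y \<le> rad K u"
    by (auto simp: sf_ball_eq[OF K u])
  have "(norm (orth_proj V y))\<^sup>2 \<le> (norm y)\<^sup>2"
    using infdist_pythagoras[OF V, of y] by (simp add: infdist_perp[OF V])
  then have "norm (orth_proj V y) \<le> norm y" by simp
  then show "norm (orth_proj V z) \<le> rad K u" using y flat_at_memD[OF V y(1)] by simp
next
  assume n: "norm (orth_proj V z) \<le> rad K u"
  have "z - orth_proj V z \<in> V\<^sup>\<bottom>" using orth_proj(2)[OF V] by (auto simp: mem_orthogonal_comp)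
  then have "- (z - orth_proj V z) \<in> V\<^sup>\<bottom>" by (rule subspace_neg[OF subspace_orthogonal_comp])
  then have "orth_proj V z \<in> flat_at K V z"
    using rad_bounds(3)[OF K u n] by (simp add: flat_at_def)
  then show "flat_at K V z \<inter> sf_ball K u \<noteq> {}" using n by (auto simp: sf_ball_eq[OF K u])
qed

text \<open>In the model, orthogonality at a point of \<open>L\<close> to the flat \<open>L\<close> through the origin is Euclidean
  orthogonality.\<close>

lemma perp_flat_eq:
  fixes V :: "'a::euclidean_space set"
  assumes K: "K < 0" and V: "subspace V" "dim V = DIM('a) - k" and k: "k \<le> DIM('a)"
    and x: "x \<in> model_part K V"
  shows "perp_flat K k (model_part K V) x = flat_at K V x"
  unfolding perp_flat_def
proof (rule the_equality)
  have xV: "x \<in> V" "x \<in> space_form K" using x by (auto simp: model_part_def)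
  have a: "0 < 1 + K * (norm x)\<^sup>2" using xV(2) K by (simp add: in_space_form_iff)
  have xin: "x \<in> flat_at K V x" using xV by (simp add: flat_at_def subspace_0[OF subspace_orthogonal_comp])
  show "flat_at K V x \<in> flats K k \<and> x \<in> flat_at K V x \<and>
      (\<forall>y\<in>flat_at K V x. \<forall>z\<in>model_part K V. sf_inner K x (y - x) (z - x) = 0)"
  proof (intro conjI ballI)
    show "flat_at K V x \<in> flats K k" using flat_at_in_flats[OF V(1), of K x] V(2) k xin by auto
    fix y z assume y: "y \<in> flat_at K V x" and z: "z \<in> model_part K V"
    have "(y - x) \<bullet> x = 0" "(y - x) \<bullet> z = 0"
      using y z xV by (auto simp: flat_at_def mem_orthogonal_comp model_part_def)
    then show "sf_inner K x (y - x) (z - x) = 0"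
      by (simp add: sf_inner_def inner_diff_right inner_commute)
  qed (rule xin)
  fix E assume E: "E \<in> flats K k \<and> x \<in> E \<and> (\<forall>y\<in>E. \<forall>z\<in>model_part K V. sf_inner K x (y - x) (z - x) = 0)"
  obtain A where A: "affine A" "aff_dim A = int k" "E = A \<inter> space_form K"
    using E by (auto simp: flats_def)
  have perp: "y - x \<in> V\<^sup>\<bottom>" if y: "y \<in> E" for y
    unfolding mem_orthogonal_comp
  proof
    \<comment> \<open>Taking \<open>z = 0\<close> first shows that \<open>y - x\<close> is orthogonal to \<open>x\<close>, and then the metric tensor is Euclidean.\<close>
    have orth: "((y - x) \<bullet> (z - x)) * (1 + K * (norm x)\<^sup>2) = K * (x \<bullet> (y - x)) * (x \<bullet> (z - x))"
      if z: "z \<in> model_part K V" for z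
    proof -
      have "((y - x) \<bullet> (z - x)) / (1 + K * (norm x)\<^sup>2) -
          K * (x \<bullet> (y - x)) * (x \<bullet> (z - x)) / (1 + K * (norm x)\<^sup>2)\<^sup>2 = 0"
        using E y z by (simp add: sf_inner_def)
      moreover have "((y - x) \<bullet> (z - x)) / (1 + K * (norm x)\<^sup>2) =
          ((y - x) \<bullet> (z - x)) * (1 + K * (norm x)\<^sup>2) / (1 + K * (norm x)\<^sup>2)\<^sup>2"
        using a by (simp add: power2_eq_square)
      ultimately show ?thesis using a by (simp add: diff_divide_distrib[symmetric])
    qed
    have "0 \<in> model_part K V" using subspace_0[OF V(1)] K by (simp add: model_part_def)
    from orth[OF this] have "(y - x) \<bullet> x + K * (norm x)\<^sup>2 * ((y - x) \<bullet> x) = K * ((y - x) \<bullet> x) * (x \<bullet> x)"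
      by (simp add: inner_commute algebra_simps)
    then have yx: "(y - x) \<bullet> x = 0" by (simp add: power2_norm_eq_inner)
    have "(y - x) \<bullet> z = 0" if z: "z \<in> model_part K V" for z
      using orth[OF z] yx a by (simp add: inner_diff_right inner_commute)
    then have "model_part K V \<subseteq> {w. (y - x) \<bullet> w = 0}" by auto
    then have "span (model_part K V) \<subseteq> {w. (y - x) \<bullet> w = 0}"
      by (rule span_minimal) (rule subspace_hyperplane)
    then show "(y - x) \<bullet> w = 0" if "w \<in> V" for w
      using that span_model_part[OF V(1), of K] K by auto
  qed
  have hull: "affine hull E = A"
    using affine_hull_affine_Int_open[OF A(1) open_space_form, of K] E A
    by (auto simp: affine_hull_eq[THEN iffD2])
  let ?B = "(\<lambda>y. x + y) ` (V\<^sup>\<bottom>)"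
  have B: "affine ?B"
    using affine_translation[of "V\<^sup>\<bottom>" x] subspace_imp_affine[OF subspace_orthogonal_comp, of V] by simp
  have "E \<subseteq> ?B"
  proof
    fix y assume "y \<in> E"
    from perp[OF this] show "y \<in> ?B" by (intro image_eqI[of _ _ "y - x"]) auto
  qed
  then have sub: "A \<subseteq> ?B" using hull_minimal[of E ?B affine] B hull by simp
  have "aff_dim ?B = int k"
    using aff_dim_subspace[OF subspace_orthogonal_comp, of V] dim_perp[OF V(1)] V(2) k
    by (simp add: aff_dim_translation_eq)
  then have "A = ?B"
    by (intro affine_dim_equal[OF A(1) B _ sub]) (use A E in auto)
  then show "E = flat_at K V x" unfolding flat_at_eq_affine A(3) by simp
qed

text \<open>The flat hits a ball inside the model iff the centre, moved by \<open>- z\<close>, is within the radius of \<open>V\<^sup>\<bottom>\<close>.\<close>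

lemma measurable_flat_at:
  fixes g :: "'w \<Rightarrow> 'a::euclidean_space"
  assumes f: "f \<in> measurable N (Gr m)" and g: "g \<in> borel_measurable N"
    and m: "m \<le> DIM('a)" and ne: "\<And>\<omega>. \<omega> \<in> space N \<Longrightarrow> flat_at K (f \<omega>) (g \<omega>) \<noteq> {}"
  shows "(\<lambda>\<omega>. flat_at K (f \<omega>) (g \<omega>)) \<in> measurable N (flats_borel K (DIM('a) - m))"
  unfolding flats_borel_def
proof (rule measurable_borel_of_fell[OF open_space_form flats_closeds])
  have sub: "subspace (f \<omega>)" "dim (f \<omega>) = m" if "\<omega> \<in> space N" for \<omega>
    using measurable_space[OF f that] by (auto simp: subspaces_def)
  show "flat_at K (f \<omega>) (g \<omega>) \<in> flats K (DIM('a) - m)" if "\<omega> \<in> space N" for \<omega>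
    using flat_at_in_flats[OF sub(1)[OF that] ne[OF that]] sub(2)[OF that] by simp
  fix c :: 'a and r assume c: "cball c r \<subseteq> space_form K"
  have "{\<omega> \<in> space N. flat_at K (f \<omega>) (g \<omega>) \<inter> ball c r \<noteq> {}} =
      {\<omega> \<in> space N. infdist (c - g \<omega>) ((f \<omega>)\<^sup>\<bottom>) < r}"
  proof (intro Collect_cong conj_cong refl)
    fix \<omega> assume w: "\<omega> \<in> space N"
    have "flat_at K (f \<omega>) (g \<omega>) \<inter> ball c r \<noteq> {} \<longleftrightarrow> (f \<omega>)\<^sup>\<bottom> \<inter> ball (c - g \<omega>) r \<noteq> {}"
    proof
      assume "flat_at K (f \<omega>) (g \<omega>) \<inter> ball c r \<noteq> {}"
      then obtain y where "y - g \<omega> \<in> (f \<omega>)\<^sup>\<bottom>" "dist c y < r" by (auto simp: flat_at_def)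
      then have "y - g \<omega> \<in> (f \<omega>)\<^sup>\<bottom> \<inter> ball (c - g \<omega>) r" by (simp add: dist_norm)
      then show "(f \<omega>)\<^sup>\<bottom> \<inter> ball (c - g \<omega>) r \<noteq> {}" by blast
    next
      assume "(f \<omega>)\<^sup>\<bottom> \<inter> ball (c - g \<omega>) r \<noteq> {}"
      then obtain v where v: "v \<in> (f \<omega>)\<^sup>\<bottom>" "dist (c - g \<omega>) v < r" by auto
      then have "dist c (g \<omega> + v) < r" by (simp add: dist_norm algebra_simps)
      moreover from this have "g \<omega> + v \<in> space_form K" using c by auto
      ultimately have "g \<omega> + v \<in> flat_at K (f \<omega>) (g \<omega>) \<inter> ball c r" using v by (simp add: flat_at_def)
      then show "flat_at K (f \<omega>) (g \<omega>) \<inter> ball c r \<noteq> {}" by blast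
    qed
    then show "flat_at K (f \<omega>) (g \<omega>) \<inter> ball c r \<noteq> {} \<longleftrightarrow> infdist (c - g \<omega>) ((f \<omega>)\<^sup>\<bottom>) < r"
      by (simp add: infdist_subspace_less_iff[OF subspace_orthogonal_comp])
  qed
  also have "\<dots> \<in> sets N"
  proof -
    have "(\<lambda>\<omega>. infdist (c - g \<omega>) ((f \<omega>)\<^sup>\<bottom>)) \<in> borel_measurable N"
      using g by (intro measurable_infdist_joint[OF measurable_compose[OF f measurable_perp]]) simp
    then show ?thesis by (intro borel_measurable_less) auto
  qed
  finally show "{\<omega> \<in> space N. flat_at K (f \<omega>) (g \<omega>) \<inter> ball c r \<noteq> {}} \<in> sets N" .
qed

subsection \<open>The distance of an intersection of flats from the base point\<close>

text \<open>Measurability of the distance reduces to countably many events that the intersection misses a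
  compact ball.\<close>

lemma sf_setdist_INF_rat:
  fixes F :: "'a::euclidean_space set"
  assumes K: "K \<le> 0" and F: "F \<subseteq> space_form K"
  shows "sf_setdist K F = (INF r\<in>\<rat> \<inter> {0<..}. if F \<inter> cball 0 (rad K r) = {} then \<top> else ennreal r)"
proof (rule antisym)
  show "sf_setdist K F \<le> (INF r\<in>\<rat> \<inter> {0<..}. if F \<inter> cball 0 (rad K r) = {} then \<top> else ennreal r)"
  proof (rule INF_greatest)
    fix r :: real assume r: "r \<in> \<rat> \<inter> {0<..}"
    show "sf_setdist K F \<le> (if F \<inter> cball 0 (rad K r) = {} then \<top> else ennreal r)"
    proof (cases "F \<inter> cball 0 (rad K r) = {}")
      case False
      then obtain x where x: "x \<in> F" "norm x \<le> rad K r" by auto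
      then have "sf_dist K 0 x \<le> r"
        using sf_dist_le_iff[OF K, of r x] r F by (auto simp: sf_dist_commute)
      then have "ennreal (sf_dist K 0 x) \<le> ennreal r" by (rule ennreal_leI)
      then have "sf_setdist K F \<le> ennreal r" unfolding sf_setdist_def using x(1) by (rule INF_lower2[rotated])
      then show ?thesis using False by simp
    qed simp
  qed
  show "(INF r\<in>\<rat> \<inter> {0<..}. if F \<inter> cball 0 (rad K r) = {} then \<top> else ennreal r) \<le> sf_setdist K F"
    unfolding sf_setdist_def
  proof (rule INF_greatest, rule ennreal_le_epsilon)
    fix x e assume x: "x \<in> F" and e: "(0::real) < e"
    have nn: "0 \<le> sf_dist K 0 x" using x F K by (intro sf_dist_nonneg) auto
    obtain r where r: "r \<in> \<rat>" "sf_dist K 0 x < r" "r < sf_dist K 0 x + e"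
      using Rats_dense_in_real[of "sf_dist K 0 x" "sf_dist K 0 x + e"] e by auto
    have "x \<in> F \<inter> cball 0 (rad K r)"
      using sf_dist_le_iff[OF K, of r x] x F r nn by (auto simp: sf_dist_commute)
    then have "(if F \<inter> cball 0 (rad K r) = {} then \<top> else ennreal r) \<le> ennreal (sf_dist K 0 x) + ennreal e"
      using r nn e by (auto simp: ennreal_plus[symmetric] simp del: ennreal_plus intro!: ennreal_leI)
    then show "(INF r\<in>\<rat> \<inter> {0<..}. if F \<inter> cball 0 (rad K r) = {} then \<top> else ennreal r)
        \<le> ennreal (sf_dist K 0 x) + ennreal e"
      using r nn by (intro INF_lower2[of r]) auto
  qed
qed

lemma measurable_sf_setdist_Int:
  assumes K: "K \<le> 0"
  shows "(\<lambda>p. sf_setdist K (fst p \<inter> snd p)) \<in>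
    borel_measurable (flats_borel K k \<Otimes>\<^sub>M (flats0_borel K q :: 'a::euclidean_space set measure))"
proof -
  let ?N = "(flats_borel K k :: 'a set measure) \<Otimes>\<^sub>M (flats0_borel K q :: 'a set measure)"
  have sp: "space ?N = flats K k \<times> flats0 K q" by (simp add: space_pair_measure)
  have hit: "{p \<in> space ?N. fst p \<inter> snd p \<inter> C = {}} \<in> sets ?N"
    if C: "compact C" "C \<subseteq> space_form K" for C :: "'a set"
  proof (rule disjoint_within_compact_measurable[OF open_space_form C])
    show "fst p \<in> closeds (space_form K)" "snd p \<in> closeds (space_form K)" if "p \<in> space ?N" for p
      using that unfolding sp by (auto intro: subsetD[OF flats_closeds] subsetD[OF flats0_closeds])
    fix D :: "'a set" assume D: "compact D" "D \<subseteq> space_form K"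
    have "fst -` {F \<in> flats K k. F \<inter> D = {}} \<inter> space ?N \<in> sets ?N"
      unfolding flats_borel_def
      by (rule measurable_sets[OF measurable_fst sets_borel_of_miss[OF flats_closeds D]])
    moreover have "fst -` {F \<in> flats K k. F \<inter> D = {}} \<inter> space ?N = {p \<in> space ?N. fst p \<inter> D = {}}"
      unfolding sp by auto
    ultimately show "{p \<in> space ?N. fst p \<inter> D = {}} \<in> sets ?N" by (simp only:)
    have "snd -` {F \<in> flats0 K q. F \<inter> D = {}} \<inter> space ?N \<in> sets ?N"
      unfolding flats0_borel_def
      by (rule measurable_sets[OF measurable_snd sets_borel_of_miss[OF flats0_closeds D]])
    moreover have "snd -` {F \<in> flats0 K q. F \<inter> D = {}} \<inter> space ?N = {p \<in> space ?N. snd p \<inter> D = {}}"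
      unfolding sp by auto
    ultimately show "{p \<in> space ?N. snd p \<inter> D = {}} \<in> sets ?N" by (simp only:)
  qed
  have "(\<lambda>p. INF r\<in>\<rat> \<inter> {0<..}. if fst p \<inter> snd p \<inter> cball 0 (rad K r) = {} then \<top> else ennreal r)
      \<in> borel_measurable ?N"
  proof (rule borel_measurable_INF)
    show "countable (\<rat> \<inter> {0::real<..})" using countable_rat by (rule countable_subset[rotated]) auto
    fix r :: real assume r: "r \<in> \<rat> \<inter> {0<..}"
    have "cball 0 (rad K r) \<subseteq> (space_form K :: 'a set)" using r rad_bounds(3)[OF K, of r] by auto
    then show "(\<lambda>p. if fst p \<inter> snd p \<inter> cball 0 (rad K r) = {} then \<top> else ennreal r) \<in> borel_measurable ?N"
      using hit[OF compact_cball] by (intro measurable_If) auto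
  qed
  moreover have "sf_setdist K (fst p \<inter> snd p) =
      (INF r\<in>\<rat> \<inter> {0<..}. if fst p \<inter> snd p \<inter> cball 0 (rad K r) = {} then \<top> else ennreal r)"
    if "p \<in> space ?N" for p
    using that unfolding sp by (intro sf_setdist_INF_rat[OF K]) (auto simp: flats_def)
  ultimately show ?thesis by (subst measurable_cong)
qed

lemma sf_setdist_eq_top_iff: "sf_setdist K F = \<top> \<longleftrightarrow> F = {}"
proof
  assume "sf_setdist K F = \<top>"
  show "F = {}"
  proof (rule ccontr)
    assume "F \<noteq> {}"
    then obtain x where "x \<in> F" by blast
    then have "sf_setdist K F \<le> ennreal (sf_dist K 0 x)" unfolding sf_setdist_def by (rule INF_lower)
    then show False using \<open>sf_setdist K F = \<top>\<close> by (simp add: top_unique)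
  qed
qed (simp add: sf_setdist_def)

section \<open>Comparison with Lebesgue measure\<close>

text \<open>A bounded neighbourhood of the unit ball of \<open>V\<close>: the product of the unit balls of \<open>V\<close> and \<open>V\<^sup>\<bottom>\<close>. The
  projection to \<open>V\<close> of Lebesgue measure on it is uniform on the unit ball of \<open>V\<close>, and it depends measurably on \<open>V\<close> without a choice of bases.\<close>

definition cyl :: "'a::euclidean_space set \<Rightarrow> 'a set" where
  "cyl V = {z. infdist z V \<le> 1 \<and> infdist z (V\<^sup>\<bottom>) \<le> 1}"

lemma cyl_iff: "subspace V \<Longrightarrow> z \<in> cyl V \<longleftrightarrow> infdist z V \<le> 1 \<and> norm (orth_proj V z) \<le> 1"
  for V :: "'a::euclidean_space set"
  by (simp add: cyl_def infdist_perp)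

lemma closed_cyl: "closed (cyl V)"
  unfolding cyl_def by (intro closed_Collect_conj closed_Collect_le continuous_intros)

lemma cyl_emeasure:
  fixes V :: "'a::euclidean_space set"
  assumes V: "subspace V"
  shows "emeasure lborel (cyl V) \<noteq> 0" "emeasure lborel (cyl V) \<noteq> \<infinity>"
proof -
  have "ball 0 1 \<subseteq> cyl V"
  proof
    fix z :: 'a assume "z \<in> ball 0 1"
    then have "norm z < 1" by simp
    then show "z \<in> cyl V"
      using infdist_le_norm[OF V, of z] infdist_le_norm[OF subspace_orthogonal_comp, of z V]
      by (simp add: cyl_def)
  qed
  then have "emeasure lborel (ball (0::'a) 1) \<le> emeasure lborel (cyl V)"
    using closed_cyl[of V] by (intro emeasure_mono) auto
  then show "emeasure lborel (cyl V) \<noteq> 0" using lborel_unit_ball(1) by auto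
  have "bounded (cyl V)"
  proof (rule boundedI)
    fix z assume z: "z \<in> cyl V"
    have "norm z \<le> norm (z - orth_proj V z) + norm (orth_proj V z)" by (metis diff_add_cancel norm_triangle_ineq)
    also have "\<dots> \<le> 2" using z by (simp add: cyl_iff[OF V] infdist_subspace[OF V])
    finally show "norm z \<le> 2" .
  qed
  then show "emeasure lborel (cyl V) \<noteq> \<infinity>" using emeasure_bounded_finite by (metis infinity_ennreal_def less_irrefl)
qed

lemma borel_measurable_orth_proj: "subspace V \<Longrightarrow> orth_proj V \<in> borel_measurable borel"
  by (intro borel_measurable_continuous_onI linear_continuous_on
      linear_conv_bounded_linear[THEN iffD1] linear_orth_proj)

text \<open>A measure on the subspace \<open>V\<close> that is quasi-invariant under small translations is comparable
  to the projection to \<open>V\<close> of Lebesgue measure on a cylinder around \<open>V\<close>.\<close>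

lemma kernel_bound:
  fixes V :: "'a::euclidean_space set" and N :: "'a measure" and \<kappa> :: ennreal
  assumes V: "subspace V" and r: "0 < r" and N: "sets N = sets borel"
    and fin: "emeasure N (V \<inter> cball 0 (2 * r)) \<noteq> \<infinity>"
    and q1: "\<And>A v. A \<in> sets borel \<Longrightarrow> A \<subseteq> V \<inter> cball 0 r \<Longrightarrow> v \<in> V \<inter> cball 0 r \<Longrightarrow>
      emeasure N {y. y - v \<in> A} \<le> \<kappa> * emeasure N A"
    and q2: "\<And>A v. A \<in> sets borel \<Longrightarrow> A \<subseteq> V \<inter> cball 0 r \<Longrightarrow> v \<in> V \<inter> cball 0 r \<Longrightarrow>
      emeasure N A \<le> \<kappa> * emeasure N {y. y - v \<in> A}"
    and A: "A \<in> sets borel" "A \<subseteq> V \<inter> cball 0 r"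
  shows "emeasure lborel (cyl V) * emeasure N A \<le>
    \<kappa>\<^sup>2 * (emeasure lborel {z. infdist z V \<le> 1 \<and> r *\<^sub>R orth_proj V z \<in> A} * emeasure N (V \<inter> cball 0 r))"
proof -
  define B where "B = V \<inter> cball 0 r"
  define D where "D = V \<inter> cball 0 (2 * r)"
  have cV: "closed V" by (rule closed_subspace[OF V])
  have B: "B \<in> sets borel" and D: "D \<in> sets borel" unfolding B_def D_def using cV by auto
  obtain b :: 'a where b: "b \<in> Basis" using nonempty_Basis by blast
  \<comment> \<open>Points at distance more than \<open>1\<close> from \<open>V\<close> are sent to \<open>p0\<close>, outside the ball, and do not count.\<close>
  define p0 where "p0 = (2 * r) *\<^sub>R b"
  have p0: "p0 \<notin> cball 0 r" using b r by (simp add: p0_def)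
  define T where "T z = (if infdist z V \<le> 1 then r *\<^sub>R orth_proj V z else p0)" for z
  have Tm: "T \<in> borel_measurable lborel"
  proof -
    have "(\<lambda>x. infdist x V) \<in> borel_measurable borel"
      by (intro borel_measurable_continuous_onI continuous_intros)
    then show ?thesis unfolding T_def using borel_measurable_orth_proj[OF V] by measurable
  qed
  \<comment> \<open>Fubini needs a \<open>\<sigma>\<close>-finite measure; the ball of radius \<open>2 * r\<close> contains all translates that occur.\<close>
  define N' where "N' = density N (indicator D)"
  have spN: "space N = UNIV" using N by (metis sets_eq_imp_space_eq space_borel)
  have N': "emeasure N' X = emeasure N (D \<inter> X)" if "X \<in> sets borel" for X
    unfolding N'_def using that D N by (subst emeasure_density) (auto simp: indicator_inter_arith[symmetric])
  have shift: "{y. y - x \<in> X} \<in> sets borel" if "X \<in> sets borel" for x and X :: "'a set"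
    using measurable_sets[of "\<lambda>y. y - x" borel borel X] that by (simp add: vimage_def)
  have BD: "B \<subseteq> D" unfolding B_def D_def using r by auto
  have shD: "{y. y - x \<in> X} \<subseteq> D" if "X \<subseteq> B" "x \<in> B" for x X
  proof
    fix y assume "y \<in> {y. y - x \<in> X}"
    then have yx: "y - x \<in> B" using that by auto
    then have "y - x + x \<in> V" using that(2) V unfolding B_def by (intro subspace_add) auto
    moreover have "norm (y - x + x) \<le> 2 * r"
      using yx that(2) norm_triangle_ineq[of "y - x" x] unfolding B_def by simp
    ultimately show "y \<in> D" by (simp add: D_def)
  qed
  have "emeasure lborel {z \<in> space lborel. T z \<in> B} * emeasure N' A
       \<le> \<kappa>\<^sup>2 * (emeasure lborel {z \<in> space lborel. T z \<in> A} * emeasure N' B)"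
  proof (rule Fubini_comparison[OF lborel.sigma_finite_measure_axioms _ _ Tm B A(1)])
    have "finite_measure N'"
    proof
      have sp': "space N' = UNIV" by (simp add: N'_def spN)
      show "emeasure N' (space N') \<noteq> \<infinity>" unfolding sp' using N'[of UNIV] fin by (simp add: D_def)
    qed
    then show "sigma_finite_measure N'" by (rule finite_measure.axioms)
    show "sets N' = sets borel" by (simp add: N'_def N)
    show "emeasure N' A \<le> \<kappa> * emeasure N' {y. y - x \<in> A}" if x: "x \<in> B" for x
    proof -
      have "D \<inter> A = A" "D \<inter> {y. y - x \<in> A} = {y. y - x \<in> A}"
        using A(2) BD shD[OF _ x, of A] unfolding B_def by blast+
      then show ?thesis using q2[OF A, of x] x N'[OF A(1)] N'[OF shift[OF A(1)], of x] by (simp add: B_def)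
    qed
    show "emeasure N' {y. y - x \<in> B} \<le> \<kappa> * emeasure N' B" if x: "x \<in> A" for x
    proof -
      have xB: "x \<in> B" using x A(2) by (auto simp: B_def)
      have "D \<inter> B = B" "D \<inter> {y. y - x \<in> B} = {y. y - x \<in> B}"
        using BD shD[OF subset_refl xB] by blast+
      then show ?thesis using q1[OF B, of x] xB N'[OF B] N'[OF shift[OF B], of x] by (simp add: B_def)
    qed
    have "AE y in N'. y \<in> D"
      unfolding N'_def using D N by (subst AE_density) (auto simp: indicator_def)
    then show "AE y in N'. emeasure lborel {z \<in> space lborel. T z \<in> B \<and> y - T z \<in> A} =
        emeasure lborel {z \<in> space lborel. T z \<in> A \<and> y - T z \<in> B}"
    proof eventually_elim
      case (elim y)
      then have y: "y \<in> V" by (simp add: D_def)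
      \<comment> \<open>The reflection \<open>z \<mapsto> t - z\<close> preserves Lebesgue measure and induces \<open>x \<mapsto> y - x\<close> on \<open>V\<close>.\<close>
      define t where "t = (1 / r) *\<^sub>R y"
      have t: "t \<in> V" unfolding t_def using V y by (rule subspace_scale)
      have refl: "infdist (t - z) V = infdist z V" for z
        using infdist_add_subspace[OF V t, of "- z"] infdist_scale[OF V, of "-1" z] by simp
      have proj: "r *\<^sub>R orth_proj V (t - z) = y - r *\<^sub>R orth_proj V z" for z
      proof -
        have "r *\<^sub>R t = y" using r by (simp add: t_def)
        then show ?thesis
          by (simp add: linear_diff[OF linear_orth_proj[OF V]] orth_proj_self[OF V t] scaleR_diff_right)
      qed
      have iff: "T (t - z) \<in> A \<and> y - T (t - z) \<in> B \<longleftrightarrow> T z \<in> B \<and> y - T z \<in> A" for z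
        using p0 A(2) by (auto simp: T_def refl proj B_def)
      have "{z. T z \<in> A \<and> y - T z \<in> B} \<in> sets borel"
      proof -
        have "{z. T z \<in> A \<and> y - T z \<in> B} = (T -` A) \<inter> ((\<lambda>z. y - T z) -` B)" by auto
        moreover have "T -` A \<in> sets borel" using measurable_sets[OF Tm A(1)] by simp
        moreover have "(\<lambda>z. y - T z) -` B \<in> sets borel"
          using measurable_sets[of "\<lambda>z. y - T z" lborel borel B] Tm B by simp
        ultimately show ?thesis by simp
      qed
      from emeasure_lborel_reflect[OF this, of t] show ?case by (simp add: iff)
    qed
  qed
  moreover have "{z \<in> space lborel. T z \<in> B} = cyl V"
    using p0 r orth_proj(1)[OF V] V by (auto simp: T_def B_def cyl_iff[OF V] subspace_scale)
  moreover have "{z \<in> space lborel. T z \<in> A} = {z. infdist z V \<le> 1 \<and> r *\<^sub>R orth_proj V z \<in> A}"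
    using p0 A(2) by (auto simp: T_def)
  moreover have "emeasure N' A = emeasure N A" "emeasure N' B = emeasure N B"
  proof -
    have "D \<inter> A = A" "D \<inter> B = B" using A(2) BD unfolding B_def by blast+
    then show "emeasure N' A = emeasure N A" "emeasure N' B = emeasure N B"
      using N'[OF A(1)] N'[OF B] by simp_all
  qed
  ultimately show ?thesis by (simp add: B_def)
qed

subsection \<open>Hausdorff measure and Lipschitz maps\<close>

definition hausdorff_outer :: "'a set \<Rightarrow> ('a \<Rightarrow> 'a \<Rightarrow> real) \<Rightarrow> nat \<Rightarrow> 'a set \<Rightarrow> ennreal" where
  "hausdorff_outer X d m A = (SUP \<delta>\<in>{0<..}. hausdorff_pre X d m \<delta> A)"

lemma ediam_lipschitz:
  assumes b: "0 \<le> b" and l: "\<And>x y. x \<in> A \<Longrightarrow> y \<in> A \<Longrightarrow> d (f x) (f y) \<le> b * d x y"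
  shows "ediam d (f ` (C \<inter> A)) \<le> ennreal b * ediam d C"
  unfolding ediam_def
proof (rule SUP_least, rule SUP_least)
  fix x' y' assume "x' \<in> f ` (C \<inter> A)" "y' \<in> f ` (C \<inter> A)"
  then obtain x y where xy: "x \<in> C" "x \<in> A" "y \<in> C" "y \<in> A" "x' = f x" "y' = f y" by blast
  have "ennreal (d x' y') \<le> ennreal (b * d x y)" using l xy by (intro ennreal_leI) auto
  also have "\<dots> = ennreal b * ennreal (d x y)" using b by (rule ennreal_mult')
  also have "\<dots> \<le> ennreal b * (SUP x\<in>C. SUP y\<in>C. ennreal (d x y))"
    using xy by (intro mult_left_mono SUP_upper2[of x] SUP_upper2[of y]) auto
  finally show "ennreal (d x' y') \<le> ennreal b * (SUP x\<in>C. SUP y\<in>C. ennreal (d x y))" .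
qed

text \<open>Images of covering sets cover the image, with diameters multiplied by at most \<open>b\<close>.\<close>

lemma hausdorff_pre_lipschitz:
  assumes b: "0 < b" and fX: "f ` A \<subseteq> X"
    and l: "\<And>x y. x \<in> A \<Longrightarrow> y \<in> A \<Longrightarrow> d (f x) (f y) \<le> b * d x y" and \<delta>: "0 < \<delta>"
  shows "hausdorff_pre X d m (b * \<delta>) (f ` A) \<le> ennreal b ^ m * hausdorff_pre X d m \<delta> A"
proof -
  have b0: "0 < ennreal b ^ m" "ennreal b ^ m \<noteq> \<top>" using b by (auto simp: ennreal_power)
  have "hausdorff_pre X d m (b * \<delta>) (f ` A) / ennreal b ^ m \<le> hausdorff_pre X d m \<delta> A"
    unfolding hausdorff_pre_def[of X d m \<delta>]
  proof (rule INF_greatest)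
    fix C :: "nat \<Rightarrow> 'a set"
    assume "C \<in> {C. A \<subseteq> (\<Union>i. C i) \<and> (\<forall>i. C i \<subseteq> X \<and> ediam d (C i) \<le> ennreal \<delta>)}"
    then have C: "A \<subseteq> (\<Union>i. C i)" "\<And>i. ediam d (C i) \<le> ennreal \<delta>" by auto
    define C' where "C' i = f ` (C i \<inter> A)" for i
    have e: "ediam d (C' i) \<le> ennreal b * ediam d (C i)" for i
      unfolding C'_def using b l by (intro ediam_lipschitz) auto
    have "ediam d (C' i) \<le> ennreal (b * \<delta>)" for i
      using order_trans[OF e[of i] mult_left_mono[OF C(2)[of i], of "ennreal b"]] b \<delta> by (simp add: ennreal_mult)
    moreover have "f ` A \<subseteq> (\<Union>i. C' i)" using C(1) unfolding C'_def by blast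
    moreover have "C' i \<subseteq> X" for i using fX by (auto simp: C'_def)
    ultimately have "hausdorff_pre X d m (b * \<delta>) (f ` A) \<le>
        (\<Sum>i. if C' i = {} then 0 else ennreal (unit_ball_vol (real m)) * (ediam d (C' i) / 2) ^ m)"
      unfolding hausdorff_pre_def by (intro INF_lower) auto
    also have "\<dots> \<le> (\<Sum>i. ennreal b ^ m * (if C i = {} then 0 else ennreal (unit_ball_vol (real m)) * (ediam d (C i) / 2) ^ m))"
    proof (rule suminf_le)
      fix i
      show "(if C' i = {} then 0 else ennreal (unit_ball_vol (real m)) * (ediam d (C' i) / 2) ^ m)
          \<le> ennreal b ^ m * (if C i = {} then 0 else ennreal (unit_ball_vol (real m)) * (ediam d (C i) / 2) ^ m)"
      proof (cases "C' i = {}")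
        case False
        then have "C i \<noteq> {}" by (auto simp: C'_def)
        have "(ediam d (C' i) / 2) ^ m \<le> (ennreal b * (ediam d (C i) / 2)) ^ m"
          using divide_right_mono_ennreal[OF e[of i], of 2] by (intro power_mono) (auto simp: ennreal_times_divide)
        then have "ennreal (unit_ball_vol (real m)) * (ediam d (C' i) / 2) ^ m \<le>
            ennreal (unit_ball_vol (real m)) * (ennreal b * (ediam d (C i) / 2)) ^ m"
          by (rule mult_left_mono) simp
        then show ?thesis using False \<open>C i \<noteq> {}\<close> by (simp add: power_mult_distrib mult_ac)
      qed simp
    qed auto
    also have "\<dots> = ennreal b ^ m * (\<Sum>i. if C i = {} then 0 else ennreal (unit_ball_vol (real m)) * (ediam d (C i) / 2) ^ m)"
      by (rule ennreal_suminf_cmult)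
    finally show "hausdorff_pre X d m (b * \<delta>) (f ` A) / ennreal b ^ m \<le>
        (\<Sum>i. if C i = {} then 0 else ennreal (unit_ball_vol (real m)) * (ediam d (C i) / 2) ^ m)"
      using b0 by (intro divide_le_posI_ennreal) (auto simp: mult.commute)
  qed
  then have "ennreal b ^ m * (hausdorff_pre X d m (b * \<delta>) (f ` A) / ennreal b ^ m) \<le> ennreal b ^ m * hausdorff_pre X d m \<delta> A"
    by (rule mult_left_mono) simp
  moreover have "c * (x / c) = x" if "0 < c" "c \<noteq> \<top>" for c x :: ennreal
    using that by (simp add: ennreal_times_divide mult.commute[of c x] mult_divide_eq_ennreal)
  ultimately show ?thesis using b0 by simp
qed

lemma hausdorff_outer_lipschitz:
  assumes b: "0 < b" and fX: "f ` A \<subseteq> X"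
    and l: "\<And>x y. x \<in> A \<Longrightarrow> y \<in> A \<Longrightarrow> d (f x) (f y) \<le> b * d x y"
  shows "hausdorff_outer X d m (f ` A) \<le> ennreal b ^ m * hausdorff_outer X d m A"
  unfolding hausdorff_outer_def[of X d m "f ` A"]
proof (rule SUP_least)
  fix \<delta> :: real assume \<delta>: "\<delta> \<in> {0<..}"
  have "hausdorff_pre X d m (b * (\<delta> / b)) (f ` A) \<le> ennreal b ^ m * hausdorff_pre X d m (\<delta> / b) A"
    by (rule hausdorff_pre_lipschitz) (use \<delta> b fX l in auto)
  also have "\<dots> \<le> ennreal b ^ m * hausdorff_outer X d m A"
    unfolding hausdorff_outer_def using \<delta> b by (intro mult_left_mono SUP_upper) auto
  finally show "hausdorff_pre X d m \<delta> (f ` A) \<le> ennreal b ^ m * hausdorff_outer X d m A" using b by simp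
qed

section \<open>The law of a random flat hitting a ball\<close>

text \<open>A random direction together with a uniform random point of the cylinder around it.\<close>

definition samp :: "nat \<Rightarrow> ('a::euclidean_space set \<times> 'a) measure" where
  "samp m = density (haar m \<Otimes>\<^sub>M lborel) (\<lambda>p. indicator (cyl (fst p)) (snd p) / emeasure lborel (cyl (fst p)))"

text \<open>Off the cylinder, which carries the whole mass of \<open>samp\<close>, the value \<open>0\<close> guarantees that the flats
  below hit the ball at every point of the sample space and not just almost surely.\<close>

definition samp_point :: "real \<Rightarrow> 'a::euclidean_space set \<times> 'a \<Rightarrow> 'a" where
  "samp_point r p = (if snd p \<in> cyl (fst p) then r *\<^sub>R snd p else 0)"

definition samp_flat :: "real \<Rightarrow> real \<Rightarrow> 'a::euclidean_space set \<times> 'a \<Rightarrow> 'a set" where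
  "samp_flat K r p = flat_at K (fst p) (samp_point r p)"

context
  fixes m :: nat
  assumes m: "m \<le> DIM('a::euclidean_space)"
begin

private abbreviation "HL \<equiv> (haar m :: 'a set measure) \<Otimes>\<^sub>M (lborel :: 'a measure)"

lemma space_HL: "space HL = subspaces m \<times> UNIV"
  by (simp add: space_pair_measure space_haar[OF m])

lemma fst_HL: "fst \<in> measurable HL (Gr m)"
  using measurable_fst[of "haar m" "lborel :: 'a measure"] by (simp add: sets_haar[OF m] cong: measurable_cong_sets)

lemma snd_HL: "snd \<in> measurable HL (borel :: 'a measure)"
  using measurable_snd[of "haar m" "lborel :: 'a measure"] by (simp cong: measurable_cong_sets)

lemma sets_cyl: "{p \<in> space HL. snd p \<in> cyl (fst p)} \<in> sets HL"
proof -
  have "{p \<in> space HL. snd p \<in> cyl (fst p)} =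
      {p \<in> space HL. infdist (snd p) (fst p) \<le> 1} \<inter> {p \<in> space HL. infdist (snd p) ((fst p)\<^sup>\<bottom>) \<le> 1}"
    by (auto simp: cyl_def)
  also have "\<dots> \<in> sets HL"
    using measurable_infdist_joint[OF fst_HL snd_HL]
      measurable_infdist_joint[OF measurable_compose[OF fst_HL measurable_perp] snd_HL]
    by (intro sets.Int borel_measurable_le) auto
  finally show ?thesis .
qed

lemma measurable_cyl_emeasure: "(\<lambda>V. emeasure lborel (cyl V)) \<in> borel_measurable (haar m :: 'a set measure)"
proof -
  have "(\<lambda>V. emeasure lborel (Pair V -` {p \<in> space HL. snd p \<in> cyl (fst p)})) \<in> borel_measurable (haar m)"
    by (rule lborel.measurable_emeasure_Pair[OF sets_cyl])
  moreover have "Pair V -` {p \<in> space HL. snd p \<in> cyl (fst p)} = cyl V" if "V \<in> space (haar m)" for V :: "'a set"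
    using that by (auto simp: space_pair_measure)
  ultimately show ?thesis by (simp cong: measurable_cong)
qed

lemma measurable_samp_density:
  "(\<lambda>p. indicator (cyl (fst p)) (snd p) / emeasure lborel (cyl (fst p)) :: ennreal) \<in> borel_measurable HL"
proof (rule borel_measurable_divide_ennreal)
  have eq: "indicator {p \<in> space HL. snd p \<in> cyl (fst p)} p = (indicator (cyl (fst p)) (snd p) :: ennreal)"
    if "p \<in> space HL" for p using that by (simp add: indicator_def)
  show "(\<lambda>p. indicator (cyl (fst p)) (snd p) :: ennreal) \<in> borel_measurable HL"
    by (rule measurable_cong[OF eq, THEN iffD1, OF _ borel_measurable_indicator[OF sets_cyl]])
  show "(\<lambda>p. emeasure lborel (cyl (fst p))) \<in> borel_measurable HL"
    by (rule measurable_compose[OF measurable_fst measurable_cyl_emeasure])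
qed

lemma sets_samp: "sets (samp m :: ('a set \<times> 'a) measure) = sets HL"
  by (simp add: samp_def)

lemma space_samp: "space (samp m :: ('a set \<times> 'a) measure) = subspaces m \<times> UNIV"
  by (simp add: samp_def space_HL)

lemma emeasure_samp:
  assumes S: "S \<in> sets HL"
  shows "emeasure (samp m) S =
    (\<integral>\<^sup>+V. emeasure lborel {z. z \<in> cyl V \<and> (V, z) \<in> S} / emeasure lborel (cyl V) \<partial>(haar m :: 'a set measure))"
proof -
  have "emeasure (samp m) S = (\<integral>\<^sup>+p. indicator (cyl (fst p)) (snd p) / emeasure lborel (cyl (fst p)) * indicator S p \<partial>HL)"
    unfolding samp_def by (rule emeasure_density[OF measurable_samp_density S])
  also have "\<dots> = (\<integral>\<^sup>+V. \<integral>\<^sup>+z. indicator (cyl V) z / emeasure lborel (cyl V) * indicator S (V, z) \<partial>lborel \<partial>haar m)"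
    using lborel.nn_integral_fst[of "\<lambda>p. indicator (cyl (fst p)) (snd p) / emeasure lborel (cyl (fst p)) * indicator S p" "haar m"]
      measurable_samp_density S by (simp add: borel_measurable_times_ennreal)
  also have "\<dots> = (\<integral>\<^sup>+V. emeasure lborel {z. z \<in> cyl V \<and> (V, z) \<in> S} / emeasure lborel (cyl V) \<partial>(haar m :: 'a set measure))"
  proof (rule nn_integral_cong)
    fix V :: "'a set" assume "V \<in> space (haar m)"
    have "Pair V -` S \<in> sets lborel" by (rule sets_Pair1[OF S])
    then have s: "{z. z \<in> cyl V \<and> (V, z) \<in> S} \<in> sets lborel"
      using closed_cyl[of V] by (simp add: vimage_def Collect_conj_eq borel_closed)
    have "(\<integral>\<^sup>+z. indicator (cyl V) z / emeasure lborel (cyl V) * indicator S (V, z) \<partial>lborel) =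
        (\<integral>\<^sup>+z. inverse (emeasure lborel (cyl V)) * indicator {z. z \<in> cyl V \<and> (V, z) \<in> S} z \<partial>lborel)"
      by (intro nn_integral_cong) (auto simp: indicator_def divide_ennreal_def)
    also have "\<dots> = inverse (emeasure lborel (cyl V)) * emeasure lborel {z. z \<in> cyl V \<and> (V, z) \<in> S}"
      using s by (rule nn_integral_cmult_indicator)
    finally show "(\<integral>\<^sup>+z. indicator (cyl V) z / emeasure lborel (cyl V) * indicator S (V, z) \<partial>lborel) =
        emeasure lborel {z. z \<in> cyl V \<and> (V, z) \<in> S} / emeasure lborel (cyl V)"
      by (simp add: divide_ennreal_def mult.commute)
  qed
  finally show ?thesis .
qed

lemma prob_space_samp: "prob_space (samp m :: ('a set \<times> 'a) measure)"
proof
  have "emeasure (samp m) (space HL) = (\<integral>\<^sup>+V. 1 \<partial>(haar m :: 'a set measure))"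
    unfolding emeasure_samp[OF sets.top]
  proof (rule nn_integral_cong)
    fix V :: "'a set" assume "V \<in> space (haar m)"
    then have V: "V \<in> subspaces m" by (simp add: space_haar[OF m])
    have "{z. z \<in> cyl V \<and> (V, z) \<in> space HL} = cyl V" using V by (simp add: space_HL)
    then show "emeasure lborel {z. z \<in> cyl V \<and> (V, z) \<in> space HL} / emeasure lborel (cyl V) = 1"
      using cyl_emeasure[of V] V by (simp add: subspaces_def ennreal_divide_self less_top zero_less_iff_neq_zero)
  qed
  also have "\<dots> = emeasure (haar m :: 'a set measure) (space (haar m))" by simp
  also have "\<dots> = 1" by (rule prob_space.emeasure_space_1[OF prob_space_haar[OF m]])
  finally show "emeasure (samp m) (space (samp m :: ('a set \<times> 'a) measure)) = 1" by (simp add: samp_def)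
qed

lemma measurable_samp_point: "samp_point r \<in> measurable (samp m) (borel :: 'a measure)"
proof -
  have "(\<lambda>p. if snd p \<in> cyl (fst p) then r *\<^sub>R snd p else 0) \<in> borel_measurable HL"
    by (rule measurable_If[OF borel_measurable_scaleR[OF borel_measurable_const snd_HL] borel_measurable_const sets_cyl])
  then show ?thesis
    by (simp add: samp_point_def[abs_def] sets_samp cong: measurable_cong_sets)
qed

lemma samp_flat_hits:
  assumes V: "subspace V" and K: "K \<le> 0" and u: "u > 0"
  shows "samp_flat K (rad K u) (V, z) \<inter> sf_ball K u \<noteq> {}"
proof -
  have "norm (orth_proj V (samp_point (rad K u) (V, z))) \<le> rad K u"
    using rad_bounds(1)[OF K u] linear_scale[OF linear_orth_proj[OF V]] linear_0[OF linear_orth_proj[OF V]]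
    by (auto simp: samp_point_def cyl_iff[OF V] mult_left_le)
  then show ?thesis by (simp add: samp_flat_def flat_at_hits_sf_ball[OF V K u])
qed

lemma measurable_samp_flat:
  assumes K: "K \<le> 0" and u: "u > 0"
  shows "samp_flat K (rad K u) \<in> measurable (samp m) (flats_borel K (DIM('a) - m) :: 'a set measure)"
  unfolding samp_flat_def[abs_def]
proof (rule measurable_flat_at[OF _ measurable_samp_point m])
  show "fst \<in> measurable (samp m) (Gr m :: 'a set measure)"
    using fst_HL by (simp add: sets_samp cong: measurable_cong_sets)
  show "flat_at K (fst p) (samp_point (rad K u) p) \<noteq> {}" if "p \<in> space (samp m)" for p :: "'a set \<times> 'a"
    using samp_flat_hits[of "fst p" K u "snd p"] that K u
    by (auto simp: space_samp subspaces_def samp_flat_def)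
qed

end

lemma sets_hitting_flats:
  fixes K :: real
  assumes K: "K \<le> 0" and u: "u > 0"
  shows "hitting_flats K k u \<in> sets (flats_borel K k :: 'a::euclidean_space set measure)"
proof -
  have C: "compact (sf_ball K u :: 'a set)" "(sf_ball K u :: 'a set) \<subseteq> space_form K"
    by (simp add: sf_ball_eq[OF K u]) (auto simp: sf_ball_def)
  have "flats K k - {F \<in> flats K k. F \<inter> sf_ball K u = {}} \<in> sets (flats_borel K k :: 'a set measure)"
    using sets_borel_of_miss[OF flats_closeds C] sets.top[of "flats_borel K k :: 'a set measure"]
    by (intro sets.Diff) (auto simp: flats_borel_def[symmetric])
  also have "flats K k - {F \<in> flats K k. F \<inter> sf_ball K u = {}} = (hitting_flats K k u :: 'a set set)"
    by (auto simp: hitting_flats_def)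
  finally show ?thesis .
qed

lemma flat_at_orth_proj: "subspace V \<Longrightarrow> flat_at K V (orth_proj V z) = flat_at K V z"
proof -
  assume V: "subspace V"
  have s: "subspace (V\<^sup>\<bottom>)" by (rule subspace_orthogonal_comp)
  have d: "z - orth_proj V z \<in> V\<^sup>\<bottom>" using orth_proj(2)[OF V] by (auto simp: mem_orthogonal_comp)
  have "y - orth_proj V z \<in> V\<^sup>\<bottom> \<longleftrightarrow> y - z \<in> V\<^sup>\<bottom>" for y
    using subspace_add[OF s d, of "y - z"] subspace_diff[OF s _ d, of "y - orth_proj V z"] by auto
  then show ?thesis by (simp add: flat_at_def)
qed

lemma sets_flat_at:
  fixes V :: "'a::euclidean_space set"
  assumes V: "V \<in> subspaces m" and m: "m \<le> DIM('a)" and K: "K \<le> 0" and u: "u > 0"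
    and B: "B \<in> sets (flats_borel K (DIM('a) - m))"
  shows "{x \<in> V \<inter> cball 0 (rad K u). flat_at K V x \<in> B} \<in> sets borel"
proof -
  let ?D = "V \<inter> cball 0 (rad K u)"
  have sV: "subspace V" using V by (simp add: subspaces_def)
  have D: "?D \<in> sets borel" using closed_subspace[OF sV] by auto
  have "(\<lambda>x. flat_at K V x) \<in> measurable (restrict_space borel ?D) (flats_borel K (DIM('a) - m))"
  proof (rule measurable_flat_at[OF _ _ m])
    show "(\<lambda>x. V) \<in> measurable (restrict_space borel ?D) (Gr m)" using V by (intro measurable_const) simp
    show "(\<lambda>x. x) \<in> borel_measurable (restrict_space borel ?D)" by (intro measurable_restrict_space1) simp
    show "flat_at K V x \<noteq> {}" if "x \<in> space (restrict_space borel ?D)" for x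
    proof -
      have "x \<in> space_form K" using that rad_bounds(3)[OF K u, of x] by (simp add: space_restrict_space)
      then have "x \<in> flat_at K V x" by (simp add: flat_at_def subspace_0[OF subspace_orthogonal_comp])
      then show ?thesis by blast
    qed
  qed
  from measurable_sets[OF this B] have "(\<lambda>x. flat_at K V x) -` B \<inter> ?D \<in> sets (restrict_space borel ?D)"
    by (simp add: space_restrict_space)
  then have "(\<lambda>x. flat_at K V x) -` B \<inter> ?D \<in> sets borel"
    using D by (subst (asm) sets_restrict_space_iff) auto
  moreover have "(\<lambda>x. flat_at K V x) -` B \<inter> ?D = {x \<in> ?D. flat_at K V x \<in> B}" by auto
  ultimately show ?thesis by simp
qed

text \<open>A measure on flats that is obtained from kernels on the subspaces \<open>V\<close> which are, up to
  constants, translation-invariant and of the same mass on a ball for all \<open>V\<close>, has after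
  normalisation a law dominated by a multiple of the law of \<open>samp_flat\<close>. The unknown mass cancels.\<close>

lemma law_bound:
  fixes F :: "'a::euclidean_space set measure" and N :: "'a set \<Rightarrow> 'a measure" and W \<kappa> h0 :: ennreal
  assumes K: "K \<le> 0" and u: "u > 0" and m: "m \<le> DIM('a)"
  defines "r \<equiv> rad K u" and "k \<equiv> DIM('a) - m"
  defines "hit \<equiv> hitting_flats K k u :: 'a set set"
  assumes F: "sets F = sets (flats_borel K k)" and \<nu>: "prob_space \<nu>"
    and g: "g \<in> measurable \<nu> (Gr m)" "distr \<nu> (Gr m) g = haar m"
    and FI: "\<And>A. A \<in> sets F \<Longrightarrow> emeasure F A = (\<integral>\<^sup>+L. I A L \<partial>\<nu>)"
    and up: "\<And>A L. A \<in> sets F \<Longrightarrow> A \<subseteq> hit \<Longrightarrow> L \<in> space \<nu> \<Longrightarrow>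
      I A L \<le> W * emeasure (N (g L)) {x \<in> g L \<inter> cball 0 r. flat_at K (g L) x \<in> A}"
    and lo: "\<And>L. L \<in> space \<nu> \<Longrightarrow> h0 \<le> I hit L"
    and N: "\<And>V. V \<in> subspaces m \<Longrightarrow> sets (N V) = sets borel"
    and Nh: "\<And>V. V \<in> subspaces m \<Longrightarrow> emeasure (N V) (V \<inter> cball 0 r) = h0"
    and fin: "\<And>V. V \<in> subspaces m \<Longrightarrow> h0 \<noteq> \<infinity> \<Longrightarrow> emeasure (N V) (V \<inter> cball 0 (2 * r)) \<noteq> \<infinity>"
    and q1: "\<And>V A v. V \<in> subspaces m \<Longrightarrow> A \<in> sets borel \<Longrightarrow> A \<subseteq> V \<inter> cball 0 r \<Longrightarrow> v \<in> V \<inter> cball 0 r \<Longrightarrow>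
      emeasure (N V) {y. y - v \<in> A} \<le> \<kappa> * emeasure (N V) A"
    and q2: "\<And>V A v. V \<in> subspaces m \<Longrightarrow> A \<in> sets borel \<Longrightarrow> A \<subseteq> V \<inter> cball 0 r \<Longrightarrow> v \<in> V \<inter> cball 0 r \<Longrightarrow>
      emeasure (N V) A \<le> \<kappa> * emeasure (N V) {y. y - v \<in> A}"
    and prob: "prob_space (density F (\<lambda>E. indicator hit E / emeasure F hit))"
    and A: "A \<in> sets F"
  shows "emeasure (density F (\<lambda>E. indicator hit E / emeasure F hit)) A \<le>
    W * \<kappa>\<^sup>2 * emeasure (distr (samp m) (flats_borel K k) (samp_flat K r)) A"
proof -
  interpret \<nu>: prob_space \<nu> by (rule \<nu>)
  have hit: "hit \<in> sets F" unfolding F hit_def by (rule sets_hitting_flats[OF K u])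
  \<comment> \<open>The normalising constant; it is at least \<open>h0\<close>, against which the mass of the kernels cancels.\<close>
  define C where "C = emeasure F hit"
  have dens: "emeasure (density F (\<lambda>E. indicator hit E / C)) B = emeasure F (hit \<inter> B) / C"
    if B: "B \<in> sets F" for B
  proof -
    have "(\<lambda>E. indicator hit E / C) \<in> borel_measurable F" using hit by measurable
    then have "emeasure (density F (\<lambda>E. indicator hit E / C)) B = (\<integral>\<^sup>+E. indicator hit E / C * indicator B E \<partial>F)"
      using B by (rule emeasure_density)
    also have "\<dots> = (\<integral>\<^sup>+E. inverse C * indicator (hit \<inter> B) E \<partial>F)"
      by (intro nn_integral_cong) (auto simp: indicator_def divide_ennreal_def)
    also have "\<dots> = inverse C * emeasure F (hit \<inter> B)" using hit B by (intro nn_integral_cmult_indicator) auto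
    finally show ?thesis by (simp add: divide_ennreal_def mult.commute)
  qed
  have "C / C = 1"
    using prob_space.emeasure_space_1[OF prob] dens[OF sets.top] sets.sets_into_space[OF hit]
    by (simp add: C_def[symmetric] Int_absorb2)
  then have C: "C \<noteq> 0" "C \<noteq> \<top>" by (auto simp: ennreal_top_divide)
  have gV: "g L \<in> subspaces m" if "L \<in> space \<nu>" for L using measurable_space[OF g(1) that] by simp
  have "(\<integral>\<^sup>+L. h0 \<partial>\<nu>) \<le> (\<integral>\<^sup>+L. I hit L \<partial>\<nu>)" using lo by (intro nn_integral_mono)
  then have hC: "h0 \<le> C" using FI[OF hit] by (simp add: C_def \<nu>.emeasure_space_1)
  then have h0fin: "h0 \<noteq> \<infinity>" using C(2) by (auto simp: top_unique)
  define S where "S V = {x \<in> V \<inter> cball 0 r. flat_at K V x \<in> A \<inter> hit}" for V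
  have Ah: "A \<inter> hit \<in> sets F" using A hit by auto
  have S: "S V \<in> sets borel" if "V \<in> subspaces m" for V
    unfolding S_def r_def using sets_flat_at[OF that m K u] Ah unfolding F k_def by blast
  have sfm: "samp_flat K r \<in> measurable (samp m) (flats_borel K k :: 'a set measure)"
    unfolding r_def k_def by (rule measurable_samp_flat[OF m K u])
  define S' where "S' = samp_flat K r -` A \<inter> space (samp m)"
  have S's: "S' \<in> sets (haar m \<Otimes>\<^sub>M lborel)"
    using measurable_sets[OF sfm] A unfolding S'_def F sets_samp[OF m] by blast
  define G where "G V = emeasure lborel {z. z \<in> cyl V \<and> (V, z) \<in> S'} / emeasure lborel (cyl V)" for V
  have NS: "emeasure (N V) (S V) \<le> \<kappa>\<^sup>2 * h0 * G V" if V: "V \<in> subspaces m" for V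
  proof -
    have sV: "subspace V" using V by (simp add: subspaces_def)
    have r0: "0 < r" using rad_bounds(1)[OF K u] by (simp add: r_def)
    have "emeasure lborel (cyl V) * emeasure (N V) (S V) \<le>
        \<kappa>\<^sup>2 * (emeasure lborel {z. infdist z V \<le> 1 \<and> r *\<^sub>R orth_proj V z \<in> S V} * emeasure (N V) (V \<inter> cball 0 r))"
      by (rule kernel_bound[OF sV r0 N[OF V] fin[OF V h0fin] q1[OF V] q2[OF V] S[OF V]]) (auto simp: S_def)
    also have "\<dots> \<le> \<kappa>\<^sup>2 * (emeasure lborel {z. z \<in> cyl V \<and> (V, z) \<in> S'} * h0)"
      unfolding Nh[OF V]
    proof (intro mult_left_mono mult_right_mono emeasure_mono subsetI)
      fix z assume "z \<in> {z. infdist z V \<le> 1 \<and> r *\<^sub>R orth_proj V z \<in> S V}"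
      then have z: "infdist z V \<le> 1" "norm (r *\<^sub>R orth_proj V z) \<le> r" "flat_at K V (r *\<^sub>R orth_proj V z) \<in> A"
        by (auto simp: S_def)
      have zc: "z \<in> cyl V" using z(1,2) r0 by (simp add: cyl_iff[OF sV])
      have "flat_at K V (r *\<^sub>R z) = flat_at K V (r *\<^sub>R orth_proj V z)"
        using flat_at_orth_proj[OF sV, of K "r *\<^sub>R z"] linear_scale[OF linear_orth_proj[OF sV]] by simp
      then have "samp_flat K r (V, z) \<in> A" using z(3) zc by (simp add: samp_flat_def samp_point_def)
      then show "z \<in> {z. z \<in> cyl V \<and> (V, z) \<in> S'}" using zc V by (simp add: S'_def space_samp[OF m])
    next
      have "Pair V -` S' \<in> sets lborel" by (rule sets_Pair1[OF S's])
      then show "{z. z \<in> cyl V \<and> (V, z) \<in> S'} \<in> sets lborel"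
        using closed_cyl[of V] by (simp add: vimage_def Collect_conj_eq borel_closed)
    qed auto
    finally have *: "emeasure lborel (cyl V) * emeasure (N V) (S V) \<le> \<kappa>\<^sup>2 * h0 * emeasure lborel {z. z \<in> cyl V \<and> (V, z) \<in> S'}"
      by (simp add: mult_ac)
    have "emeasure (N V) (S V) = emeasure lborel (cyl V) * emeasure (N V) (S V) / emeasure lborel (cyl V)"
      using cyl_emeasure[OF sV] by (simp add: mult.commute[of "emeasure lborel (cyl V)"] mult_divide_eq_ennreal)
    also have "\<dots> \<le> \<kappa>\<^sup>2 * h0 * emeasure lborel {z. z \<in> cyl V \<and> (V, z) \<in> S'} / emeasure lborel (cyl V)"
      using * by (rule divide_right_mono_ennreal)
    also have "\<dots> = \<kappa>\<^sup>2 * h0 * G V" by (simp add: G_def ennreal_times_divide)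
    finally show ?thesis .
  qed
  have Gm: "G \<in> borel_measurable (haar m)"
  proof -
    let ?Z = "{p \<in> space (haar m \<Otimes>\<^sub>M lborel). snd p \<in> cyl (fst p)} \<inter> S'"
    have "(\<lambda>V. emeasure lborel (Pair V -` ?Z)) \<in> borel_measurable (haar m)"
      by (rule lborel.measurable_emeasure_Pair[OF sets.Int[OF sets_cyl[OF m] S's]])
    then have "(\<lambda>V. emeasure lborel (Pair V -` ?Z) / emeasure lborel (cyl V)) \<in> borel_measurable (haar m)"
      using measurable_cyl_emeasure[OF m] by (rule borel_measurable_divide_ennreal)
    moreover have "emeasure lborel (Pair V -` ?Z) / emeasure lborel (cyl V) = G V" if "V \<in> space (haar m)" for V
    proof -
      have "Pair V -` ?Z = {z. z \<in> cyl V \<and> (V, z) \<in> S'}" using that by (auto simp: space_pair_measure)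
      then show ?thesis by (simp add: G_def)
    qed
    ultimately show ?thesis by (rule measurable_cong[THEN iffD1, rotated])
  qed
  then have GmGr: "G \<in> borel_measurable (Gr m)" by (simp add: sets_haar[OF m] cong: measurable_cong_sets)
  have "emeasure F (A \<inter> hit) = (\<integral>\<^sup>+L. I (A \<inter> hit) L \<partial>\<nu>)" by (rule FI[OF Ah])
  also have "\<dots> \<le> (\<integral>\<^sup>+L. W * \<kappa>\<^sup>2 * h0 * G (g L) \<partial>\<nu>)"
  proof (rule nn_integral_mono)
    fix L assume L: "L \<in> space \<nu>"
    have "I (A \<inter> hit) L \<le> W * emeasure (N (g L)) (S (g L))" unfolding S_def by (rule up[OF Ah _ L]) auto
    also have "\<dots> \<le> W * (\<kappa>\<^sup>2 * h0 * G (g L))" using NS[OF gV[OF L]] by (rule mult_left_mono) simp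
    finally show "I (A \<inter> hit) L \<le> W * \<kappa>\<^sup>2 * h0 * G (g L)" by (simp add: mult_ac)
  qed
  also have "\<dots> = W * \<kappa>\<^sup>2 * h0 * (\<integral>\<^sup>+L. G (g L) \<partial>\<nu>)"
    by (rule nn_integral_cmult[OF measurable_compose[OF g(1) GmGr]])
  also have "(\<integral>\<^sup>+L. G (g L) \<partial>\<nu>) = (\<integral>\<^sup>+V. G V \<partial>distr \<nu> (Gr m) g)"
    by (rule nn_integral_distr[OF g(1), symmetric]) (simp add: GmGr)
  also have "\<dots> = emeasure (samp m) S'" unfolding g(2) emeasure_samp[OF m S's] G_def ..
  also have "\<dots> = emeasure (distr (samp m) (flats_borel K k) (samp_flat K r)) A"
    unfolding S'_def by (rule emeasure_distr[OF sfm, symmetric]) (use A F in simp)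
  finally have FA: "emeasure F (A \<inter> hit) \<le> W * \<kappa>\<^sup>2 * h0 * emeasure (distr (samp m) (flats_borel K k) (samp_flat K r)) A" .
  have "emeasure F (hit \<inter> A) / C \<le> C * (W * \<kappa>\<^sup>2 * emeasure (distr (samp m) (flats_borel K k) (samp_flat K r)) A) / C"
  proof (rule divide_right_mono_ennreal)
    have "W * \<kappa>\<^sup>2 * h0 * emeasure (distr (samp m) (flats_borel K k) (samp_flat K r)) A =
        h0 * (W * \<kappa>\<^sup>2 * emeasure (distr (samp m) (flats_borel K k) (samp_flat K r)) A)" by (simp add: mult_ac)
    also have "\<dots> \<le> C * (W * \<kappa>\<^sup>2 * emeasure (distr (samp m) (flats_borel K k) (samp_flat K r)) A)"
      using hC by (rule mult_right_mono) simp
    finally show "emeasure F (hit \<inter> A) \<le> C * (W * \<kappa>\<^sup>2 * emeasure (distr (samp m) (flats_borel K k) (samp_flat K r)) A)"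
      using FA by (simp add: Int_commute)
  qed
  also have "\<dots> = W * \<kappa>\<^sup>2 * emeasure (distr (samp m) (flats_borel K k) (samp_flat K r)) A"
    using C by (simp add: mult.commute[of C] mult_divide_eq_ennreal)
  finally show ?thesis using dens[OF A] by (simp add: C_def)
qed

lemma nn_integral_null_space:
  assumes "emeasure M (space M) = 0"
  shows "(\<integral>\<^sup>+x. f x \<partial>M) = 0"
proof -
  have "AE x in M. f x = 0" using assms by (intro AE_I[of _ _ "space M"]) auto
  then have "(\<integral>\<^sup>+x. f x \<partial>M) = (\<integral>\<^sup>+x. 0 \<partial>M)" by (rule nn_integral_cong_AE)
  then show ?thesis by simp
qed

text \<open>The value of \<open>measure_of\<close> is the zero measure unless the given set function is countably additive. So
  if a measure obtained in this way gives some set a non-zero value, it is given by its set function.\<close>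

lemma emeasure_measure_of_nonnull:
  assumes "emeasure (measure_of \<Omega> S \<phi>) B \<noteq> 0" "A \<in> sigma_sets \<Omega> S" "S \<subseteq> Pow \<Omega>"
  shows "emeasure (measure_of \<Omega> S \<phi>) A = \<phi> A"
proof -
  have "measure_space \<Omega> (sigma_sets \<Omega> S) \<phi>"
    using assms(1) unfolding emeasure_measure_of_conv by (auto split: if_splits)
  then show ?thesis using assms(2,3) unfolding emeasure_measure_of_conv by simp
qed

lemma hitting_law_density:
  "hitting_law K k u = density (flats_measure K k :: 'a::euclidean_space set measure)
     (\<lambda>E. indicator (hitting_flats K k u) E / emeasure (flats_measure K k) (hitting_flats K k u :: 'a set set))"
  unfolding hitting_law_def hitting_const_def ..

lemma sets_flats_measure: "sets (flats_measure K k :: 'a::euclidean_space set measure) = sets (flats_borel K k)"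
  unfolding flats_measure_def
  using sets_measure_of[OF sets.space_closed[of "flats_borel K k :: 'a set measure"]]
    sets.sigma_sets_eq[of "flats_borel K k :: 'a set measure"]
  by simp

text \<open>A density with respect to a measure for which the hitting flats are null has total mass \<open>0\<close>, so the
  existence of the normalised law already shows that the normalising constant does not vanish.\<close>

lemma hitting_flats_nonnull:
  assumes K: "K \<le> 0" and u: "u > 0" and p: "prob_space (hitting_law K k u :: 'a::euclidean_space set measure)"
  shows "emeasure (flats_measure K k :: 'a set measure) (hitting_flats K k u) \<noteq> 0"
proof
  let ?F = "flats_measure K k :: 'a set measure"
  assume 0: "emeasure ?F (hitting_flats K k u) = 0"
  have hit: "hitting_flats K k u \<in> sets ?F"
    unfolding sets_flats_measure by (rule sets_hitting_flats[OF K u])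
  then have "AE E in ?F. E \<notin> hitting_flats K k u" using 0 by (intro AE_not_in null_setsI)
  then have "AE E in ?F. indicator (hitting_flats K k u) E / emeasure ?F (hitting_flats K k u) * indicator (space ?F) E = (0::ennreal)"
    by eventually_elim simp
  then have "emeasure (density ?F (\<lambda>E. indicator (hitting_flats K k u) E / emeasure ?F (hitting_flats K k u))) (space ?F)
      = (\<integral>\<^sup>+E. 0 \<partial>?F)"
  proof -
    have "(\<lambda>E. indicator (hitting_flats K k u) E / emeasure ?F (hitting_flats K k u)) \<in> borel_measurable ?F"
      using hit by measurable
    from emeasure_density[OF this sets.top]
    show ?thesis using nn_integral_cong_AE[OF \<open>AE E in ?F. indicator (hitting_flats K k u) E / _ * _ = 0\<close>] by simp
  qed
  then show False
    using prob_space.emeasure_space_1[OF p] unfolding hitting_law_density by simp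
qed

lemma flats_measure_formula:
  assumes K: "K \<le> 0" and u: "u > 0" and p: "prob_space (hitting_law K k u :: 'a::euclidean_space set measure)"
    and A: "A \<in> sets (flats_measure K k :: 'a set measure)"
  shows "emeasure (flats_measure K k) A =
    (if K = 0
        then \<integral>\<^sup>+ L. (\<integral>\<^sup>+ x. indicator A ((\<lambda>y. y + x) ` L) \<partial>subspace_lborel (orthogonal_comp L))
               \<partial>flats0_measure 0 k
        else \<integral>\<^sup>+ L. (\<integral>\<^sup>+ x\<in>L. (indicator A (perp_flat K k L x) *
                            ennreal (cosh (sqrt (- K) * sf_dist K x 0) ^ k))
                      \<partial>hausdorff_measure (space_form K) (sf_dist K) (DIM('a) - k))
               \<partial>flats0_measure K (DIM('a) - k))"
  using hitting_flats_nonnull[OF K u p] unfolding flats_measure_def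
  by (rule emeasure_measure_of_nonnull)
    (use A sets.space_closed[of "flats_borel K k :: 'a set measure"]
        sets.sigma_sets_eq[of "flats_borel K k :: 'a set measure"] in
      \<open>simp_all add: sets_flats_measure\<close>)

subsection \<open>Negative curvature\<close>

text \<open>The distortion of \<open>m\<close>-dimensional Hausdorff measure under translations. The radius is \<open>2 * u\<close> since a
  point of the ball of radius \<open>u\<close> may be translated by a vector of norm up to \<open>u\<close>.\<close>

definition kap :: "real \<Rightarrow> nat \<Rightarrow> real \<Rightarrow> real" where
  "kap K m u = (lip_hi K (2 * u) / lip_lo K (2 * u)) ^ m"

text \<open>The factor \<open>cosh\<close> bounds the density of the measure on flats, and \<open>kap\<close> enters twice because
  each of the two sets compared in \<open>Fubini_comparison\<close> is translated once.\<close>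

definition theta :: "real \<Rightarrow> nat \<Rightarrow> nat \<Rightarrow> real \<Rightarrow> real" where
  "theta K m k u = (if K = 0 then 1 else cosh (sqrt (- K) * u) ^ k * (kap K m u)\<^sup>2)"

text \<open>The kernel is for every \<open>V\<close> the same Hausdorff measure. Its mass on a ball of \<open>V\<close> does not depend on \<open>V\<close>
  because rotations are isometries, and translations distort it by at most \<open>kap\<close>. That Hausdorff
  measure does not vanish and is finite on these balls follows from the law being a probability
  measure.\<close>

lemma law_bound_hyperbolic:
  assumes K: "K < 0" and u: "u > 0" and m: "m \<le> DIM('a::euclidean_space)" and small: "0 < 1 + K * (2 * u)\<^sup>2"
    and p: "prob_space (hitting_law K (DIM('a) - m) u :: 'a set measure)"
    and A: "A \<in> sets (flats_borel K (DIM('a) - m) :: 'a set measure)"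
  shows "emeasure (hitting_law K (DIM('a) - m) u) A \<le> ennreal (theta K m (DIM('a) - m) u) *
    emeasure (distr (samp m) (flats_borel K (DIM('a) - m)) (samp_flat K (rad K u))) A"
proof -
  define X where "X = (space_form K :: 'a set)"
  define d where "d = (sf_dist K :: 'a \<Rightarrow> 'a \<Rightarrow> real)"
  define k where "k = DIM('a) - m"
  define r where "r = rad K u"
  define hi where "hi = lip_hi K (2 * u)"
  define lo where "lo = lip_lo K (2 * u)"
  define h where "h = hausdorff_measure X d m"
  define W where "W = ennreal (cosh (sqrt (- K) * u) ^ k)"
  define \<kappa> where "\<kappa> = ennreal ((hi / lo) ^ m)"
  let ?F = "flats_measure K k :: 'a set measure"
  let ?\<nu> = "flats0_measure K m :: 'a set measure"
  let ?hit = "hitting_flats K k u :: 'a set set"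
  have K0: "K \<le> 0" using K by simp
  have mk: "DIM('a) - k = m" using m by (simp add: k_def)
  have p': "prob_space (hitting_law K k u :: 'a set measure)" using p by (simp add: k_def)
  have r: "0 < r" "r \<le> u" unfolding r_def by (rule rad_bounds[OF K0 u])+
  have hi: "0 < hi" using small by (simp add: hi_def lip_hi_def)
  have "4 * K * (2 * u)\<^sup>2 \<le> 0" using K by (simp add: mult_nonpos_nonneg)
  then have lo: "0 < lo" by (simp add: lo_def lip_lo_def)
  have X: "x \<in> X" if "norm x \<le> 2 * u" for x
  proof -
    have "(norm x)\<^sup>2 \<le> (2 * u)\<^sup>2" using that by (intro power_mono) auto
    then have "K * (2 * u)\<^sup>2 \<le> K * (norm x)\<^sup>2" using K by (intro mult_left_mono_neg) auto
    then show ?thesis using small K unfolding X_def in_space_form_iff[OF K0] by linarith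
  qed
  have Xb: "X \<in> sets borel" by (simp add: X_def)
  have bil: "lo * dist x y \<le> d x y" "d x y \<le> hi * dist x y" if "norm x \<le> 2 * u" "norm y \<le> 2 * u" for x y
    using sf_dist_bilipschitz[OF K small that] by (auto simp: lo_def hi_def d_def)
  have sh: "sets h = sets (restrict_space borel X)" and sph: "space h = X"
    unfolding h_def hausdorff_measure_def
    using sets.space_closed[of "restrict_space borel X"] sets.sigma_sets_eq[of "restrict_space borel X"]
    by (simp_all add: space_restrict_space)
  have shb: "B \<in> sets h \<longleftrightarrow> B \<in> sets borel \<and> B \<subseteq> X" for B
    unfolding sh using Xb by (subst sets_restrict_space_iff) auto
  let ?I = "\<lambda>A L. \<integral>\<^sup>+ x\<in>L. (indicator A (perp_flat K k L x) *
      ennreal (cosh (sqrt (- K) * sf_dist K x 0) ^ k)) \<partial>h"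
  have FI: "emeasure ?F A = (\<integral>\<^sup>+L. ?I A L \<partial>?\<nu>)" if "A \<in> sets ?F" for A
    using flats_measure_formula[OF K0 u p' that] K by (simp add: h_def X_def d_def mk)
  have hitF: "?hit \<in> sets ?F" unfolding sets_flats_measure by (rule sets_hitting_flats[OF K0 u])
  \<comment> \<open>If it vanished, no flat would be counted; so Hausdorff measure is given by its outer measure.\<close>
  have hnon: "emeasure h X \<noteq> 0"
  proof
    assume "emeasure h X = 0"
    then have "?I ?hit L = 0" for L by (intro nn_integral_null_space) (simp add: sph)
    then have "emeasure ?F ?hit = 0" unfolding FI[OF hitF] by simp
    then show False using hitting_flats_nonnull[OF K0 u p'] by simp
  qed
  have hB: "emeasure h B = hausdorff_outer X d m B" if "B \<in> sets borel" "B \<subseteq> X" for B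
    unfolding hausdorff_outer_def using hnon unfolding h_def hausdorff_measure_def
  proof (rule emeasure_measure_of_nonnull)
    show "B \<in> sigma_sets X (sets (restrict_space borel X))"
      using shb[of B] that sh by (intro sigma_sets.Basic) auto
    show "sets (restrict_space borel X) \<subseteq> Pow X"
      using sets.space_closed[of "restrict_space borel X"] by (simp add: space_restrict_space)
  qed
  define N where "N = distr h borel (\<lambda>x. x)"
  have idm: "(\<lambda>x. x) \<in> measurable h borel"
    using measurable_restrict_space1[of "\<lambda>x. x" borel borel X] by (simp add: sh cong: measurable_cong_sets)
  have sN: "sets N = sets borel" by (simp add: N_def)
  have NB: "emeasure N B = hausdorff_outer X d m B" if "B \<in> sets borel" "B \<subseteq> cball 0 (2 * u)" for B
  proof -
    have BX: "B \<subseteq> X" using that(2) X by auto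
    have "emeasure N B = emeasure h (B \<inter> X)" unfolding N_def using emeasure_distr[OF idm that(1)] by (simp add: sph)
    then show ?thesis using hB[OF that(1) BX] BX by (simp add: Int_absorb2)
  qed
  have lip: "hausdorff_outer X d m (f ` B) \<le> ennreal ((b * hi / lo) ^ m) * hausdorff_outer X d m B"
    if b: "0 < b" and f: "\<And>x y. x \<in> B \<Longrightarrow> y \<in> B \<Longrightarrow> dist (f x) (f y) \<le> b * dist x y"
      and B: "B \<subseteq> cball 0 (2 * u)" and fB: "f ` B \<subseteq> cball 0 (2 * u)" for f :: "'a \<Rightarrow> 'a" and b B
  proof -
    have "hausdorff_outer X d m (f ` B) \<le> ennreal (b * hi / lo) ^ m * hausdorff_outer X d m B"
    proof (rule hausdorff_outer_lipschitz)
      show "0 < b * hi / lo" using b hi lo by simp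
      show "f ` B \<subseteq> X" using fB X by auto
      fix x y assume xy: "x \<in> B" "y \<in> B"
      have n: "norm x \<le> 2 * u" "norm y \<le> 2 * u" "norm (f x) \<le> 2 * u" "norm (f y) \<le> 2 * u"
        using xy B fB by auto
      have "d (f x) (f y) \<le> hi * dist (f x) (f y)" by (rule bil(2)[OF n(3,4)])
      also have "\<dots> \<le> hi * (b * dist x y)" using f[OF xy] hi by (intro mult_left_mono) auto
      also have "\<dots> = b * hi / lo * (lo * dist x y)" using lo by simp
      also have "\<dots> \<le> b * hi / lo * d x y" using bil(1)[OF n(1,2)] b hi lo by (intro mult_left_mono) auto
      finally show "d (f x) (f y) \<le> b * hi / lo * d x y" .
    qed
    then show ?thesis using b hi lo by (simp add: ennreal_power)
  qed
  obtain V0 :: "'a set" where V0: "V0 \<in> subspaces m"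
    using prob_space.not_empty[OF prob_space_haar[OF m]] space_haar[OF m] by blast
  define h0 where "h0 = emeasure N (V0 \<inter> cball 0 r)"
  have Vr: "V \<inter> cball 0 c \<in> sets borel" if "V \<in> subspaces m" for V :: "'a set" and c
    using that closed_subspace[of V] by (auto simp: subspaces_def)
  have rsub: "V \<inter> cball 0 r \<subseteq> cball 0 (2 * u)" "V \<inter> cball 0 (2 * r) \<subseteq> cball 0 (2 * u)" for V :: "'a set"
    using r u by auto
  \<comment> \<open>Orthogonal maps are isometries, and they act transitively on subspaces of equal dimension.\<close>
  have rot: "emeasure N (V \<inter> cball 0 r) \<le> emeasure N (V' \<inter> cball 0 r)"
    if V: "V \<in> subspaces m" and V': "V' \<in> subspaces m" for V V' :: "'a set"
  proof -
    obtain R where R: "orthogonal_transformation R" "R ` V' = V"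
      by (rule orthogonal_transformation_subspace_transitive[of V' V]) (use V V' in \<open>simp_all add: subspaces_def\<close>)
    have im: "R ` (V' \<inter> cball 0 r) = V \<inter> cball 0 r"
      using R(2) orthogonal_transformation_norm[OF R(1)] by auto
    have "hausdorff_outer X d m (R ` (V' \<inter> cball 0 r)) \<le> ennreal 1 ^ m * hausdorff_outer X d m (V' \<inter> cball 0 r)"
    proof (rule hausdorff_outer_lipschitz)
      show "R ` (V' \<inter> cball 0 r) \<subseteq> X" unfolding im using rsub(1)[of V] X by auto
      show "d (R x) (R y) \<le> 1 * d x y" for x y
        using orthogonal_transformation_isometry[THEN iffD1, OF R(1)]
        by (simp add: d_def sf_dist_def orthogonal_transformation_inner[OF R(1)] orthogonal_transformation_norm[OF R(1)])
    qed simp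
    then show ?thesis using NB[OF Vr[OF V] rsub(1)] NB[OF Vr[OF V'] rsub(1)] by (simp add: im)
  qed
  have Nh: "emeasure N (V \<inter> cball 0 r) = h0" if "V \<in> subspaces m" for V :: "'a set"
    unfolding h0_def using rot[OF that V0] rot[OF V0 that] by simp
  \<comment> \<open>Doubling is Lipschitz, so finiteness passes from the ball of radius \<open>r\<close> to that of radius \<open>2 * r\<close>.\<close>
  have fin: "emeasure N (V \<inter> cball 0 (2 * r)) \<noteq> \<infinity>" if V: "V \<in> subspaces m" and h0: "h0 \<noteq> \<infinity>" for V :: "'a set"
  proof -
    have sV: "subspace V" using V by (simp add: subspaces_def)
    have im: "(*\<^sub>R) 2 ` (V \<inter> cball 0 r) = V \<inter> cball 0 (2 * r)"
    proof (intro set_eqI iffI)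
      fix y assume y: "y \<in> V \<inter> cball 0 (2 * r)"
      then have "(1 / 2) *\<^sub>R y \<in> V \<inter> cball 0 r" using sV by (auto simp: subspace_scale)
      then show "y \<in> (*\<^sub>R) 2 ` (V \<inter> cball 0 r)" by (intro image_eqI[of _ _ "(1 / 2) *\<^sub>R y"]) auto
    qed (use sV in \<open>auto simp: subspace_scale\<close>)
    have "hausdorff_outer X d m ((*\<^sub>R) 2 ` (V \<inter> cball 0 r)) \<le>
        ennreal ((2 * hi / lo) ^ m) * hausdorff_outer X d m (V \<inter> cball 0 r)"
    proof (rule lip)
      show "dist (2 *\<^sub>R x) (2 *\<^sub>R y) \<le> 2 * dist x y" for x y :: 'a
        by (simp add: dist_norm scaleR_diff_right[symmetric])
      show "(*\<^sub>R) 2 ` (V \<inter> cball 0 r) \<subseteq> cball 0 (2 * u)" unfolding im by (rule rsub(2))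
    qed (use rsub(1) in auto)
    then have "emeasure N (V \<inter> cball 0 (2 * r)) \<le> ennreal ((2 * hi / lo) ^ m) * h0"
      using NB[OF Vr[OF V] rsub(2)] NB[OF Vr[OF V] rsub(1)] Nh[OF V] by (simp add: im)
    also have "\<dots> < \<infinity>" using h0 by (simp add: ennreal_mult_less_top less_top)
    finally show ?thesis by simp
  qed
  have trans: "emeasure N {y. y - v \<in> B} \<le> \<kappa> * emeasure N B" "emeasure N B \<le> \<kappa> * emeasure N {y. y - v \<in> B}"
    if B: "B \<in> sets borel" "B \<subseteq> V \<inter> cball 0 r" and v: "v \<in> V \<inter> cball 0 r" for V B and v :: 'a
  proof -
    let ?B' = "{y. y - v \<in> B}"
    have B': "?B' \<in> sets borel"
      using measurable_sets[of "\<lambda>y. y - v" borel borel B] B by (simp add: vimage_def)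
    have B'u: "?B' \<subseteq> cball 0 (2 * u)"
    proof
      fix y assume "y \<in> ?B'"
      then have "norm (y - v) \<le> r" "norm v \<le> r" using B(2) v by auto
      then show "y \<in> cball 0 (2 * u)" using norm_triangle_ineq[of "y - v" v] r by simp
    qed
    have Bu: "B \<subseteq> cball 0 (2 * u)" using B(2) rsub(1)[of V] by blast
    have im1: "(\<lambda>x. x + v) ` B = ?B'" by (auto simp: image_iff) (metis diff_add_cancel)
    have im2: "(\<lambda>x. x - v) ` ?B' = B" by (auto simp: image_iff) (metis add_diff_cancel)
    have "hausdorff_outer X d m ((\<lambda>x. x + v) ` B) \<le> ennreal ((1 * hi / lo) ^ m) * hausdorff_outer X d m B"
      by (rule lip) (use Bu B'u in \<open>simp_all add: im1\<close>)
    then show "emeasure N ?B' \<le> \<kappa> * emeasure N B"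
      using NB[OF B(1) Bu] NB[OF B' B'u] by (simp add: im1 \<kappa>_def)
    have "hausdorff_outer X d m ((\<lambda>x. x - v) ` ?B') \<le> ennreal ((1 * hi / lo) ^ m) * hausdorff_outer X d m ?B'"
      by (rule lip) (use Bu B'u in \<open>simp_all add: im2 dist_norm\<close>)
    then show "emeasure N B \<le> \<kappa> * emeasure N ?B'"
      using NB[OF B(1) Bu] NB[OF B' B'u] by (simp add: im2 \<kappa>_def)
  qed
  have \<nu>eq: "?\<nu> = distr (haar m) (flats0_borel K m) (model_part K)" by (rule flats0_measure_eq[OF K0 m])
  have mpm: "model_part K \<in> measurable (haar m) (flats0_borel K m :: 'a set measure)"
    using measurable_model_part[OF K0, of m] by (simp add: sets_haar[OF m] cong: measurable_cong_sets)
  have \<nu>: "prob_space ?\<nu>" unfolding \<nu>eq by (rule prob_space.prob_space_distr[OF prob_space_haar[OF m] mpm])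
  have sp\<nu>: "space ?\<nu> = flats0 K m" by (simp add: \<nu>eq)
  have spanm: "span \<in> measurable ?\<nu> (Gr m)"
    using measurable_span_flats0[OF K0, of m] by (simp add: \<nu>eq cong: measurable_cong_sets)
  have spand: "distr ?\<nu> (Gr m) span = haar m"
  proof -
    have "distr ?\<nu> (Gr m) span = distr (haar m) (Gr m) (span \<circ> model_part K)"
      unfolding \<nu>eq by (rule distr_distr[OF measurable_span_flats0[OF K0] mpm])
    also have "\<dots> = distr (haar m) (haar m) (\<lambda>x. x)"
      by (intro distr_cong) (auto simp: sets_haar[OF m] space_haar[OF m] subspaces_def span_model_part[OF _ K0] simp del: dim_span)
    also have "\<dots> = haar m" by (rule distr_id)
    finally show ?thesis .
  qed
  have pf: "perp_flat K k L x = flat_at K (span L) x" if "L \<in> flats0 K m" "x \<in> L" for L :: "'a set" and x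
  proof -
    have V: "subspace (span L)" "dim (span L) = DIM('a) - k" "model_part K (span L) = L"
      using span_flats0[OF K0 that(1)] mk by (auto simp: subspaces_def)
    have "k \<le> DIM('a)" by (simp add: k_def)
    then show ?thesis using perp_flat_eq[OF K V(1) V(2), of x] that(2) V(3) by simp
  qed
  have hitiff: "flat_at K V x \<in> ?hit \<longleftrightarrow> norm x \<le> r" if V: "V \<in> subspaces m" and x: "x \<in> V" "x \<in> X" for V x
  proof -
    have sV: "subspace V" using V by (simp add: subspaces_def)
    have "x \<in> flat_at K V x" using x by (simp add: flat_at_def X_def subspace_0[OF subspace_orthogonal_comp])
    then have "flat_at K V x \<in> flats K k"
      using flat_at_in_flats[OF sV, of K x] V by (auto simp: subspaces_def k_def)
    then show ?thesis
      using flat_at_hits_sf_ball[OF sV K0 u, of x] orth_proj_self[OF sV x(1)] by (simp add: hitting_flats_def r_def)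
  qed
  have wt: "sf_dist K x 0 \<le> u" "0 \<le> sf_dist K x 0" if "x \<in> X" "norm x \<le> r" for x
    using that sf_dist_le_iff[OF K0, of u x] sf_dist_nonneg[OF K0, of x 0] u K0 by (auto simp: X_def r_def)
  have bound: "emeasure (density ?F (\<lambda>E. indicator ?hit E / emeasure ?F ?hit)) A \<le>
    W * \<kappa>\<^sup>2 * emeasure (distr (samp m) (flats_borel K k) (samp_flat K r)) A"
  proof (rule law_bound[OF K0 u m, where N="\<lambda>V. N" and \<nu>="?\<nu>" and g=span and I="?I" and ?h0.0=h0,
        folded k_def r_def])
    show "sets ?F = sets (flats_borel K k)" by (rule sets_flats_measure)
    show "prob_space (density ?F (\<lambda>E. indicator ?hit E / emeasure ?F ?hit))"
      using p' unfolding hitting_law_density .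
    show "A \<in> sets ?F" using A by (simp add: sets_flats_measure k_def)
  next
    fix A L assume A: "A \<in> sets ?F" "A \<subseteq> ?hit" and L: "L \<in> space ?\<nu>"
    let ?V = "span L"
    let ?S = "{x \<in> ?V \<inter> cball 0 r. flat_at K ?V x \<in> A}"
    have L': "L \<in> flats0 K m" using L sp\<nu> by simp
    have V: "?V \<in> subspaces m" and Leq: "model_part K ?V = L" using span_flats0[OF K0 L'] by auto
    have S: "?S \<in> sets borel" unfolding r_def
      by (rule sets_flat_at[OF V m K0 u]) (use A(1) in \<open>simp add: sets_flats_measure k_def\<close>)
    have SX: "?S \<subseteq> X" using X r by auto
    have "?I A L \<le> (\<integral>\<^sup>+x. W * indicator ?S x \<partial>h)"
    proof (rule nn_integral_mono)
      fix x assume "x \<in> space h"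
      then have xX: "x \<in> X" by (simp add: sph)
      show "indicator A (perp_flat K k L x) * ennreal (cosh (sqrt (- K) * sf_dist K x 0) ^ k) * indicator L x
          \<le> W * indicator ?S x"
      proof (cases "x \<in> L \<and> perp_flat K k L x \<in> A")
        case True
        then have xV: "x \<in> ?V" and fl: "flat_at K ?V x \<in> A" using pf[OF L', of x] by (auto intro: span_base)
        then have n: "norm x \<le> r" using hitiff[OF V xV xX] A(2) by blast
        have "cosh (sqrt (- K) * sf_dist K x 0) \<le> cosh (sqrt (- K) * u)"
          using wt[OF xX n] K u by (subst cosh_real_nonneg_le_iff) auto
        then have "ennreal (cosh (sqrt (- K) * sf_dist K x 0) ^ k) \<le> W"
          unfolding W_def by (intro ennreal_leI power_mono) auto
        then show ?thesis using True xV fl n by simp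
      qed (auto simp: indicator_def)
    qed
    also have "\<dots> = W * emeasure h ?S" using S SX by (intro nn_integral_cmult_indicator) (simp add: shb)
    also have "emeasure h ?S = emeasure N ?S"
    proof -
      have "?S \<subseteq> cball 0 (2 * u)" using rsub(1)[of ?V] by blast
      then show ?thesis using hB[OF S SX] NB[OF S] by simp
    qed
    finally show "?I A L \<le> W * emeasure N ?S" .
  next
    fix L assume L: "L \<in> space ?\<nu>"
    let ?V = "span L"
    have L': "L \<in> flats0 K m" using L sp\<nu> by simp
    have V: "?V \<in> subspaces m" and Leq: "model_part K ?V = L" using span_flats0[OF K0 L'] by auto
    let ?D = "?V \<inter> cball 0 r"
    have DX: "?D \<subseteq> X" using X r by auto
    have "h0 = emeasure N ?D" by (rule Nh[OF V, symmetric])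
    also have "\<dots> = emeasure h ?D" using hB[OF Vr[OF V] DX] NB[OF Vr[OF V] rsub(1)] by simp
    also have "\<dots> = (\<integral>\<^sup>+x. indicator ?D x \<partial>h)" using Vr[OF V] DX by (subst nn_integral_indicator) (simp_all add: shb)
    also have "\<dots> \<le> ?I ?hit L"
    proof (rule nn_integral_mono)
      fix x assume "x \<in> space h"
      show "indicator ?D x \<le> indicator ?hit (perp_flat K k L x) * ennreal (cosh (sqrt (- K) * sf_dist K x 0) ^ k) * indicator L x"
      proof (cases "x \<in> ?D")
        case True
        then have xV: "x \<in> ?V" and xX: "x \<in> X" and n: "norm x \<le> r" using DX by auto
        have xL: "x \<in> L" using Leq xV xX by (auto simp: model_part_def X_def)
        have "perp_flat K k L x \<in> ?hit" using hitiff[OF V xV xX] n pf[OF L' xL] by simp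
        moreover have "1 \<le> ennreal (cosh (sqrt (- K) * sf_dist K x 0) ^ k)"
          by (simp add: cosh_real_ge_1 one_le_power)
        ultimately show ?thesis using True xL by simp
      qed simp
    qed
    finally show "h0 \<le> ?I ?hit L" .
  qed (use \<nu> spanm spand FI sN Nh fin trans in \<open>simp_all\<close>)
  have th: "W * \<kappa>\<^sup>2 = ennreal (theta K m k u)"
    using K hi lo unfolding W_def \<kappa>_def theta_def kap_def hi_def[symmetric] lo_def[symmetric]
    by (simp add: ennreal_power ennreal_mult[symmetric])
  show ?thesis using bound unfolding th hitting_law_density k_def r_def .
qed

subsection \<open>Curvature zero\<close>

lemma PiM_lborel_shift:
  fixes c :: "'i \<Rightarrow> real"
  assumes I: "finite I"
  shows "distr (\<Pi>\<^sub>M i\<in>I. lborel) (\<Pi>\<^sub>M i\<in>I. lborel) (\<lambda>f. \<lambda>i\<in>I. f i + c i) = (\<Pi>\<^sub>M i\<in>I. (lborel :: real measure))"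
proof -
  interpret product_sigma_finite "\<lambda>_::'i. lborel :: real measure" ..
  let ?P = "\<Pi>\<^sub>M i\<in>I. (lborel :: real measure)"
  have m: "(\<lambda>f. \<lambda>i\<in>I. f i + c i) \<in> measurable ?P ?P" by measurable
  show ?thesis
  proof (rule PiM_eqI[OF I])
    fix A :: "'i \<Rightarrow> real set" assume A: "\<And>i. i \<in> I \<Longrightarrow> A i \<in> sets lborel"
    have sh: "{x. x - - c i \<in> A i} \<in> sets lborel" if "i \<in> I" for i
      using measurable_sets[of "\<lambda>x. x - - c i" borel borel "A i"] A[OF that] by (simp add: vimage_def)
    have "emeasure (distr ?P ?P (\<lambda>f. \<lambda>i\<in>I. f i + c i)) (Pi\<^sub>E I A) =
        emeasure ?P ((\<lambda>f. \<lambda>i\<in>I. f i + c i) -` Pi\<^sub>E I A \<inter> space ?P)"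
      using A I by (intro emeasure_distr[OF m]) (auto intro: sets_PiM_I_finite)
    also have "(\<lambda>f. \<lambda>i\<in>I. f i + c i) -` Pi\<^sub>E I A \<inter> space ?P = Pi\<^sub>E I (\<lambda>i. {x. x - - c i \<in> A i})"
      by (auto simp: space_PiM PiE_iff extensional_def)
    also have "emeasure ?P (Pi\<^sub>E I (\<lambda>i. {x. x - - c i \<in> A i})) = (\<Prod>i\<in>I. emeasure lborel {x. x - - c i \<in> A i})"
      using sh by (intro emeasure_PiM I) auto
    also have "\<dots> = (\<Prod>i\<in>I. emeasure lborel (A i))"
      using A emeasure_lborel_shift[of _ "- c _"] by (intro prod.cong refl) simp
    finally show "emeasure (distr ?P ?P (\<lambda>f. \<lambda>i\<in>I. f i + c i)) (Pi\<^sub>E I A) = (\<Prod>i\<in>I. emeasure lborel (A i))" .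
  qed simp
qed

text \<open>In orthonormal coordinates these are properties of product Lebesgue measure.\<close>

lemma subspace_lborel:
  fixes V :: "'a::euclidean_space set"
  assumes V: "subspace V"
  shows "sets (subspace_lborel V) = sets borel"
    and "AE x in subspace_lborel V. x \<in> V"
    and "R > 0 \<Longrightarrow> emeasure (subspace_lborel V) (V \<inter> cball 0 R) = ennreal (unit_ball_vol (real (dim V)) * R ^ dim V)"
    and "A \<in> sets borel \<Longrightarrow> v \<in> V \<Longrightarrow> emeasure (subspace_lborel V) {y. y - v \<in> A} = emeasure (subspace_lborel V) A"
proof -
  define B where "B = (SOME B. pairwise orthogonal B \<and> (\<forall>b\<in>B. norm b = 1) \<and> span B = V)"
  obtain B0 where "pairwise orthogonal B0" "\<And>x. x \<in> B0 \<Longrightarrow> norm x = 1" "span B0 = V"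
    using orthonormal_basis_subspace[OF V] by metis
  then have "\<exists>B. pairwise orthogonal B \<and> (\<forall>b\<in>B. norm b = 1) \<and> span B = V" by blast
  from someI_ex[OF this] have B: "pairwise orthogonal B" "\<And>b. b \<in> B \<Longrightarrow> norm b = 1" "span B = V"
    unfolding B_def by blast+
  have "0 \<notin> B" using B(2) by force
  then have ind: "independent B" using B(1) by (intro pairwise_orthogonal_independent) auto
  then have fB: "finite B" by (rule independent_imp_finite)
  have "span V = V" using V by (simp add: span_eq_iff)
  then have "span B = span V" by (simp only: B(3))
  from dim_eq_card[OF this ind] have cB: "card B = dim V" ..
  let ?P = "\<Pi>\<^sub>M b\<in>B. (lborel :: real measure)"
  define \<phi> where "\<phi> f = (\<Sum>b\<in>B. f b *\<^sub>R b)" for f :: "'a \<Rightarrow> real"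
  have sl: "subspace_lborel V = distr ?P borel \<phi>"
    unfolding subspace_lborel_def B_def[symmetric] \<phi>_def[abs_def] Let_def ..
  have \<phi>m: "\<phi> \<in> measurable ?P borel"
    unfolding \<phi>_def[abs_def] by (intro borel_measurable_sum borel_measurable_scaleR) simp_all
  show s: "sets (subspace_lborel V) = sets borel" by (simp add: sl)
  have \<phi>V: "\<phi> f \<in> V" for f
    unfolding \<phi>_def using V B(3) by (intro subspace_sum subspace_scale) (auto intro: span_base)
  have cV: "V \<in> sets borel" using closed_subspace[OF V] by auto
  show "AE x in subspace_lborel V. x \<in> V"
    unfolding sl using cV \<phi>V by (subst AE_distr_iff[OF \<phi>m]) auto
  have on: "b \<bullet> c = (if b = c then 1 else 0)" if "b \<in> B" "c \<in> B" for b c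
    using B(1,2) that by (auto simp: pairwise_def orthogonal_def norm_eq_1)
  have coord: "\<phi> f \<bullet> c = f c" if c: "c \<in> B" for f c
  proof -
    have "\<phi> f \<bullet> c = (\<Sum>b\<in>B. f b * (b \<bullet> c))" by (simp add: \<phi>_def inner_sum_left)
    also have "\<dots> = (\<Sum>b\<in>B. if b = c then f c else 0)" using on c by (intro sum.cong refl) auto
    finally show ?thesis using c fB by simp
  qed
  have norm\<phi>: "norm (\<phi> f) = sqrt (\<Sum>b\<in>B. (f b)\<^sup>2)" for f
  proof -
    have "\<phi> f \<bullet> \<phi> f = (\<Sum>b\<in>B. f b * (\<phi> f \<bullet> b))" by (subst (2) \<phi>_def) (simp add: inner_sum_right)
    also have "\<dots> = (\<Sum>b\<in>B. (f b)\<^sup>2)" using coord by (intro sum.cong refl) (simp add: power2_eq_square)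
    finally show ?thesis by (simp add: norm_eq_sqrt_inner)
  qed
  show "emeasure (subspace_lborel V) (V \<inter> cball 0 R) = ennreal (unit_ball_vol (real (dim V)) * R ^ dim V)" if R: "R > 0"
  proof -
    have "emeasure (subspace_lborel V) (V \<inter> cball 0 R) = emeasure ?P (\<phi> -` (V \<inter> cball 0 R) \<inter> space ?P)"
      unfolding sl using cV by (intro emeasure_distr[OF \<phi>m]) auto
    also have "\<phi> -` (V \<inter> cball 0 R) \<inter> space ?P = {f. sqrt (\<Sum>b\<in>B. (f b)\<^sup>2) \<le> R} \<inter> space ?P"
      using \<phi>V by (auto simp: norm\<phi>)
    also have "emeasure ?P \<dots> = ennreal (unit_ball_vol (real (card B)) * R ^ card B)"
      by (rule emeasure_cball_aux[OF fB R])
    finally show ?thesis by (simp add: cB)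
  qed
  show "emeasure (subspace_lborel V) {y. y - v \<in> A} = emeasure (subspace_lborel V) A"
    if A: "A \<in> sets borel" and v: "v \<in> V"
  proof -
    let ?s = "\<lambda>f. \<lambda>b\<in>B. f b + - (v \<bullet> b)"
    have ve: "(\<Sum>b\<in>B. (v \<bullet> b) *\<^sub>R b) = v"
    proof -
      obtain c where c: "v = \<phi> c" using v B(3) span_finite[OF fB] unfolding \<phi>_def by blast
      have "(\<Sum>b\<in>B. (v \<bullet> b) *\<^sub>R b) = (\<Sum>b\<in>B. c b *\<^sub>R b)"
        unfolding c by (intro sum.cong refl) (simp add: coord)
      then show ?thesis by (simp add: c \<phi>_def)
    qed
    have sm: "?s \<in> measurable ?P ?P" by measurable
    have \<phi>s: "\<phi> (?s f) = \<phi> f - v" for f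
      by (simp add: \<phi>_def scaleR_diff_left sum_subtractf ve)
    have A': "{y. y - v \<in> A} \<in> sets borel"
      using measurable_sets[of "\<lambda>y. y - v" borel borel A] A by (simp add: vimage_def)
    have "emeasure (subspace_lborel V) A = emeasure (distr (distr ?P ?P ?s) borel \<phi>) A"
      unfolding PiM_lborel_shift[OF fB] sl ..
    also have "\<dots> = emeasure (distr ?P borel (\<phi> \<circ> ?s)) A" by (simp only: distr_distr[OF \<phi>m sm])
    also have "\<dots> = emeasure ?P ((\<phi> \<circ> ?s) -` A \<inter> space ?P)"
      by (rule emeasure_distr[OF measurable_comp[OF sm \<phi>m] A])
    also have "(\<phi> \<circ> ?s) -` A \<inter> space ?P = \<phi> -` {y. y - v \<in> A} \<inter> space ?P" unfolding vimage_def comp_def \<phi>s by auto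
    also have "emeasure ?P \<dots> = emeasure (subspace_lborel V) {y. y - v \<in> A}"
      unfolding sl by (rule emeasure_distr[OF \<phi>m A', symmetric])
    finally show ?thesis by simp
  qed
qed

text \<open>The kernel is Lebesgue measure on \<open>V\<close>, the orthogonal complement of the direction of the flat. It is
  exactly invariant, so that all constants are \<open>1\<close>; complements of \<open>haar\<close>-distributed subspaces are
  \<open>haar\<close>-distributed.\<close>

lemma law_bound_euclidean:
  assumes u: "u > 0" and m: "m \<le> DIM('a::euclidean_space)"
    and p: "prob_space (hitting_law 0 (DIM('a) - m) u :: 'a set measure)"
    and A: "A \<in> sets (flats_borel 0 (DIM('a) - m) :: 'a set measure)"
  shows "emeasure (hitting_law 0 (DIM('a) - m) u) A \<le> ennreal (theta 0 m (DIM('a) - m) u) *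
    emeasure (distr (samp m) (flats_borel 0 (DIM('a) - m)) (samp_flat 0 (rad 0 u))) A"
proof -
  define k where "k = DIM('a) - m"
  have mk: "DIM('a) - k = m" and k: "k \<le> DIM('a)" using m by (simp_all add: k_def)
  define r where "r = rad 0 u"
  have r: "0 < r" using u by (simp add: r_def rad_def)
  let ?F = "flats_measure 0 k :: 'a set measure"
  let ?\<nu> = "flats0_measure 0 k :: 'a set measure"
  let ?hit = "hitting_flats 0 k u :: 'a set set"
  let ?g = "\<lambda>L. (span L)\<^sup>\<bottom> :: 'a set"
  let ?I = "\<lambda>A L. \<integral>\<^sup>+ x. indicator A ((\<lambda>y. y + x) ` L) \<partial>subspace_lborel (orthogonal_comp L)"
  have p': "prob_space (hitting_law 0 k u :: 'a set measure)" using p by (simp add: k_def)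
  have FI: "emeasure ?F A = (\<integral>\<^sup>+L. ?I A L \<partial>?\<nu>)" if "A \<in> sets ?F" for A
    using flats_measure_formula[OF order_refl u p' that] by simp
  have \<nu>eq: "?\<nu> = distr (haar k) (flats0_borel 0 k) (model_part 0)" by (rule flats0_measure_eq[OF order_refl k])
  have mpm: "model_part 0 \<in> measurable (haar k) (flats0_borel 0 k :: 'a set measure)"
    using measurable_model_part[OF order_refl, of k] by (simp add: sets_haar[OF k] cong: measurable_cong_sets)
  have \<nu>: "prob_space ?\<nu>" unfolding \<nu>eq by (rule prob_space.prob_space_distr[OF prob_space_haar[OF k] mpm])
  have sp\<nu>: "space ?\<nu> = flats0 0 k" by (simp add: \<nu>eq)
  have gm0: "?g \<in> measurable (flats0_borel 0 k) (Gr m)"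
  proof -
    have "orthogonal_comp \<in> measurable (Gr k) (Gr (DIM('a) - k) :: 'a set measure)" by (rule measurable_perp)
    then have "orthogonal_comp \<in> measurable (Gr k) (Gr m :: 'a set measure)" by (simp only: mk)
    then show ?thesis by (rule measurable_compose[OF measurable_span_flats0[OF order_refl]])
  qed
  have gm: "?g \<in> measurable ?\<nu> (Gr m)" using gm0 by (simp add: \<nu>eq cong: measurable_cong_sets)
  have gd: "distr ?\<nu> (Gr m) ?g = haar m"
  proof -
    have "distr ?\<nu> (Gr m) ?g = distr (haar k) (Gr m) (?g \<circ> model_part 0)"
      unfolding \<nu>eq by (rule distr_distr[OF gm0 mpm])
    also have "\<dots> = distr (haar k) (Gr (DIM('a) - k)) orthogonal_comp"
      by (intro distr_cong) (auto simp: mk space_haar[OF k] subspaces_def span_model_part)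
    also have "\<dots> = haar m" using haar_perp[OF k] mk by simp
    finally show ?thesis .
  qed
  have Lfacts: "?g L \<in> subspaces m" "subspace (?g L)" "orthogonal_comp L = ?g L" "(?g L)\<^sup>\<bottom> = L" if L: "L \<in> flats0 0 k" for L
  proof -
    have *: "span L \<in> subspaces k" "span L = L" using span_flats0[OF order_refl L] by (auto simp: model_part_def)
    show "?g L \<in> subspaces m" using perp_subspaces[OF *(1)] mk by simp
    then show "subspace (?g L)" by (simp add: subspaces_def)
    show "orthogonal_comp L = ?g L" by (simp only: *(2))
    show "(?g L)\<^sup>\<bottom> = L" using perp_perp[OF subspace_span, of L] by (simp only: *(2))
  qed
  have fl: "(\<lambda>y. y + x) ` L = flat_at 0 (?g L) x" if L: "L \<in> flats0 0 k" for L x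
    by (auto simp: flat_at_eq_affine Lfacts(4)[OF L] add.commute)
  have hitiff: "flat_at 0 V x \<in> ?hit \<longleftrightarrow> norm x \<le> r" if V: "V \<in> subspaces m" and x: "x \<in> V" for V x
  proof -
    have sV: "subspace V" using V by (simp add: subspaces_def)
    have "x \<in> flat_at 0 V x" by (simp add: flat_at_def subspace_0[OF subspace_orthogonal_comp])
    then have "flat_at 0 V x \<in> flats 0 k"
      using flat_at_in_flats[OF sV, of 0 x] V by (auto simp: subspaces_def k_def)
    then show ?thesis
      using flat_at_hits_sf_ball[OF sV order_refl u, of x] orth_proj_self[OF sV x] by (simp add: hitting_flats_def r_def)
  qed
  define h0 where "h0 = ennreal (unit_ball_vol (real m) * r ^ m)"
  have bound: "emeasure (density ?F (\<lambda>E. indicator ?hit E / emeasure ?F ?hit)) A \<le>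
    1 * 1\<^sup>2 * emeasure (distr (samp m) (flats_borel 0 k) (samp_flat 0 r)) A"
  proof (rule law_bound[OF order_refl u m, where N=subspace_lborel and \<nu>="?\<nu>" and g="?g" and I="?I" and ?h0.0=h0,
        folded k_def r_def])
    show "sets ?F = sets (flats_borel 0 k)" by (rule sets_flats_measure)
    show "prob_space (density ?F (\<lambda>E. indicator ?hit E / emeasure ?F ?hit))"
      using p' unfolding hitting_law_density .
    show "A \<in> sets ?F" using A by (simp add: sets_flats_measure k_def)
  next
    fix A L assume A: "A \<in> sets ?F" "A \<subseteq> ?hit" and L: "L \<in> space ?\<nu>"
    then have L': "L \<in> flats0 0 k" using sp\<nu> by simp
    note Lf = Lfacts[OF L']
    let ?S = "{x \<in> ?g L \<inter> cball 0 r. flat_at 0 (?g L) x \<in> A}"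
    have S: "?S \<in> sets borel" unfolding r_def
      by (rule sets_flat_at[OF Lf(1) m order_refl u]) (use A(1) in \<open>simp add: sets_flats_measure k_def\<close>)
    have "?I A L = (\<integral>\<^sup>+x. indicator ?S x \<partial>subspace_lborel (?g L))"
      unfolding Lf(3)
    proof (rule nn_integral_cong_AE, use subspace_lborel(2)[OF Lf(2)] in eventually_elim)
      case (elim x)
      show "indicator A ((\<lambda>y. y + x) ` L) = (indicator ?S x :: ennreal)"
        using elim hitiff[OF Lf(1) elim] A(2) by (auto simp: fl[OF L'] indicator_def)
    qed
    also have "\<dots> = emeasure (subspace_lborel (?g L)) ?S"
      using S by (intro nn_integral_indicator) (simp add: subspace_lborel(1)[OF Lf(2)])
    finally show "?I A L \<le> 1 * emeasure (subspace_lborel (?g L)) ?S" by simp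
  next
    fix L assume L: "L \<in> space ?\<nu>"
    then have L': "L \<in> flats0 0 k" using sp\<nu> by simp
    note Lf = Lfacts[OF L']
    let ?D = "?g L \<inter> cball 0 r"
    have D: "?D \<in> sets borel" using closed_subspace[OF Lf(2)] by auto
    have "h0 = emeasure (subspace_lborel (?g L)) ?D"
      using subspace_lborel(3)[OF Lf(2) r] Lf(1) by (simp add: h0_def subspaces_def)
    also have "\<dots> = (\<integral>\<^sup>+x. indicator ?D x \<partial>subspace_lborel (?g L))"
      using D by (intro nn_integral_indicator[symmetric]) (simp add: subspace_lborel(1)[OF Lf(2)])
    also have "\<dots> \<le> ?I ?hit L"
      unfolding Lf(3)
    proof (rule nn_integral_mono)
      fix x
      show "indicator ?D x \<le> (indicator ?hit ((\<lambda>y. y + x) ` L) :: ennreal)"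
        using hitiff[OF Lf(1), of x] by (auto simp: fl[OF L'] indicator_def)
    qed
    finally show "h0 \<le> ?I ?hit L" .
  next
    fix V :: "'a set" assume V: "V \<in> subspaces m"
    then have sV: "subspace V" by (simp add: subspaces_def)
    show "emeasure (subspace_lborel V) (V \<inter> cball 0 r) = h0"
      using subspace_lborel(3)[OF sV r] V by (simp add: h0_def subspaces_def)
    show "emeasure (subspace_lborel V) (V \<inter> cball 0 (2 * r)) \<noteq> \<infinity>"
      using subspace_lborel(3)[OF sV, of "2 * r"] r by simp
    show "sets (subspace_lborel V) = sets borel" by (rule subspace_lborel(1)[OF sV])
    fix A :: "'a set" and v assume A: "A \<in> sets borel" and v: "v \<in> V \<inter> cball 0 r"
    show "emeasure (subspace_lborel V) {y. y - v \<in> A} \<le> 1 * emeasure (subspace_lborel V) A"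
      "emeasure (subspace_lborel V) A \<le> 1 * emeasure (subspace_lborel V) {y. y - v \<in> A}"
      using subspace_lborel(4)[OF sV A] v by simp_all
  qed (use \<nu> gm gd FI in \<open>simp_all\<close>)
  show ?thesis using bound unfolding hitting_law_density k_def r_def theta_def by simp
qed

section \<open>The limit of vanishing curvature\<close>

subsection \<open>Pointwise convergence of the distance\<close>

definition samp_dist :: "real \<Rightarrow> real \<Rightarrow> ('a::euclidean_space set \<times> 'a) \<times> 'a set \<Rightarrow> ennreal" where
  "samp_dist u K p = sf_setdist K (samp_flat K (rad K u) (fst p) \<inter> model_part K (snd p))"

text \<open>Scaling by \<open>rad K u\<close> carries one fixed affine subspace \<open>F\<close> to the intersection for curvature \<open>K\<close>, as far
  as it lies in the model. So one point of \<open>F\<close>, the nearest to the origin, yields the distance for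
  all \<open>K\<close> for which its multiple lies in the model.\<close>

lemma samp_dist_cases:
  fixes V L :: "'a::euclidean_space set" and u :: real and z :: 'a
  assumes V: "subspace V" and L: "subspace L" and u: "u > 0"
  defines "w \<equiv> samp_point 1 (V, z)"
  defines "F \<equiv> {y \<in> L. y - w \<in> V\<^sup>\<bottom>}"
  shows "F = {} \<Longrightarrow> K \<le> 0 \<Longrightarrow> samp_dist u K ((V, z), L) = \<top>"
    and "F \<noteq> {} \<Longrightarrow> \<exists>p0 :: 'a. \<forall>K\<le>0. rad K u *\<^sub>R p0 \<in> space_form K \<longrightarrow>
      samp_dist u K ((V, z), L) = ennreal (sf_dist K 0 (rad K u *\<^sub>R p0))"
proof -
  have pt: "samp_point r (V, z) = r *\<^sub>R w" for r by (simp add: w_def samp_point_def)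
  have mem: "y \<in> samp_flat K (rad K u) (V, z) \<inter> model_part K L \<longleftrightarrow> y \<in> space_form K \<and> (1 / rad K u) *\<^sub>R y \<in> F"
    if K: "K \<le> 0" for K y
  proof -
    have r: "0 < rad K u" by (rule rad_bounds(1)[OF K u])
    have "y \<in> L \<longleftrightarrow> (1 / rad K u) *\<^sub>R y \<in> L"
      using subspace_scale[OF L, of "(1 / rad K u) *\<^sub>R y" "rad K u"] subspace_scale[OF L, of y] r by auto
    moreover have "y - rad K u *\<^sub>R w \<in> V\<^sup>\<bottom> \<longleftrightarrow> (1 / rad K u) *\<^sub>R y - w \<in> V\<^sup>\<bottom>"
    proof -
      have e: "rad K u *\<^sub>R ((1 / rad K u) *\<^sub>R y - w) = y - rad K u *\<^sub>R w" using r by (simp add: scaleR_diff_right)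
      have e': "(1 / rad K u) *\<^sub>R (y - rad K u *\<^sub>R w) = (1 / rad K u) *\<^sub>R y - w" using r by (simp add: scaleR_diff_right)
      show ?thesis
        using subspace_scale[OF subspace_orthogonal_comp, of "(1 / rad K u) *\<^sub>R y - w" V "rad K u"]
          subspace_scale[OF subspace_orthogonal_comp, of "y - rad K u *\<^sub>R w" V "1 / rad K u"]
        unfolding e e' by blast
    qed
    ultimately show ?thesis by (auto simp: samp_flat_def flat_at_def model_part_def F_def pt)
  qed
  show "samp_dist u K ((V, z), L) = \<top>" if "F = {}" "K \<le> 0"
  proof -
    have "samp_flat K (rad K u) (V, z) \<inter> model_part K L = {}" using mem[OF that(2)] that(1) by blast
    then show ?thesis by (simp add: samp_dist_def sf_setdist_eq_top_iff)
  qed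
  assume ne: "F \<noteq> {}"
  have "closed F"
  proof -
    have "F = L \<inter> (\<lambda>y. y - w) -` (V\<^sup>\<bottom>)" by (auto simp: F_def)
    moreover have "closed ((\<lambda>y. y - w) -` (V\<^sup>\<bottom>))"
      by (intro closed_vimage closed_subspace subspace_orthogonal_comp continuous_intros)
    ultimately show ?thesis using closed_subspace[OF L] by auto
  qed
  then obtain p0 where p0: "p0 \<in> F" "\<And>y. y \<in> F \<Longrightarrow> dist 0 p0 \<le> dist 0 y"
    using distance_attains_inf[OF _ ne, of 0] by metis
  show "\<exists>p0 :: 'a. \<forall>K\<le>0. rad K u *\<^sub>R p0 \<in> space_form K \<longrightarrow>
      samp_dist u K ((V, z), L) = ennreal (sf_dist K 0 (rad K u *\<^sub>R p0))"
  proof (intro exI[of _ p0] allI impI)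
    fix K assume K: "K \<le> 0" and X: "rad K u *\<^sub>R p0 \<in> space_form K"
    have r: "0 < rad K u" by (rule rad_bounds(1)[OF K u])
    show "samp_dist u K ((V, z), L) = ennreal (sf_dist K 0 (rad K u *\<^sub>R p0))"
      unfolding samp_dist_def sf_setdist_def fst_conv snd_conv
    proof (rule antisym)
      have "rad K u *\<^sub>R p0 \<in> samp_flat K (rad K u) (V, z) \<inter> model_part K L"
        using p0(1) X r by (subst mem[OF K]) simp
      then show "(INF x\<in>samp_flat K (rad K u) (V, z) \<inter> model_part K L. ennreal (sf_dist K 0 x))
          \<le> ennreal (sf_dist K 0 (rad K u *\<^sub>R p0))" by (rule INF_lower)
      show "ennreal (sf_dist K 0 (rad K u *\<^sub>R p0)) \<le>
          (INF x\<in>samp_flat K (rad K u) (V, z) \<inter> model_part K L. ennreal (sf_dist K 0 x))"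
      proof (rule INF_greatest)
        fix y assume "y \<in> samp_flat K (rad K u) (V, z) \<inter> model_part K L"
        then have y: "y \<in> space_form K" "(1 / rad K u) *\<^sub>R y \<in> F" by (simp_all only: mem[OF K])
        have "norm p0 \<le> norm y / rad K u" using p0(2)[OF y(2)] r by simp
        then have "norm (rad K u *\<^sub>R p0) \<le> norm y" using r by (simp add: le_divide_eq mult.commute)
        then show "ennreal (sf_dist K 0 (rad K u *\<^sub>R p0)) \<le> ennreal (sf_dist K 0 y)"
          by (intro ennreal_leI sf_dist_mono[OF K y(1)])
      qed
    qed
  qed
qed

lemma sf_dist_rad_tendsto:
  fixes p0 :: "'a::euclidean_space"
  assumes u: "u > 0"
  shows "((\<lambda>K. sf_dist K 0 (rad K u *\<^sub>R p0)) \<longlongrightarrow> u * norm p0) (at_left 0)"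
    and "\<forall>\<^sub>F K in at_left 0. rad K u *\<^sub>R p0 \<in> space_form K"
proof -
  define s where "s = u * norm p0"
  have neg: "\<forall>\<^sub>F K in at_left (0::real). K < 0" by (rule eventually_at_leftI[of "-1"]) auto
  have nb: "norm (rad K u *\<^sub>R p0) \<le> s" if "K < 0" for K
    using rad_bounds(1,2)[of K u] u that by (simp add: s_def mult_right_mono)
  have small: "\<forall>\<^sub>F K in at_left 0. 0 < 1 + K * s\<^sup>2" by (rule lip_hi_pos_eventually)
  show "\<forall>\<^sub>F K in at_left 0. rad K u *\<^sub>R p0 \<in> space_form K"
    using small neg
  proof eventually_elim
    case (elim K)
    have "(norm (rad K u *\<^sub>R p0))\<^sup>2 \<le> s\<^sup>2" using nb[OF elim(2)] by (intro power_mono) auto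
    then have "K * s\<^sup>2 \<le> K * (norm (rad K u *\<^sub>R p0))\<^sup>2" using elim by (intro mult_left_mono_neg) auto
    then show ?case using elim(1) unfolding in_space_form_iff[OF less_imp_le[OF elim(2)]] by linarith
  qed
  have s0: "0 \<le> s" using u by (simp add: s_def)
  have low: "\<forall>\<^sub>F K in at_left 0. lip_lo K s * (rad K u * norm p0) \<le> sf_dist K 0 (rad K u *\<^sub>R p0)"
    using small neg
  proof eventually_elim
    case (elim K)
    then show ?case
      using sf_dist_bilipschitz(1)[OF elim(2,1), of 0 "rad K u *\<^sub>R p0"] nb[OF elim(2)] s0 rad_bounds(1)[of K u] u by simp
  qed
  have high: "\<forall>\<^sub>F K in at_left 0. sf_dist K 0 (rad K u *\<^sub>R p0) \<le> lip_hi K s * (rad K u * norm p0)"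
    using small neg
  proof eventually_elim
    case (elim K)
    then show ?case
      using sf_dist_bilipschitz(2)[OF elim(2,1), of 0 "rad K u *\<^sub>R p0"] nb[OF elim(2)] s0 rad_bounds(1)[of K u] u by simp
  qed
  have "((\<lambda>K. lip_lo K s * (rad K u * norm p0)) \<longlongrightarrow> 1 * (u * norm p0)) (at_left 0)"
    "((\<lambda>K. lip_hi K s * (rad K u * norm p0)) \<longlongrightarrow> 1 * (u * norm p0)) (at_left 0)"
    by (intro tendsto_mult lip_lo_tendsto lip_hi_tendsto rad_tendsto tendsto_const)+
  then show "((\<lambda>K. sf_dist K 0 (rad K u *\<^sub>R p0)) \<longlongrightarrow> u * norm p0) (at_left 0)"
    using tendsto_sandwich[OF low high] by simp
qed

lemma samp_dist_tendsto:
  fixes V L :: "'a::euclidean_space set" and u :: real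
  assumes V: "subspace V" and L: "subspace L" and u: "u > 0"
  shows "((\<lambda>K. samp_dist u K ((V, z), L)) \<longlongrightarrow> samp_dist u 0 ((V, z), L)) (at_left 0)"
    and "\<forall>\<^sub>F K in at_left 0. samp_dist u K ((V, z), L) = \<top> \<longleftrightarrow> samp_dist u 0 ((V, z), L) = \<top>"
proof -
  define F where "F = {y \<in> L. y - samp_point 1 (V, z) \<in> V\<^sup>\<bottom>}"
  have neg: "\<forall>\<^sub>F K in at_left (0::real). K < 0" by (rule eventually_at_leftI[of "-1"]) auto
  note cases = samp_dist_cases[OF V L u, of z, folded F_def]
  have "((\<lambda>K. samp_dist u K ((V, z), L)) \<longlongrightarrow> samp_dist u 0 ((V, z), L)) (at_left 0) \<and>
    (\<forall>\<^sub>F K in at_left 0. samp_dist u K ((V, z), L) = \<top> \<longleftrightarrow> samp_dist u 0 ((V, z), L) = \<top>)"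
  proof (cases "F = {}")
    case True
    have 0: "samp_dist u 0 ((V, z), L) = \<top>" by (rule cases(1)[OF True]) simp
    have ev: "\<forall>\<^sub>F K in at_left 0. samp_dist u K ((V, z), L) = \<top>"
      using neg by eventually_elim (rule cases(1)[OF True], simp)
    then have "((\<lambda>K. samp_dist u K ((V, z), L)) \<longlongrightarrow> \<top>) (at_left 0)" by (rule tendsto_eventually)
    then show ?thesis using ev 0 by simp
  next
    case False
    obtain p0 :: 'a where p0: "\<And>K. K \<le> 0 \<Longrightarrow> rad K u *\<^sub>R p0 \<in> space_form K \<Longrightarrow>
      samp_dist u K ((V, z), L) = ennreal (sf_dist K 0 (rad K u *\<^sub>R p0))"
      using cases(2)[OF False] by blast
    have 0: "samp_dist u 0 ((V, z), L) = ennreal (u * norm p0)"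
      using p0[of 0] u by (simp add: sf_dist_def rad_def)
    have ev: "\<forall>\<^sub>F K in at_left 0. ennreal (sf_dist K 0 (rad K u *\<^sub>R p0)) = samp_dist u K ((V, z), L)"
      using neg sf_dist_rad_tendsto(2)[OF u, of p0] by eventually_elim (simp add: p0)
    have "((\<lambda>K. ennreal (sf_dist K 0 (rad K u *\<^sub>R p0))) \<longlongrightarrow> ennreal (u * norm p0)) (at_left 0)"
      by (rule tendsto_ennrealI[OF sf_dist_rad_tendsto(1)[OF u]])
    then have "((\<lambda>K. samp_dist u K ((V, z), L)) \<longlongrightarrow> samp_dist u 0 ((V, z), L)) (at_left 0)"
      unfolding 0 using ev by (rule Lim_transform_eventually)
    moreover have "\<forall>\<^sub>F K in at_left 0. samp_dist u K ((V, z), L) = \<top> \<longleftrightarrow> samp_dist u 0 ((V, z), L) = \<top>"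
      using ev by eventually_elim (metis 0 ennreal_neq_top)
    ultimately show ?thesis ..
  qed
  then show "((\<lambda>K. samp_dist u K ((V, z), L)) \<longlongrightarrow> samp_dist u 0 ((V, z), L)) (at_left 0)"
    "\<forall>\<^sub>F K in at_left 0. samp_dist u K ((V, z), L) = \<top> \<longleftrightarrow> samp_dist u 0 ((V, z), L) = \<top>" by auto
qed

subsection \<open>Integrals under comparable laws\<close>

lemma integral_le_of_measure_le:
  fixes g :: "'b \<Rightarrow> real"
  assumes p: "prob_space \<mu>" "prob_space \<Lambda>" and s: "sets \<mu> = sets \<Lambda>" and t: "0 \<le> t"
    and le: "\<And>A. A \<in> sets \<mu> \<Longrightarrow> emeasure \<mu> A \<le> ennreal t * emeasure \<Lambda> A"
    and g: "g \<in> borel_measurable \<mu>" "\<And>x. 0 \<le> g x" "\<And>x. g x \<le> B"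
  shows "(\<integral>x. g x \<partial>\<mu>) \<le> t * (\<integral>x. g x \<partial>\<Lambda>)"
proof -
  interpret M: prob_space \<mu> by (rule p)
  interpret L: prob_space \<Lambda> by (rule p)
  have gL: "g \<in> borel_measurable \<Lambda>" using g(1) s by (simp cong: measurable_cong_sets)
  have iM: "integrable \<mu> g" and iL: "integrable \<Lambda> g"
    using g gL by (auto intro!: M.integrable_const_bound[of _ B] L.integrable_const_bound[of _ B])
  have "\<mu> \<le> scale_measure (ennreal t) \<Lambda>"
    using le s by (subst le_measure) auto
  then have "(\<integral>\<^sup>+x. ennreal (g x) \<partial>\<mu>) \<le> (\<integral>\<^sup>+x. ennreal (g x) \<partial>scale_measure (ennreal t) \<Lambda>)"
    by (intro nn_integral_mono_measure) (simp_all add: s)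
  also have "\<dots> = ennreal t * (\<integral>\<^sup>+x. ennreal (g x) \<partial>\<Lambda>)"
    using gL by (intro nn_integral_scale_measure) simp
  finally have "ennreal (\<integral>x. g x \<partial>\<mu>) \<le> ennreal (t * (\<integral>x. g x \<partial>\<Lambda>))"
    using g(2) iM iL t by (simp add: nn_integral_eq_integral ennreal_mult)
  then show ?thesis using t g(2) by (subst (asm) ennreal_le_iff) (auto intro!: mult_nonneg_nonneg integral_nonneg_AE)
qed

text \<open>A one-sided bound suffices: applied to \<open>f + B\<close> and to \<open>B - f\<close>, it bounds the integral from both sides
  because both measures have total mass \<open>1\<close>.\<close>

lemma integral_diff_of_measure_le:
  fixes f :: "'b \<Rightarrow> real"
  assumes p: "prob_space \<mu>" "prob_space \<Lambda>" and s: "sets \<mu> = sets \<Lambda>" and t: "0 \<le> t"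
    and le: "\<And>A. A \<in> sets \<mu> \<Longrightarrow> emeasure \<mu> A \<le> ennreal t * emeasure \<Lambda> A"
    and f: "f \<in> borel_measurable \<mu>" "\<And>x. \<bar>f x\<bar> \<le> B"
  shows "\<bar>(\<integral>x. f x \<partial>\<mu>) - (\<integral>x. f x \<partial>\<Lambda>)\<bar> \<le> (t - 1) * (2 * B)"
proof -
  interpret M: prob_space \<mu> by (rule p)
  interpret L: prob_space \<Lambda> by (rule p)
  have fL: "f \<in> borel_measurable \<Lambda>" using f(1) s by (simp cong: measurable_cong_sets)
  have iM: "integrable \<mu> f" and iL: "integrable \<Lambda> f"
    using f fL by (auto intro!: M.integrable_const_bound[of _ B] L.integrable_const_bound[of _ B])
  have fb: "- B \<le> f x" "f x \<le> B" for x using f(2)[of x] by linarith+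
  have fb0: "0 \<le> f x + B" "f x + B \<le> 2 * B" "0 \<le> B - f x" "B - f x \<le> 2 * B" for x
    using f(2)[of x] by linarith+
  have a: "(\<integral>x. f x + B \<partial>\<mu>) \<le> t * (\<integral>x. f x + B \<partial>\<Lambda>)"
    by (rule integral_le_of_measure_le[OF p s t le, where B="2 * B"]) (use f(1) fb0 in auto)
  have b: "(\<integral>x. B - f x \<partial>\<mu>) \<le> t * (\<integral>x. B - f x \<partial>\<Lambda>)"
    by (rule integral_le_of_measure_le[OF p s t le, where B="2 * B"]) (use f(1) fb0 in auto)
  have "emeasure \<mu> (space \<mu>) \<le> ennreal t * emeasure \<Lambda> (space \<Lambda>)"
    using le[OF sets.top] sets_eq_imp_space_eq[OF s] by simp
  then have t1: "1 \<le> t" by (simp add: M.emeasure_space_1 L.emeasure_space_1)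
  define x where "x = (\<integral>x. f x \<partial>\<mu>)"
  define y where "y = (\<integral>x. f x \<partial>\<Lambda>)"
  have a': "x + B \<le> t * (y + B)" using a iM iL M.prob_space L.prob_space by (simp add: x_def y_def)
  have b': "B - x \<le> t * (B - y)" using b iM iL M.prob_space L.prob_space by (simp add: x_def y_def)
  have "\<bar>y\<bar> \<le> B"
  proof -
    have "y \<le> (\<integral>x. B \<partial>\<Lambda>)" unfolding y_def using iL fb by (intro integral_mono) auto
    moreover have "(\<integral>x. - B \<partial>\<Lambda>) \<le> y" unfolding y_def using iL fb by (intro integral_mono) auto
    ultimately show ?thesis using L.prob_space by (simp add: abs_le_iff)
  qed
  then have "(t - 1) * (y + B) \<le> (t - 1) * (2 * B)" "(t - 1) * (B - y) \<le> (t - 1) * (2 * B)"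
    using t1 by (auto intro!: mult_left_mono)
  then have "\<bar>x - y\<bar> \<le> (t - 1) * (2 * B)" using a' b' by (simp add: algebra_simps abs_le_iff)
  then show ?thesis by (simp add: x_def y_def)
qed

lemma theta_tendsto: "((\<lambda>K. theta K m k u) \<longlongrightarrow> 1) (at_left 0)"
proof -
  have "((\<lambda>K. kap K m u) \<longlongrightarrow> (1 / 1) ^ m) (at_left 0)"
    unfolding kap_def by (intro tendsto_power tendsto_divide lip_hi_tendsto lip_lo_tendsto) simp
  moreover have "((\<lambda>K. cosh (sqrt (- K) * u)) \<longlongrightarrow> cosh (0 * u)) (at_left 0)"
    by (intro tendsto_cosh tendsto_mult sqrt_neg_tendsto tendsto_const)
  ultimately have "((\<lambda>K. cosh (sqrt (- K) * u) ^ k * (kap K m u)\<^sup>2) \<longlongrightarrow> cosh (0 * u) ^ k * ((1 / 1) ^ m)\<^sup>2) (at_left 0)"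
    by (intro tendsto_mult tendsto_power)
  then have "((\<lambda>K. cosh (sqrt (- K) * u) ^ k * (kap K m u)\<^sup>2) \<longlongrightarrow> 1) (at_left 0)" by simp
  moreover have "\<forall>\<^sub>F K in at_left 0. cosh (sqrt (- K) * u) ^ k * (kap K m u)\<^sup>2 = theta K m k u"
    by (rule eventually_at_leftI[of "-1"]) (auto simp: theta_def)
  ultimately show ?thesis by (rule Lim_transform_eventually)
qed

lemma theta_nonneg: "0 \<le> theta K m k u"
  by (simp add: theta_def)

section \<open>Convergence of the law of the distance\<close>

lemma measurable_samp_pair:
  fixes u K :: real
  assumes K: "K \<le> 0" and u: "u > 0" and m: "m \<le> DIM('a::euclidean_space)" and q: "q \<le> DIM('a)"
  shows "(\<lambda>p. (samp_flat K (rad K u) (fst p), model_part K (snd p))) \<in>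
    measurable ((samp m :: ('a set \<times> 'a) measure) \<Otimes>\<^sub>M haar q) (flats_borel K (DIM('a) - m) \<Otimes>\<^sub>M (flats0_borel K q :: 'a set measure))"
proof (rule measurable_Pair)
  show "(\<lambda>p. samp_flat K (rad K u) (fst p)) \<in> measurable ((samp m :: ('a set \<times> 'a) measure) \<Otimes>\<^sub>M haar q) (flats_borel K (DIM('a) - m))"
    by (rule measurable_compose[OF measurable_fst measurable_samp_flat[OF m K u]])
  have "model_part K \<in> measurable (haar q) (flats0_borel K q :: 'a set measure)"
    using measurable_model_part[OF K, of q] by (simp add: sets_haar[OF q] cong: measurable_cong_sets)
  then show "(\<lambda>p. model_part K (snd p)) \<in> measurable ((samp m :: ('a set \<times> 'a) measure) \<Otimes>\<^sub>M haar q) (flats0_borel K q :: 'a set measure)"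
    by (rule measurable_compose[OF measurable_snd])
qed

lemma measurable_samp_dist:
  fixes u K :: real
  assumes K: "K \<le> 0" and u: "u > 0" and m: "m \<le> DIM('a::euclidean_space)" and q: "q \<le> DIM('a)"
  shows "samp_dist u K \<in> borel_measurable ((samp m :: ('a set \<times> 'a) measure) \<Otimes>\<^sub>M (haar q :: 'a set measure))"
proof -
  have "(\<lambda>p. sf_setdist K (samp_flat K (rad K u) (fst p) \<inter> model_part K (snd p))) \<in>
      borel_measurable ((samp m :: ('a set \<times> 'a) measure) \<Otimes>\<^sub>M (haar q :: 'a set measure))"
    using measurable_compose[OF measurable_samp_pair[OF K u m q] measurable_sf_setdist_Int[OF K]] by simp
  then show ?thesis by (simp add: samp_dist_def[abs_def])
qed

lemma prob_space_samp_pair: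
  assumes m: "m \<le> DIM('a::euclidean_space)" and q: "q \<le> DIM('a)"
  shows "prob_space ((samp m :: ('a set \<times> 'a) measure) \<Otimes>\<^sub>M (haar q :: 'a set measure))"
proof -
  interpret S: prob_space "samp m :: ('a set \<times> 'a) measure" by (rule prob_space_samp[OF m])
  interpret H: prob_space "haar q :: 'a set measure" by (rule prob_space_haar[OF q])
  interpret pair_prob_space "samp m :: ('a set \<times> 'a) measure" "haar q :: 'a set measure" ..
  show ?thesis by (rule prob_space_axioms)
qed

text \<open>Almost surely the two linear directions are transversal, and then the flats meet.\<close>

lemma AE_samp_dist_finite:
  assumes u: "u > 0" and mq: "m \<le> q" and q: "q \<le> DIM('a::euclidean_space)"
  shows "AE p in (samp m :: ('a set \<times> 'a) measure) \<Otimes>\<^sub>M (haar q :: 'a set measure). samp_dist u 0 p \<noteq> \<top>"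
proof -
  have m: "m \<le> DIM('a)" using mq q by simp
  interpret S: prob_space "samp m :: ('a set \<times> 'a) measure" by (rule prob_space_samp[OF m])
  interpret H: prob_space "haar q :: 'a set measure" by (rule prob_space_haar[OF q])
  interpret SH: pair_prob_space "samp m :: ('a set \<times> 'a) measure" "haar q :: 'a set measure" ..
  show ?thesis
  proof (rule SH.AE_pair_measure)
    have "{p \<in> space ((samp m :: ('a set \<times> 'a) measure) \<Otimes>\<^sub>M (haar q :: 'a set measure)). samp_dist u 0 p \<in> - {\<top>}} \<in> sets ((samp m :: ('a set \<times> 'a) measure) \<Otimes>\<^sub>M haar q)"
      by (rule measurable_sets_Collect[OF measurable_samp_dist[OF order_refl u m q]]) simp
    then show "{p \<in> space ((samp m :: ('a set \<times> 'a) measure) \<Otimes>\<^sub>M (haar q :: 'a set measure)). samp_dist u 0 p \<noteq> \<top>} \<in> sets ((samp m :: ('a set \<times> 'a) measure) \<Otimes>\<^sub>M haar q)"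
      by simp
    show "AE x in samp m. AE L in (haar q :: 'a set measure). samp_dist u 0 (x, L) \<noteq> \<top>"
    proof (rule AE_I2)
      fix x :: "'a set \<times> 'a" assume "x \<in> space (samp m)"
      then obtain V z where x: "x = (V, z)" "V \<in> subspaces m" by (auto simp: space_samp[OF m])
      have V: "subspace V" using x by (simp add: subspaces_def)
      have "DIM('a) \<le> dim (V\<^sup>\<bottom>) + q" using x(2) dim_perp[OF V] mq by (simp add: subspaces_def)
      then have "AE L in (haar q :: 'a set measure). transv L (V\<^sup>\<bottom>)"
        by (rule AE_haar_transv[OF q subspace_orthogonal_comp])
      then show "AE L in (haar q :: 'a set measure). samp_dist u 0 (x, L) \<noteq> \<top>"
      proof (rule AE_mp, intro AE_I2 impI)
        fix L assume "transv L (V\<^sup>\<bottom>)"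
        then obtain y where "y \<in> L" "- samp_point u (V, z) + y \<in> V\<^sup>\<bottom>" unfolding transv_def by blast
        then have "y \<in> samp_flat 0 (rad 0 u) (V, z) \<inter> model_part 0 L"
          by (simp add: samp_flat_def flat_at_def model_part_def rad_def add.commute)
        then show "samp_dist u 0 (x, L) \<noteq> \<top>"
          unfolding samp_dist_def sf_setdist_eq_top_iff x(1) by auto
      qed
    qed
  qed
qed

lemma emeasure_pair_mono_left:
  assumes "prob_space \<mu>" "prob_space \<Lambda>" "prob_space \<nu>" and s: "sets \<mu> = sets \<Lambda>"
    and le: "\<And>A. A \<in> sets \<mu> \<Longrightarrow> emeasure \<mu> A \<le> t * emeasure \<Lambda> A"
    and S: "S \<in> sets (\<mu> \<Otimes>\<^sub>M \<nu>)"
  shows "emeasure (\<mu> \<Otimes>\<^sub>M \<nu>) S \<le> t * emeasure (\<Lambda> \<Otimes>\<^sub>M \<nu>) S"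
proof -
  interpret M: prob_space \<mu> by fact
  interpret L: prob_space \<Lambda> by fact
  interpret N: prob_space \<nu> by fact
  interpret MN: pair_prob_space \<mu> \<nu> ..
  interpret LN: pair_prob_space \<Lambda> \<nu> ..
  have S': "S \<in> sets (\<Lambda> \<Otimes>\<^sub>M \<nu>)" using S sets_pair_measure_cong[OF s, of \<nu> \<nu>] by simp
  have "emeasure (\<mu> \<Otimes>\<^sub>M \<nu>) S = (\<integral>\<^sup>+y. emeasure \<mu> ((\<lambda>x. (x, y)) -` S) \<partial>\<nu>)"
    by (rule MN.emeasure_pair_measure_alt2[OF S])
  also have "\<dots> \<le> (\<integral>\<^sup>+y. t * emeasure \<Lambda> ((\<lambda>x. (x, y)) -` S) \<partial>\<nu>)"
    by (intro nn_integral_mono le sets_Pair2[OF S])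
  also have "\<dots> = t * (\<integral>\<^sup>+y. emeasure \<Lambda> ((\<lambda>x. (x, y)) -` S) \<partial>\<nu>)"
    by (rule nn_integral_cmult[OF LN.measurable_emeasure_Pair2[OF S']])
  also have "(\<integral>\<^sup>+y. emeasure \<Lambda> ((\<lambda>x. (x, y)) -` S) \<partial>\<nu>) = emeasure (\<Lambda> \<Otimes>\<^sub>M \<nu>) S"
    by (rule LN.emeasure_pair_measure_alt2[OF S', symmetric])
  finally show ?thesis .
qed

text \<open>A bounded function of the distance has, up to an error controlled by \<open>theta\<close>, the expectation
  that it has on the sample space shared by all curvatures.\<close>

lemma expectation_samp:
  fixes E :: "'w \<Rightarrow> 'a::euclidean_space set" and L :: "'w \<Rightarrow> 'a set" and f :: "ennreal \<Rightarrow> real"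
  assumes K: "K \<le> 0" and small: "K < 0 \<Longrightarrow> 0 < 1 + K * (2 * u)\<^sup>2" and u: "u > 0"
    and m: "m \<le> DIM('a)" and q: "q \<le> DIM('a)" and k: "k = DIM('a) - m"
    and P: "prob_space P"
    and dL: "distr P (flats0_borel K q) L = flats0_measure K q"
    and dE: "distr P (flats_borel K k) E = hitting_law K k u"
    and ind: "prob_space.indep_var P (flats_borel K k) E (flats0_borel K q) L"
    and f: "f \<in> borel_measurable borel" "\<And>x. \<bar>f x\<bar> \<le> B"
  shows "(\<lambda>\<omega>. sf_setdist K (E \<omega> \<inter> L \<omega>)) \<in> borel_measurable P"
    and "\<bar>(\<integral>\<omega>. f (sf_setdist K (E \<omega> \<inter> L \<omega>)) \<partial>P) - (\<integral>p. f (samp_dist u K p) \<partial>((samp m :: ('a set \<times> 'a) measure) \<Otimes>\<^sub>M (haar q :: 'a set measure)))\<bar>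
      \<le> (theta K m k u - 1) * (2 * B)"
proof -
  interpret P: prob_space P by (rule P)
  let ?E = "flats_borel K k :: 'a set measure" and ?L = "flats0_borel K q :: 'a set measure"
  have rv: "E \<in> measurable P ?E" "L \<in> measurable P ?L"
    and joint: "distr P ?E E \<Otimes>\<^sub>M distr P ?L L = distr P (?E \<Otimes>\<^sub>M ?L) (\<lambda>\<omega>. (E \<omega>, L \<omega>))"
    using P.indep_var_distribution_eq[of ?E E ?L L] ind by auto
  have EL: "(\<lambda>\<omega>. (E \<omega>, L \<omega>)) \<in> measurable P (?E \<Otimes>\<^sub>M ?L)" using rv by (rule measurable_Pair)
  have dm: "(\<lambda>p. sf_setdist K (fst p \<inter> snd p)) \<in> borel_measurable (?E \<Otimes>\<^sub>M ?L)"
    by (rule measurable_sf_setdist_Int[OF K])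
  show "(\<lambda>\<omega>. sf_setdist K (E \<omega> \<inter> L \<omega>)) \<in> borel_measurable P"
    using measurable_compose[OF EL dm] by simp
  let ?S = "samp m :: ('a set \<times> 'a) measure" and ?H = "haar q :: 'a set measure"
  let ?sf = "samp_flat K (rad K u)"
  define \<Lambda> where "\<Lambda> = distr ?S ?E ?sf"
  define \<mu> where "\<mu> = (hitting_law K k u :: 'a set measure)"
  define \<nu> where "\<nu> = (flats0_measure K q :: 'a set measure)"
  have sfm: "?sf \<in> measurable ?S ?E" unfolding k by (rule measurable_samp_flat[OF m K u])
  have mpm: "model_part K \<in> measurable ?H ?L"
    using measurable_model_part[OF K, of q] by (simp add: sets_haar[OF q] cong: measurable_cong_sets)
  have p\<mu>: "prob_space \<mu>" unfolding \<mu>_def dE[symmetric] by (rule P.prob_space_distr[OF rv(1)])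
  have p\<nu>: "prob_space \<nu>" unfolding \<nu>_def dL[symmetric] by (rule P.prob_space_distr[OF rv(2)])
  have p\<Lambda>: "prob_space \<Lambda>" unfolding \<Lambda>_def by (rule prob_space.prob_space_distr[OF prob_space_samp[OF m] sfm])
  have s\<mu>: "sets \<mu> = sets ?E" by (simp add: \<mu>_def dE[symmetric])
  have s\<nu>: "sets \<nu> = sets ?L" by (simp add: \<nu>_def dL[symmetric])
  have s\<Lambda>: "sets \<Lambda> = sets ?E" by (simp add: \<Lambda>_def)
  have le: "emeasure \<mu> A \<le> ennreal (theta K m k u) * emeasure \<Lambda> A" if "A \<in> sets \<mu>" for A
  proof (cases "K = 0")
    case True
    show ?thesis using law_bound_euclidean[OF u m, of A] p\<mu> that unfolding \<mu>_def \<Lambda>_def True k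
      using s\<mu> unfolding \<mu>_def True k by simp
  next
    case False
    then have K': "K < 0" using K by simp
    show ?thesis using law_bound_hyperbolic[OF K' u m small[OF K'], of A] p\<mu> that s\<mu> unfolding \<mu>_def \<Lambda>_def k by simp
  qed
  interpret M: prob_space \<mu> by (rule p\<mu>)
  interpret N: prob_space \<nu> by (rule p\<nu>)
  interpret La: prob_space \<Lambda> by (rule p\<Lambda>)
  interpret MN: pair_prob_space \<mu> \<nu> ..
  interpret LN: pair_prob_space \<Lambda> \<nu> ..
  have sets_MN: "sets (\<mu> \<Otimes>\<^sub>M \<nu>) = sets (?E \<Otimes>\<^sub>M ?L)" by (rule sets_pair_measure_cong[OF s\<mu> s\<nu>])
  have sets_LN: "sets (\<Lambda> \<Otimes>\<^sub>M \<nu>) = sets (?E \<Otimes>\<^sub>M ?L)" by (rule sets_pair_measure_cong[OF s\<Lambda> s\<nu>])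
  let ?f = "\<lambda>p. f (sf_setdist K (fst p \<inter> snd p))"
  have fm: "?f \<in> borel_measurable (?E \<Otimes>\<^sub>M ?L)" by (rule measurable_compose[OF dm f(1)])
  have "\<bar>(\<integral>p. ?f p \<partial>(\<mu> \<Otimes>\<^sub>M \<nu>)) - (\<integral>p. ?f p \<partial>(\<Lambda> \<Otimes>\<^sub>M \<nu>))\<bar> \<le> (theta K m k u - 1) * (2 * B)"
  proof (rule integral_diff_of_measure_le)
    show "prob_space (\<mu> \<Otimes>\<^sub>M \<nu>)" "prob_space (\<Lambda> \<Otimes>\<^sub>M \<nu>)" by (rule MN.prob_space_axioms LN.prob_space_axioms)+
    show "emeasure (\<mu> \<Otimes>\<^sub>M \<nu>) A \<le> ennreal (theta K m k u) * emeasure (\<Lambda> \<Otimes>\<^sub>M \<nu>) A" if "A \<in> sets (\<mu> \<Otimes>\<^sub>M \<nu>)" for A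
      by (rule emeasure_pair_mono_left[OF p\<mu> p\<Lambda> p\<nu> _ le that]) (simp_all add: s\<mu> s\<Lambda>)
    show "?f \<in> borel_measurable (\<mu> \<Otimes>\<^sub>M \<nu>)" using fm by (simp add: sets_MN cong: measurable_cong_sets)
  qed (simp_all add: sets_MN sets_LN theta_nonneg f(2))
  moreover have "(\<integral>p. ?f p \<partial>(\<mu> \<Otimes>\<^sub>M \<nu>)) = (\<integral>\<omega>. f (sf_setdist K (E \<omega> \<inter> L \<omega>)) \<partial>P)"
    unfolding \<mu>_def \<nu>_def dE[symmetric] dL[symmetric] joint by (subst integral_distr[OF EL fm]) simp
  moreover have "(\<integral>p. ?f p \<partial>(\<Lambda> \<Otimes>\<^sub>M \<nu>)) = (\<integral>p. f (samp_dist u K p) \<partial>(?S \<Otimes>\<^sub>M ?H))"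
  proof -
    have \<nu>': "\<nu> = distr ?H ?L (model_part K)" unfolding \<nu>_def by (rule flats0_measure_eq[OF K q])
    have "\<Lambda> \<Otimes>\<^sub>M \<nu> = distr (?S \<Otimes>\<^sub>M ?H) (?E \<Otimes>\<^sub>M ?L) (\<lambda>(x, y). (?sf x, model_part K y))"
      unfolding \<Lambda>_def \<nu>' by (rule pair_measure_distr[OF sfm mpm]) (use N.sigma_finite_measure_axioms \<nu>' in simp)
    then have "\<Lambda> \<Otimes>\<^sub>M \<nu> = distr (?S \<Otimes>\<^sub>M ?H) (?E \<Otimes>\<^sub>M ?L) (\<lambda>p. (?sf (fst p), model_part K (snd p)))"
      by (simp add: case_prod_beta')
    then show ?thesis
      using integral_distr[OF measurable_samp_pair[OF K u m q, folded k] fm] by (simp add: samp_dist_def)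
  qed
  ultimately show "\<bar>(\<integral>\<omega>. f (sf_setdist K (E \<omega> \<inter> L \<omega>)) \<partial>P) - (\<integral>p. f (samp_dist u K p) \<partial>((samp m :: ('a set \<times> 'a) measure) \<Otimes>\<^sub>M (haar q :: 'a set measure)))\<bar>
      \<le> (theta K m k u - 1) * (2 * B)" by simp
qed

lemma expectation_samp_tendsto:
  fixes f :: "ennreal \<Rightarrow> real" and u :: real
  assumes u: "u > 0" and m: "m \<le> DIM('a::euclidean_space)" and q: "q \<le> DIM('a)"
    and f: "f \<in> borel_measurable borel" "\<And>x. \<bar>f x\<bar> \<le> B"
    and lim: "\<And>p :: ('a set \<times> 'a) \<times> 'a set. subspace (fst (fst p)) \<Longrightarrow> subspace (snd p) \<Longrightarrow>
      ((\<lambda>K. f (samp_dist u K p)) \<longlongrightarrow> f (samp_dist u 0 p)) (at_left 0)"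
  shows "((\<lambda>K. \<integral>p. f (samp_dist u K p) \<partial>((samp m :: ('a set \<times> 'a) measure) \<Otimes>\<^sub>M (haar q :: 'a set measure))) \<longlongrightarrow>
    (\<integral>p. f (samp_dist u 0 p) \<partial>((samp m :: ('a set \<times> 'a) measure) \<Otimes>\<^sub>M haar q))) (at_left 0)"
  unfolding tendsto_at_iff_sequentially
proof (intro allI impI)
  fix X :: "nat \<Rightarrow> real" assume X: "\<forall>i. X i \<in> {..<0} - {0}" "X \<longlonglongrightarrow> 0"
  interpret prob_space "(samp m :: ('a set \<times> 'a) measure) \<Otimes>\<^sub>M (haar q :: 'a set measure)" by (rule prob_space_samp_pair[OF m q])
  have fl: "filterlim X (at_left 0) sequentially"
    using X unfolding filterlim_at by (auto intro: always_eventually simp: less_imp_neq)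
  have meas: "(\<lambda>p. f (samp_dist u K p)) \<in> borel_measurable ((samp m :: ('a set \<times> 'a) measure) \<Otimes>\<^sub>M (haar q :: 'a set measure))" if "K \<le> 0" for K
    by (rule measurable_compose[OF measurable_samp_dist[OF that u m q] f(1)])
  show "((\<lambda>K. \<integral>p. f (samp_dist u K p) \<partial>((samp m :: ('a set \<times> 'a) measure) \<Otimes>\<^sub>M (haar q :: 'a set measure))) \<circ> X) \<longlonglongrightarrow>
    (\<integral>p. f (samp_dist u 0 p) \<partial>((samp m :: ('a set \<times> 'a) measure) \<Otimes>\<^sub>M haar q))"
    unfolding comp_def
  proof (rule integral_dominated_convergence[where w="\<lambda>_. B"])
    show "(\<lambda>p. f (samp_dist u 0 p)) \<in> borel_measurable ((samp m :: ('a set \<times> 'a) measure) \<Otimes>\<^sub>M (haar q :: 'a set measure))"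
      by (rule meas) simp
    show "(\<lambda>p. f (samp_dist u (X i) p)) \<in> borel_measurable ((samp m :: ('a set \<times> 'a) measure) \<Otimes>\<^sub>M (haar q :: 'a set measure))" for i
      using X(1) by (intro meas) (auto simp: less_imp_le)
    show "AE p in (samp m :: ('a set \<times> 'a) measure) \<Otimes>\<^sub>M (haar q :: 'a set measure). (\<lambda>i. f (samp_dist u (X i) p)) \<longlonglongrightarrow> f (samp_dist u 0 p)"
    proof (rule AE_I2)
      fix p assume "p \<in> space ((samp m :: ('a set \<times> 'a) measure) \<Otimes>\<^sub>M (haar q :: 'a set measure))"
      then have "subspace (fst (fst p))" "subspace (snd p)"
        by (auto simp: space_pair_measure space_samp[OF m] space_haar[OF q] subspaces_def)
      from filterlim_compose[OF lim[OF this] fl]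
      show "(\<lambda>i. f (samp_dist u (X i) p)) \<longlonglongrightarrow> f (samp_dist u 0 p)" .
    qed
  qed (use f(2) in auto)
qed

theorem theorem3p6:
  fixes q \<gamma> :: nat and u :: real
    and P :: "real \<Rightarrow> 'w measure"
    and L E :: "real \<Rightarrow> 'w \<Rightarrow> 'a::euclidean_space set"
  assumes "DIM('a) \<ge> 2"
    and "q \<in> {1..DIM('a) - 1}"
    and "\<gamma> \<in> {0..q - 1}"
    and "u > 0"
    and "\<And>K. K \<le> 0 \<Longrightarrow> prob_space (P K)"
    and "\<And>K. K \<le> 0 \<Longrightarrow> L K \<in> measurable (P K) (flats0_borel K q)"
    and "\<And>K. K \<le> 0 \<Longrightarrow> distr (P K) (flats0_borel K q) (L K) = flats0_measure K q"
    and "\<And>K. K \<le> 0 \<Longrightarrow> E K \<in> measurable (P K) (flats_borel K (DIM('a) - q + \<gamma>))"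
    and "\<And>K. K \<le> 0 \<Longrightarrow> distr (P K) (flats_borel K (DIM('a) - q + \<gamma>)) (E K)
                          = hitting_law K (DIM('a) - q + \<gamma>) u"
    and "\<And>K. K \<le> 0 \<Longrightarrow> prob_space.indep_var (P K) (flats_borel K (DIM('a) - q + \<gamma>)) (E K)
                          (flats0_borel K q) (L K)"
  shows "weak_conv_prob (\<lambda>K. distr (P K) borel (\<lambda>\<omega>. sf_setdist K (E K \<omega> \<inter> L K \<omega>)))
           (distr (P 0) borel (\<lambda>\<omega>. sf_setdist 0 (E 0 \<omega> \<inter> L 0 \<omega>))) (at_left 0)
       \<and> ((\<lambda>K. measure (P K) {\<omega> \<in> space (P K). E K \<omega> \<inter> L K \<omega> \<noteq> {}}) \<longlongrightarrow> 1) (at_left 0)"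
proof -
  define m where "m = q - \<gamma>"
  define k where "k = DIM('a) - q + \<gamma>"
  have q: "q \<le> DIM('a)" and m: "m \<le> DIM('a)" and mq: "m \<le> q" and k: "k = DIM('a) - m"
    using assms(1-3) by (auto simp: m_def k_def)
  note u = assms(4)
  let ?Q = "(samp m :: ('a set \<times> 'a) measure) \<Otimes>\<^sub>M (haar q :: 'a set measure)"
  let ?d = "\<lambda>K \<omega>. sf_setdist K (E K \<omega> \<inter> L K \<omega>)"
  have neg: "\<forall>\<^sub>F K in at_left (0::real). K < 0" by (rule eventually_at_leftI[of "-1"]) auto
  have small: "\<forall>\<^sub>F K in at_left 0. 0 < 1 + K * (2 * u)\<^sup>2" by (rule lip_hi_pos_eventually)
  have exp: "?d K \<in> borel_measurable (P K)"
      "\<bar>(\<integral>\<omega>. f (?d K \<omega>) \<partial>P K) - (\<integral>p. f (samp_dist u K p) \<partial>?Q)\<bar> \<le> (theta K m k u - 1) * (2 * B)"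
    if "K \<le> 0" "K < 0 \<Longrightarrow> 0 < 1 + K * (2 * u)\<^sup>2" "f \<in> borel_measurable borel" "\<And>x. \<bar>f x\<bar> \<le> B"
    for K B and f :: "ennreal \<Rightarrow> real"
    by (rule expectation_samp[OF that(1) that(2) u m q k assms(5)[OF that(1)] assms(7)[OF that(1)]
          assms(9)[OF that(1), folded k_def] assms(10)[OF that(1), folded k_def] that(3) that(4)]; assumption)+
  have lim: "((\<lambda>K. \<integral>\<omega>. f (?d K \<omega>) \<partial>P K) \<longlongrightarrow> (\<integral>\<omega>. f (?d 0 \<omega>) \<partial>P 0)) (at_left 0)"
    and at0: "(\<integral>\<omega>. f (?d 0 \<omega>) \<partial>P 0) = (\<integral>p. f (samp_dist u 0 p) \<partial>?Q)"
    if f: "f \<in> borel_measurable borel" "\<And>x. \<bar>f x\<bar> \<le> B"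
      and pw: "\<And>p :: ('a set \<times> 'a) \<times> 'a set. subspace (fst (fst p)) \<Longrightarrow> subspace (snd p) \<Longrightarrow>
      ((\<lambda>K. f (samp_dist u K p)) \<longlongrightarrow> f (samp_dist u 0 p)) (at_left 0)"
    for B and f :: "ennreal \<Rightarrow> real"
  proof -
    have "\<bar>(\<integral>\<omega>. f (?d 0 \<omega>) \<partial>P 0) - (\<integral>p. f (samp_dist u 0 p) \<partial>?Q)\<bar> \<le> (theta 0 m k u - 1) * (2 * B)"
      by (rule exp(2)) (use f in auto)
    then show at0: "(\<integral>\<omega>. f (?d 0 \<omega>) \<partial>P 0) = (\<integral>p. f (samp_dist u 0 p) \<partial>?Q)"
      by (simp add: theta_def)
    have ev: "\<forall>\<^sub>F K in at_left 0. norm ((\<integral>\<omega>. f (?d K \<omega>) \<partial>P K) - (\<integral>p. f (samp_dist u K p) \<partial>?Q))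
        \<le> (theta K m k u - 1) * (2 * B)"
      using neg small
    proof eventually_elim
      case (elim K)
      show ?case unfolding real_norm_def by (rule exp(2)) (use elim f in auto)
    qed
    have "((\<lambda>K. (theta K m k u - 1) * (2 * B)) \<longlongrightarrow> (1 - 1) * (2 * B)) (at_left 0)"
      by (intro tendsto_mult tendsto_diff theta_tendsto tendsto_const)
    then have "((\<lambda>K. (theta K m k u - 1) * (2 * B)) \<longlongrightarrow> 0) (at_left 0)" by simp
    with ev have "((\<lambda>K. (\<integral>\<omega>. f (?d K \<omega>) \<partial>P K) - (\<integral>p. f (samp_dist u K p) \<partial>?Q)) \<longlongrightarrow> 0) (at_left 0)"
      by (rule Lim_null_comparison)
    from tendsto_add[OF this expectation_samp_tendsto[OF u m q f pw]]
    show "((\<lambda>K. \<integral>\<omega>. f (?d K \<omega>) \<partial>P K) \<longlongrightarrow> (\<integral>\<omega>. f (?d 0 \<omega>) \<partial>P 0)) (at_left 0)"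
      unfolding at0 by simp
  qed
  have meas: "?d K \<in> borel_measurable (P K)" if "K = 0 \<or> K < 0 \<and> 0 < 1 + K * (2 * u)\<^sup>2" for K
    by (rule exp(1)[of K "\<lambda>_. 0" 0]) (use that in auto)
  have weak: "weak_conv_prob (\<lambda>K. distr (P K) borel (?d K)) (distr (P 0) borel (?d 0)) (at_left 0)"
    unfolding weak_conv_prob_def
  proof (intro conjI allI impI)
    show "\<forall>\<^sub>F K in at_left 0. prob_space (distr (P K) borel (?d K)) \<and> sets (distr (P K) borel (?d K)) = sets borel"
      using neg small
    proof eventually_elim
      case (elim K)
      then show ?case using prob_space.prob_space_distr[OF assms(5)[of K] meas[of K]] by auto
    qed
    show "prob_space (distr (P 0) borel (?d 0))"
      using prob_space.prob_space_distr[OF assms(5)[of 0] meas[of 0]] by auto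
    show "sets (distr (P 0) borel (?d 0)) = sets borel" by simp
    fix f :: "ennreal \<Rightarrow> real" assume f: "continuous_on UNIV f \<and> bounded (range f)"
    have fm: "f \<in> borel_measurable borel" using f by (simp add: borel_measurable_continuous_onI)
    obtain B where B: "\<And>x. \<bar>f x\<bar> \<le> B" using f by (auto simp: bounded_iff)
    have "((\<lambda>K. \<integral>\<omega>. f (?d K \<omega>) \<partial>P K) \<longlongrightarrow> (\<integral>\<omega>. f (?d 0 \<omega>) \<partial>P 0)) (at_left 0)"
    proof (rule lim[OF fm B])
      fix p :: "('a set \<times> 'a) \<times> 'a set"
      assume p: "subspace (fst (fst p))" "subspace (snd p)"
      have "((\<lambda>K. samp_dist u K p) \<longlongrightarrow> samp_dist u 0 p) (at_left 0)"
        using samp_dist_tendsto(1)[OF p u, of "snd (fst p)"] by simp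
      moreover have "isCont f (samp_dist u 0 p)" using f by (simp add: continuous_on_eq_continuous_at)
      ultimately show "((\<lambda>K. f (samp_dist u K p)) \<longlongrightarrow> f (samp_dist u 0 p)) (at_left 0)"
        by (rule isCont_tendsto_compose[rotated])
    qed
    moreover have "(\<integral>x. f x \<partial>distr (P K) borel (?d K)) = (\<integral>\<omega>. f (?d K \<omega>) \<partial>P K)"
      if "K = 0 \<or> K < 0 \<and> 0 < 1 + K * (2 * u)\<^sup>2" for K
      by (rule integral_distr[OF meas[OF that] fm])
    moreover have "\<forall>\<^sub>F K in at_left 0. K = 0 \<or> K < 0 \<and> 0 < 1 + K * (2 * u)\<^sup>2"
      using neg small by eventually_elim simp
    ultimately show "((\<lambda>K. \<integral>x. f x \<partial>distr (P K) borel (?d K)) \<longlongrightarrow> (\<integral>x. f x \<partial>distr (P 0) borel (?d 0))) (at_left 0)"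
      by (auto elim!: Lim_transform_eventually eventually_mono)
  qed
  \<comment> \<open>The intersection is non-empty iff the distance is finite. The indicator is not continuous, but at a
    fixed sample its value is eventually constant as \<open>K\<close> tends to \<open>0\<close>.\<close>
  let ?g = "indicator (- {\<top>}) :: ennreal \<Rightarrow> real"
  have gm: "?g \<in> borel_measurable borel" by (intro borel_measurable_indicator) simp
  have g1: "\<bar>?g x\<bar> \<le> 1" for x by (simp add: indicator_def)
  have pw: "((\<lambda>K. ?g (samp_dist u K p)) \<longlongrightarrow> ?g (samp_dist u 0 p)) (at_left 0)"
    if "subspace (fst (fst p))" "subspace (snd p)" for p :: "('a set \<times> 'a) \<times> 'a set"
  proof (rule tendsto_eventually)
    show "\<forall>\<^sub>F K in at_left 0. ?g (samp_dist u K p) = ?g (samp_dist u 0 p)"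
      using samp_dist_tendsto(2)[OF that u, of "snd (fst p)"] by eventually_elim (simp add: indicator_def)
  qed
  interpret Q: prob_space ?Q by (rule prob_space_samp_pair[OF m q])
  have "(\<integral>p. ?g (samp_dist u 0 p) \<partial>?Q) = (\<integral>p. 1 \<partial>?Q)"
  proof (rule integral_cong_AE)
    show "(\<lambda>p. ?g (samp_dist u 0 p)) \<in> borel_measurable ?Q"
      by (rule measurable_compose[OF measurable_samp_dist[OF order_refl u m q] gm])
    show "AE p in ?Q. ?g (samp_dist u 0 p) = 1"
      using AE_samp_dist_finite[OF u mq q] by eventually_elim (simp add: indicator_def)
  qed simp
  then have one: "(\<integral>\<omega>. ?g (?d 0 \<omega>) \<partial>P 0) = 1" using at0[OF gm g1 pw] by (simp add: Q.prob_space)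
  have hit: "(\<integral>\<omega>. ?g (?d K \<omega>) \<partial>P K) = measure (P K) {\<omega> \<in> space (P K). E K \<omega> \<inter> L K \<omega> \<noteq> {}}"
    if K: "K < 0 \<and> 0 < 1 + K * (2 * u)\<^sup>2" for K
  proof -
    have "(\<integral>\<omega>. ?g (?d K \<omega>) \<partial>P K) = (\<integral>\<omega>. indicator {\<omega> \<in> space (P K). E K \<omega> \<inter> L K \<omega> \<noteq> {}} \<omega> \<partial>P K)"
      by (intro Bochner_Integration.integral_cong) (auto simp: indicator_def sf_setdist_eq_top_iff)
    also have "\<dots> = measure (P K) ({\<omega> \<in> space (P K). E K \<omega> \<inter> L K \<omega> \<noteq> {}} \<inter> space (P K))"
      by (rule Bochner_Integration.integral_indicator)
    also have "{\<omega> \<in> space (P K). E K \<omega> \<inter> L K \<omega> \<noteq> {}} \<inter> space (P K) = {\<omega> \<in> space (P K). E K \<omega> \<inter> L K \<omega> \<noteq> {}}"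
      by auto
    finally show ?thesis .
  qed
  have "((\<lambda>K. measure (P K) {\<omega> \<in> space (P K). E K \<omega> \<inter> L K \<omega> \<noteq> {}}) \<longlongrightarrow> 1) (at_left 0)"
  proof (rule Lim_transform_eventually)
    show "((\<lambda>K. \<integral>\<omega>. ?g (?d K \<omega>) \<partial>P K) \<longlongrightarrow> 1) (at_left 0)" using lim[OF gm g1 pw] one by simp
    show "\<forall>\<^sub>F K in at_left 0. (\<integral>\<omega>. ?g (?d K \<omega>) \<partial>P K) = measure (P K) {\<omega> \<in> space (P K). E K \<omega> \<inter> L K \<omega> \<noteq> {}}"
      using neg small by eventually_elim (simp add: hit)
  qed
  with weak show ?thesis ..
qed

end
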